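(* Consider the $1$-out $2$-complex $S_2(n,1)$. For any finite abelian group $G$, \[\lim_{n\to\infty}\frac{\log \mathbb{E}|Z^1(S_2(n,1),G)|}{n^2}=0.\] For any prime $p$, \[\frac{\dim H_1(S_2(n,1),\mathbb{F}_p)}{n^2}\] converges to zero in probability as $n\to\infty$. Moreover, \[\frac{\mathrm{mg}(H_1(S_2(n,1),\mathbb{Z}))}{n^2}\] converges to zero in probability as $n\to\infty$.
   Context: For a group $\Gamma$, $\mathrm{mg}(\Gamma)$ denotes the minimum number of generators of $\Gamma$. The random $1$-out $2$-complex $S_2(n,1)$ is the random $2$-dimensional simplicial complex on the vertex set $[n]=\{1,\dots,n\}$ defined as follows. Start with the complete graph on $[n]$; independently for each edge $\{u,v\}\in\binom{[n]}{2}$, choose a third vertex $w$ from $[n]\setminus\{u,v\}$ uniformly at random and add the triangular face $\{u,v,w\}$ to the complex. If a triangular face is chosen at multiple edges, only one copy of that face is kept. For a simplicial complex $X$ on $[n]$ with complete $1$-skeleton, $Z^1(X,G)$ is the group of $1$-cocycles with coefficients in $G$, i.e., the functions $f:\{(u,v)\in[n]^2: u\ne v\}\to G$ with $f(u,v)=-f(v,u)$ for all $u\neq v$, and $f(u,v)+f(v,w)+f(w,u)=0$ for every triangular face $\{u,v,w\}$ of $X$. *)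

theory Defs
  imports
    "HOL-Probability.Probability"
    "HOL-Number_Theory.Residues"
    "HOL-Algebra.IntRing"
    "HOL-Algebra.Generated_Groups"
    "Jordan_Normal_Form.Missing_VectorSpace"
begin

section \<open>Simplicial homology with coefficients in a commutative ring\<close>

text \<open>
  A finite abstract simplicial complex is represented by the set of its nonempty faces.
  The total order on the vertices orients the faces.
\<close>

definition simplices :: "'v set set \<Rightarrow> nat \<Rightarrow> 'v set set" where
  "simplices K k = {\<sigma> \<in> K. card \<sigma> = Suc k}"

definition chain_module :: "('a, 'm) ring_scheme \<Rightarrow> 'v set set \<Rightarrow> nat \<Rightarrow> ('a, 'v set \<Rightarrow> 'a) module"
  where "chain_module R K k =
    \<lparr>carrier = simplices K k \<rightarrow>\<^sub>E carrier R,
     mult = undefined, one = undefined,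
     zero = (\<lambda>\<sigma>\<in>simplices K k. \<zero>\<^bsub>R\<^esub>),
     add = (\<lambda>c d. \<lambda>\<sigma>\<in>simplices K k. c \<sigma> \<oplus>\<^bsub>R\<^esub> d \<sigma>),
     smult = (\<lambda>r c. \<lambda>\<sigma>\<in>simplices K k. r \<otimes>\<^bsub>R\<^esub> c \<sigma>)\<rparr>"

text \<open>
  The boundary map from \<open>(k + 1)\<close>-chains to \<open>k\<close>-chains, given by its value at each \<open>k\<close>-face \<open>\<tau>\<close>.
  In the increasing enumeration of the face \<open>insert v \<tau>\<close> the vertex \<open>v\<close> has
  index \<open>card {u \<in> \<tau>. u < v}\<close>, counted from 0.
\<close>

definition boundary ::
    "('a, 'm) ring_scheme \<Rightarrow> 'v::linorder set set \<Rightarrow> nat \<Rightarrow> ('v set \<Rightarrow> 'a) \<Rightarrow> ('v set \<Rightarrow> 'a)"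
  where "boundary R K k c =
    (\<lambda>\<tau>\<in>simplices K k.
       \<Oplus>\<^bsub>R\<^esub>v\<in>{v. v \<notin> \<tau> \<and> insert v \<tau> \<in> K}.
         ((\<ominus>\<^bsub>R\<^esub> \<one>\<^bsub>R\<^esub>) [^]\<^bsub>R\<^esub> card {u \<in> \<tau>. u < v}) \<otimes>\<^bsub>R\<^esub> c (insert v \<tau>))"

fun cycles :: "('a, 'm) ring_scheme \<Rightarrow> 'v::linorder set set \<Rightarrow> nat \<Rightarrow> ('v set \<Rightarrow> 'a) set" where
  "cycles R K 0 = carrier (chain_module R K 0)"
| "cycles R K (Suc k) =
     {c \<in> carrier (chain_module R K (Suc k)). boundary R K k c = \<zero>\<^bsub>chain_module R K k\<^esub>}"

definition boundaries ::
    "('a, 'm) ring_scheme \<Rightarrow> 'v::linorder set set \<Rightarrow> nat \<Rightarrow> ('v set \<Rightarrow> 'a) set"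
  where "boundaries R K k = boundary R K k ` carrier (chain_module R K (Suc k))"

definition quotient_module :: "('a, 'b, 'm) module_scheme \<Rightarrow> 'b set \<Rightarrow> ('a, 'b set) module" where
  "quotient_module M N =
    \<lparr>carrier = a_rcosets\<^bsub>M\<^esub> N,
     mult = undefined, one = undefined,
     zero = N,
     add = (\<lambda>A B. A <+>\<^bsub>M\<^esub> B),
     smult = (\<lambda>r A. \<Union>x\<in>A. N +>\<^bsub>M\<^esub> (r \<odot>\<^bsub>M\<^esub> x))\<rparr>"

definition homology ::
    "('a, 'm) ring_scheme \<Rightarrow> 'v::linorder set set \<Rightarrow> nat \<Rightarrow> ('a, ('v set \<Rightarrow> 'a) set) module"
  where "homology R K k =
    quotient_module ((chain_module R K k)\<lparr>carrier := cycles R K k\<rparr>) (boundaries R K k)"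


section \<open>Minimum number of generators\<close>

text \<open>Only meaningful for finitely generated groups.\<close>

definition min_generators :: "('g, 'm) monoid_scheme \<Rightarrow> nat" where
  "min_generators G =
    (LEAST m. \<exists>S. finite S \<and> card S = m \<and> S \<subseteq> carrier G \<and> generate G S = carrier G)"


section \<open>Cocycles\<close>

text \<open>
  The coefficient group is written multiplicatively, and \<open>K\<close> is meant to be a complex on
  \<open>{1..n}\<close> with complete 1-skeleton.
\<close>

definition cocycles1 :: "nat \<Rightarrow> nat set set \<Rightarrow> ('g, 'm) monoid_scheme \<Rightarrow> (nat \<times> nat \<Rightarrow> 'g) set"
  where "cocycles1 n K G =
    {f \<in> {(u, v). u \<in> {1..n} \<and> v \<in> {1..n} \<and> u \<noteq> v} \<rightarrow>\<^sub>E carrier G.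
       (\<forall>u\<in>{1..n}. \<forall>v\<in>{1..n}. u \<noteq> v \<longrightarrow> f (u, v) = inv\<^bsub>G\<^esub> f (v, u)) \<and>
       (\<forall>u v w. {u, v, w} \<in> K \<and> card {u, v, w} = 3 \<longrightarrow>
          f (u, v) \<otimes>\<^bsub>G\<^esub> f (v, w) \<otimes>\<^bsub>G\<^esub> f (w, u) = \<one>\<^bsub>G\<^esub>)}"


section \<open>The random 1-out 2-complex\<close>

definition edges :: "nat \<Rightarrow> nat set set" where
  "edges n = {e. e \<subseteq> {1..n} \<and> card e = 2}"

definition one_out_complex :: "nat \<Rightarrow> (nat set \<Rightarrow> nat) \<Rightarrow> nat set set" where
  "one_out_complex n w =
    {{v} |v. v \<in> {1..n}} \<union> edges n \<union> {insert (w e) e |e. e \<in> edges n}"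

text \<open>
  For \<open>n = 2\<close> the single edge has no third vertex, so the distribution is only meaningful for
  the other values of \<open>n\<close>.
\<close>

definition S2 :: "nat \<Rightarrow> nat set set pmf" where
  "S2 n = map_pmf (one_out_complex n)
            (Pi_pmf (edges n) undefined (\<lambda>e. pmf_of_set ({1..n} - e)))"


section \<open>Convergence in probability\<close>

text \<open>The random variables may live on different probability spaces.\<close>

definition tendsto_in_prob :: "(nat \<Rightarrow> 'a pmf) \<Rightarrow> (nat \<Rightarrow> 'a \<Rightarrow> real) \<Rightarrow> real \<Rightarrow> bool" where
  "tendsto_in_prob P Y c \<longleftrightarrow>
    (\<forall>\<epsilon>>0. (\<lambda>n. measure_pmf.prob (P n) {x. \<bar>Y n x - c\<bar> > \<epsilon>}) \<longlonglongrightarrow> 0)"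

end

(*
  Upper bound for E|Z^1|: the expectation is the sum over all antisymmetric f of the product over the
  edges {u,v} of the fraction of w with f(u,w) + f(w,v) = f(u,v). Sample m vertices w_1, ..., w_m.
  For a suitable sample, the empirical fractions approximate the true ones on average over the
  edges, and they depend only on r(u,i) = f(u,w_i), which takes at most |G|^(nm) values. For fixed r,
  the empirical fractions on an edge form a probability distribution in the value of f on that edge,
  so the sum over f of their product is 1. Hence E|Z^1| is at most exp(o(n^2)).

  Homology: H_1 is generated by the edges avoiding the vertex 1, subject to one relation of l1-norm
  at most 3 for each face. Modulo p, a basis among these edges has size at most log_p |Z^1(F_p)|,
  which Markov's inequality controls. Over the integers, adjoin such bases for all primes p < P. The
  quotient by them is a finite group of order prime to every p < P, and it has exp(O(n^2))
  elements because its relations are short. Hence O(n^2 / log P) further edges generate it.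
*)

theory Submission
  imports Defs "HOL-Library.Function_Algebras"
begin

section \<open>Approximating frequencies by a sample\<close>

text \<open>The chosen vertices are independent over the edges, but the equation at
  \<open>{u, v}\<close> involves the values of \<open>f\<close> on many other edges, so the sum over
  \<open>f\<close> does not factor by itself; decoupling the edges is the purpose of the sample.
  Averaging over samples controls sums of errors, whereas products must be compared, so the estimate
  passes to logarithms. A shift \<open>d > 0\<close> keeps these finite where a fraction is 0 and
  costs only a factor \<open>1 + |G| d\<close> per edge.

  For integral homology, Markov's inequality can treat only finitely many primes fixed in advance,
  while the prime that decides the number of generators may grow with \<open>n\<close>. Hence the
  cutoff \<open>P\<close> is fixed before \<open>n\<close> tends to infinity. Large primes are not
  examined individually: each generator that they force multiplies the order of the remaining
  quotient by at least \<open>P\<close>, and that order is bounded without any randomness.\<close>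

definition lists_of :: "nat \<Rightarrow> 'a set \<Rightarrow> 'a list set" where
  "lists_of m A = {xs. set xs \<subseteq> A \<and> length xs = m}"

lemma finite_lists_of: "finite A \<Longrightarrow> finite (lists_of m A)"
  unfolding lists_of_def by (rule finite_lists_length_eq)

lemma card_lists_of: "finite A \<Longrightarrow> card (lists_of m A) = card A ^ m"
  unfolding lists_of_def by (rule card_lists_length_eq)

lemma sum_lists_of_Suc:
  "(\<Sum>ws\<in>lists_of (Suc m) A. g ws) = (\<Sum>ws\<in>lists_of m A. \<Sum>w\<in>A. g (w # ws))"
proof -
  have "lists_of (Suc m) A = (\<lambda>(w, ws). w # ws) ` (A \<times> lists_of m A)"
    by (auto simp: lists_of_def length_Suc_conv image_iff)
  moreover have "inj_on (\<lambda>(w, ws). w # ws) (A \<times> lists_of m A)"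
    by (auto simp: inj_on_def)
  ultimately have "(\<Sum>ws\<in>lists_of (Suc m) A. g ws) = (\<Sum>(w, ws)\<in>A \<times> lists_of m A. g (w # ws))"
    by (simp add: sum.reindex case_prod_unfold comp_def)
  also have "\<dots> = (\<Sum>w\<in>A. \<Sum>ws\<in>lists_of m A. g (w # ws))"
    by (rule sum.cartesian_product[symmetric])
  also have "\<dots> = (\<Sum>ws\<in>lists_of m A. \<Sum>w\<in>A. g (w # ws))"
    by (rule sum.swap)
  finally show ?thesis .
qed

text \<open>The variance of a sum of \<open>m\<close> independent centred draws, kept as an
  unnormalised sum over all lists. Prepending \<open>w\<close> to \<open>ws\<close> creates the
  cross term \<open>2 * sum_list (map x ws) * x w\<close>, which the mean-zero hypothesis
  removes.\<close>

lemma sample_second_moment: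
  fixes x :: "'a \<Rightarrow> real"
  assumes A: "finite A" and mean: "(\<Sum>w\<in>A. x w) = 0" and bd: "\<And>w. w \<in> A \<Longrightarrow> \<bar>x w\<bar> \<le> 1"
  shows "(\<Sum>ws\<in>lists_of m A. (sum_list (map x ws))\<^sup>2) \<le> real m * real (card A) ^ m"
proof (induction m)
  case 0
  have "lists_of 0 A = {[]}" by (auto simp: lists_of_def)
  then show ?case by simp
next
  case (Suc m)
  have sq: "(\<Sum>w\<in>A. (x w)\<^sup>2) \<le> real (card A)"
    using sum_mono[of A "\<lambda>w. (x w)\<^sup>2" "\<lambda>_. 1"] bd by (simp add: abs_square_le_1)
  have "(\<Sum>ws\<in>lists_of (Suc m) A. (sum_list (map x ws))\<^sup>2)
      = (\<Sum>ws\<in>lists_of m A. \<Sum>w\<in>A. (x w)\<^sup>2 + 2 * sum_list (map x ws) * x w + (sum_list (map x ws))\<^sup>2)"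
    by (simp add: sum_lists_of_Suc power2_sum algebra_simps)
  also have "\<dots> = (\<Sum>ws\<in>lists_of m A. (\<Sum>w\<in>A. (x w)\<^sup>2) + real (card A) * (sum_list (map x ws))\<^sup>2)"
    by (simp add: sum.distrib mean flip: sum_distrib_left)
  also have "\<dots> = real (card A) ^ m * (\<Sum>w\<in>A. (x w)\<^sup>2)
      + real (card A) * (\<Sum>ws\<in>lists_of m A. (sum_list (map x ws))\<^sup>2)"
    by (simp add: sum.distrib card_lists_of[OF A] flip: sum_distrib_left)
  also have "\<dots> \<le> real (card A) ^ m * real (card A) + real (card A) * (real m * real (card A) ^ m)"
    by (intro add_mono mult_left_mono sq Suc.IH) auto
  also have "\<dots> = real (Suc m) * real (card A) ^ Suc m"
    by (simp add: algebra_simps)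
  finally show ?case .
qed

definition freq :: "('a \<Rightarrow> bool) \<Rightarrow> 'a list \<Rightarrow> real" where
  "freq s ws = real (length (filter s ws)) / real (length ws)"

lemma freq_nonneg: "freq s ws \<ge> 0"
  by (simp add: freq_def)

text \<open>The centred indicator of \<open>s\<close> is bounded by 1 whatever \<open>s\<close> is,
  so the second moment gives a mean error of \<open>1 / sqrt m\<close> uniformly in
  \<open>s\<close>. This lets one sample size serve all edges and all \<open>f\<close>.\<close>

lemma sample_abs_deviation:
  fixes s :: "'a \<Rightarrow> bool"
  assumes A: "finite A" "A \<noteq> {}" and m: "m > 0"
  defines "t \<equiv> real (card {w\<in>A. s w}) / real (card A)"
  shows "(\<Sum>ws\<in>lists_of m A. \<bar>t - freq s ws\<bar>) \<le> real (card A) ^ m / sqrt (real m)"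
proof -
  define x where "x = (\<lambda>w. of_bool (s w) - t)"
  have cA: "real (card A) > 0" using A by (simp add: card_gt_0_iff)
  have t: "0 \<le> t" "t \<le> 1"
    using cA card_mono[of A "{w\<in>A. s w}"] A by (auto simp: t_def)
  have "(\<Sum>w\<in>A. x w) = real (card {w\<in>A. s w}) - real (card A) * t"
    using A by (simp add: x_def sum_subtractf of_bool_def sum.If_cases Int_def)
  then have mean: "(\<Sum>w\<in>A. x w) = 0" using cA by (simp add: t_def)
  have bd: "\<bar>x w\<bar> \<le> 1" for w using t by (auto simp: x_def)
  have dev: "sum_list (map x ws) = real (length (filter s ws)) - real (length ws) * t" for ws
    by (induction ws) (auto simp: x_def algebra_simps)
  have sq: "sqrt (real m) > 0" using m by simp
  have each: "\<bar>t - freq s ws\<bar> \<le> (sum_list (map x ws))\<^sup>2 / (2 * real m * sqrt (real m)) + 1 / (2 * sqrt (real m))"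
    if "ws \<in> lists_of m A" for ws
  proof -
    have len: "length ws = m" using that by (simp add: lists_of_def)
    define y where "y = sum_list (map x ws)"
    have *: "\<bar>t - freq s ws\<bar> = \<bar>y\<bar> / real m"
      using m by (simp add: y_def dev freq_def len field_simps abs_minus_commute abs_divide flip: abs_mult)
    \<comment> \<open>AM-GM in place of Cauchy-Schwarz. With \<open>sqrt m\<close> as the typical
      size of \<open>y\<close>, both summands of the bound end up as \<open>1 / (2 * sqrt m)\<close>
      on average.\<close>
    have "0 \<le> (\<bar>y\<bar> - sqrt (real m))\<^sup>2" by simp
    then have "2 * \<bar>y\<bar> * sqrt (real m) \<le> y\<^sup>2 + real m"
      by (simp add: power2_diff)
    then have "2 * \<bar>y\<bar> * sqrt (real m) / (2 * real m * sqrt (real m)) \<le> (y\<^sup>2 + real m) / (2 * real m * sqrt (real m))"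
      by (intro divide_right_mono) auto
    then show ?thesis
      using m sq by (simp add: * add_divide_distrib flip: y_def)
  qed
  have "(\<Sum>ws\<in>lists_of m A. \<bar>t - freq s ws\<bar>)
      \<le> (\<Sum>ws\<in>lists_of m A. (sum_list (map x ws))\<^sup>2 / (2 * real m * sqrt (real m)) + 1 / (2 * sqrt (real m)))"
    by (rule sum_mono) (rule each)
  also have "\<dots> = (\<Sum>ws\<in>lists_of m A. (sum_list (map x ws))\<^sup>2) / (2 * real m * sqrt (real m))
       + real (card A) ^ m / (2 * sqrt (real m))"
    by (simp add: sum.distrib sum_divide_distrib card_lists_of[OF A(1)])
  also have "\<dots> \<le> (real m * real (card A) ^ m) / (2 * real m * sqrt (real m)) + real (card A) ^ m / (2 * sqrt (real m))"
    by (intro add_mono divide_right_mono sample_second_moment A mean bd) auto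
  also have "\<dots> = real (card A) ^ m / sqrt (real m)"
    using m by (simp add: field_simps)
  finally show ?thesis .
qed

text \<open>After the shift by \<open>d\<close> the logarithm is Lipschitz with constant
  \<open>1 / d\<close> on the nonnegative reals, 0 included, so errors in frequencies become errors
  in logarithms of products.\<close>

lemma ln_add_diff_le:
  fixes x y d :: real
  assumes "0 \<le> x" "0 \<le> y" "0 < d"
  shows "ln (x + d) - ln (y + d) \<le> \<bar>x - y\<bar> / d"
proof -
  have "ln (x + d) - ln (y + d) = ln ((x + d) / (y + d))"
    using assms by (simp add: ln_div)
  also have "\<dots> \<le> (x + d) / (y + d) - 1"
    using assms by (intro ln_le_minus_one) (auto intro!: divide_pos_pos)
  also have "\<dots> = (x - y) / (y + d)" using assms by (simp add: field_simps)
  also have "\<dots> \<le> \<bar>x - y\<bar> / (y + d)" using assms by (intro divide_right_mono) auto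
  also have "\<dots> \<le> \<bar>x - y\<bar> / d" using assms by (intro divide_left_mono) auto
  finally show ?thesis .
qed

text \<open>Averaged over all lists, the sum over \<open>E\<close> of the log-ratios is at most the
  stated exponent, so some list does no worse than the average. A single list must serve the whole
  product, hence the averaging of the total \<open>D\<close> rather than a choice for each
  edge.\<close>

lemma exists_good_sample:
  fixes s :: "'e \<Rightarrow> 'a \<Rightarrow> bool"
  assumes E: "finite E" and A: "finite A" "A \<noteq> {}" and m: "m > 0" and d: "d > 0"
  defines "t \<equiv> \<lambda>e. real (card {w\<in>A. s e w}) / real (card A)"
  shows "\<exists>ws\<in>lists_of m A. (\<Prod>e\<in>E. t e + d)
           \<le> exp (real (card E) / (d * sqrt (real m))) * (\<Prod>e\<in>E. freq (s e) ws + d)"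
proof -
  define D where "D = (\<lambda>ws. \<Sum>e\<in>E. ln (t e + d) - ln (freq (s e) ws + d))"
  define B where "B = real (card E) / (d * sqrt (real m))"
  have t0: "t e \<ge> 0" for e by (simp add: t_def)
  have "(\<Sum>ws\<in>lists_of m A. D ws) = (\<Sum>e\<in>E. \<Sum>ws\<in>lists_of m A. ln (t e + d) - ln (freq (s e) ws + d))"
    unfolding D_def by (rule sum.swap)
  also have "\<dots> \<le> (\<Sum>e\<in>E. \<Sum>ws\<in>lists_of m A. \<bar>t e - freq (s e) ws\<bar> / d)"
    by (intro sum_mono ln_add_diff_le t0 freq_nonneg d)
  also have "\<dots> \<le> (\<Sum>e\<in>E. (real (card A) ^ m / sqrt (real m)) / d)"
  proof (rule sum_mono)
    fix e
    show "(\<Sum>ws\<in>lists_of m A. \<bar>t e - freq (s e) ws\<bar> / d) \<le> (real (card A) ^ m / sqrt (real m)) / d"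
      unfolding t_def sum_divide_distrib[symmetric]
      using d by (intro divide_right_mono sample_abs_deviation A m) auto
  qed
  also have "\<dots> = (\<Sum>ws\<in>lists_of m A. B)"
    by (simp add: B_def card_lists_of[OF A(1)] field_simps)
  finally have le: "(\<Sum>ws\<in>lists_of m A. D ws) \<le> (\<Sum>ws\<in>lists_of m A. B)" .
  have "card (lists_of m A) \<noteq> 0" using A by (simp add: card_lists_of)
  then have ne: "lists_of m A \<noteq> {}" by auto
  have "\<exists>ws\<in>lists_of m A. D ws \<le> B"
  proof (rule ccontr)
    assume "\<not> ?thesis"
    then have "(\<Sum>ws\<in>lists_of m A. B) < (\<Sum>ws\<in>lists_of m A. D ws)"
      by (intro sum_strict_mono ne finite_lists_of A) auto
    with le show False by simp
  qed
  then obtain ws where ws: "ws \<in> lists_of m A" "D ws \<le> B" by blast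
  have p: "t e + d > 0" "freq (s e) ws + d > 0" for e
    using t0[of e] freq_nonneg[of "s e" ws] d by auto
  have "(\<Prod>e\<in>E. t e + d) = exp (\<Sum>e\<in>E. ln (t e + d))"
    using p E by (simp add: exp_sum)
  also have "\<dots> \<le> exp (B + (\<Sum>e\<in>E. ln (freq (s e) ws + d)))"
    using ws(2) by (simp add: D_def sum_subtractf)
  also have "\<dots> = exp B * (\<Prod>e\<in>E. freq (s e) ws + d)"
    using p E by (simp add: exp_add exp_sum)
  finally show ?thesis using ws(1) by (auto simp: B_def)
qed

section \<open>The expected number of cocycles\<close>

lemma finite_edges [simp]: "finite (edges n)"
  by (rule finite_subset[of _ "Pow {1..n}"]) (auto simp: edges_def)

lemma edgesE:
  assumes "e \<in> edges n"
  obtains u v where "e = {u, v}" "u < v" "u \<in> {1..n}" "v \<in> {1..n}" "Min e = u" "Max e = v"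
proof -
  from assms obtain a b where ab: "e = {a, b}" "a \<noteq> b" "{a, b} \<subseteq> {1..n}"
    by (auto simp: edges_def card_2_iff)
  show ?thesis
  proof (cases "a < b")
    case True then show ?thesis using ab by (intro that[of a b]) auto
  next
    case False then show ?thesis using ab by (intro that[of b a]) auto
  qed
qed

lemma pair_in_edges: "u \<in> {1..n} \<Longrightarrow> v \<in> {1..n} \<Longrightarrow> u \<noteq> v \<Longrightarrow> {u, v} \<in> edges n"
  by (auto simp: edges_def)

lemma card_edges_le: "card (edges n) \<le> n\<^sup>2"
proof -
  have "edges n \<subseteq> (\<lambda>(u, v). {u, v}) ` ({1..n} \<times> {1..n})"
    by (auto elim!: edgesE)
  then have "card (edges n) \<le> card ({1..n} \<times> {1..n})"
    by (intro surj_card_le) auto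
  then show ?thesis by (simp add: power2_eq_square)
qed

text \<open>Antisymmetric extension to ordered pairs. The value \<open>\<one>\<close> on the
  diagonal matters because a sampled vertex may coincide with an endpoint of an edge.\<close>

definition skew :: "('g, 'm) monoid_scheme \<Rightarrow> (nat set \<Rightarrow> 'g) \<Rightarrow> nat \<Rightarrow> nat \<Rightarrow> 'g" where
  "skew G f u v = (if u < v then f {u, v} else if v < u then inv\<^bsub>G\<^esub> f {u, v} else \<one>\<^bsub>G\<^esub>)"

text \<open>The cocycle equation on the triangle with base \<open>e\<close> and apex
  \<open>w\<close>, solved for the value on the base.\<close>

definition balanced :: "('g, 'm) monoid_scheme \<Rightarrow> (nat set \<Rightarrow> 'g) \<Rightarrow> nat set \<Rightarrow> nat \<Rightarrow> bool" where
  "balanced G f e w \<longleftrightarrow> skew G f (Min e) w \<otimes>\<^bsub>G\<^esub> skew G f w (Max e) = f e"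

lemma (in group) skew_closed:
  assumes "f \<in> edges n \<rightarrow>\<^sub>E carrier G" "u \<in> {1..n}" "v \<in> {1..n}"
  shows "skew G f u v \<in> carrier G"
proof -
  have "f {u, v} \<in> carrier G" if "u \<noteq> v"
    using assms that pair_in_edges[of u n v] by (intro PiE_mem[OF assms(1)]) auto
  then show ?thesis by (auto simp: skew_def)
qed

lemma (in group) skew_swap:
  assumes "f \<in> edges n \<rightarrow>\<^sub>E carrier G" "u \<in> {1..n}" "v \<in> {1..n}"
  shows "skew G f v u = inv skew G f u v"
proof -
  have "f {u, v} \<in> carrier G" if "u \<noteq> v"
    using assms that pair_in_edges[of u n v] by (intro PiE_mem[OF assms(1)]) auto
  then show ?thesis by (auto simp: skew_def insert_commute)
qed

text \<open>The good sample depends on \<open>f\<close>. Bounding by a sum over all tables in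
  \<open>R\<close> removes this dependence at the cost of the factor \<open>k ^ (n * m)\<close>,
  which is exponential in \<open>n\<close> only. For a fixed table the factor at \<open>e\<close>
  sees \<open>f\<close> through \<open>f e\<close> alone, so the sum over \<open>f\<close> becomes a
  product over the edges.\<close>

lemma (in group) sum_prod_balanced_le:
  assumes fin: "finite (carrier G)" and n: "n > 0" and m: "m > 0" and d: "(d :: real) > 0"
  defines "k \<equiv> real (card (carrier G))" and "N \<equiv> card (edges n)"
  shows "(\<Sum>f\<in>edges n \<rightarrow>\<^sub>E carrier G. \<Prod>e\<in>edges n. real (card {w\<in>{1..n}. balanced G f e w}) / real n + d)
     \<le> k ^ (n * m) * exp (real N / (d * sqrt (real m))) * (1 + k * d) ^ N"
    (is "sum ?T ?F \<le> _")
proof -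
  define C where "C = exp (real N / (d * sqrt (real m)))"
  define R where "R = ({1..n} \<times> {..<m}) \<rightarrow>\<^sub>E carrier G"
  \<comment> \<open>The fraction of sampled vertices that vote for the value \<open>a\<close> on
    \<open>e\<close>, judged from the table alone; \<open>inv r (Max e, i)\<close> stands for the
    step from the sampled vertex to \<open>Max e\<close>.\<close>
  define q where "q = (\<lambda>r (e :: nat set) a. real (card {i\<in>{..<m}. r (Min e, i) \<otimes> inv r (Max e, i) = a}) / real m)"
  have finR: "finite R" unfolding R_def using fin by (intro finite_PiE) auto
  have q0: "q r e a \<ge> 0" for r e a by (simp add: q_def)
  have *: "?T f \<le> C * (\<Sum>r\<in>R. \<Prod>e\<in>edges n. q r e (f e) + d)" if f: "f \<in> ?F" for f
  proof -
    have ne: "finite {1..n}" "{1..n} \<noteq> {}" using n by auto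
    obtain ws where ws: "ws \<in> lists_of m {1..n}"
      and le: "?T f \<le> C * (\<Prod>e\<in>edges n. freq (balanced G f e) ws + d)"
      by (rule bexE[OF exists_good_sample[OF finite_edges[of n] ne m d, of "balanced G f"]])
         (simp only: card_atLeastAtMost diff_Suc_1 C_def N_def)
    have len: "length ws = m" and sub: "\<And>i. i < m \<Longrightarrow> ws ! i \<in> {1..n}"
      using ws nth_mem by (fastforce simp: lists_of_def)+
    define r where "r = (\<lambda>(u, i)\<in>{1..n} \<times> {..<m}. skew G f u (ws ! i))"
    have r: "r \<in> R" unfolding R_def r_def using skew_closed[OF f] sub by auto
    have "freq (balanced G f e) ws = q r e (f e)" if e: "e \<in> edges n" for e
    proof -
      obtain u v where uv: "u \<in> {1..n}" "v \<in> {1..n}" "Min e = u" "Max e = v"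
        using e by (elim edgesE)
      have "balanced G f e (ws ! i) \<longleftrightarrow> r (Min e, i) \<otimes> inv r (Max e, i) = f e" if "i < m" for i
        using that uv sub[OF that] skew_swap[OF f uv(2) sub[OF that]]
        by (simp add: balanced_def r_def)
      then have "{i. i < m \<and> balanced G f e (ws ! i)} = {i\<in>{..<m}. r (Min e, i) \<otimes> inv r (Max e, i) = f e}"
        by auto
      then show ?thesis by (simp add: freq_def q_def len length_filter_conv_card)
    qed
    then have "?T f \<le> C * (\<Prod>e\<in>edges n. q r e (f e) + d)" using le by simp
    \<comment> \<open>The table of \<open>f\<close> supplies one of the nonnegative terms of the sum
      over \<open>R\<close>.\<close>
    also have "\<dots> \<le> C * (\<Sum>r\<in>R. \<Prod>e\<in>edges n. q r e (f e) + d)"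
      using r finR q0 d
      by (intro mult_left_mono member_le_sum) (auto simp: C_def intro!: prod_nonneg add_nonneg_nonneg)
    finally show ?thesis .
  qed
  \<comment> \<open>Each sampled index votes for exactly one group element, so the fractions add up
    to 1; the shift adds \<open>d\<close> once for each of the \<open>k\<close> elements.\<close>
  have one: "(\<Sum>a\<in>carrier G. q r e a + d) = 1 + k * d" if r: "r \<in> R" and e: "e \<in> edges n" for r e
  proof -
    obtain u v where uv: "u \<in> {1..n}" "v \<in> {1..n}" "Min e = u" "Max e = v"
      using e by (elim edgesE)
    have "(\<lambda>i. r (Min e, i) \<otimes> inv r (Max e, i)) ` {..<m} \<subseteq> carrier G"
      using r uv by (auto simp: R_def PiE_def Pi_def)
    then have "(\<Sum>a\<in>carrier G. card {i\<in>{..<m}. r (Min e, i) \<otimes> inv r (Max e, i) = a}) = m"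
      using sum.group[of "{..<m}" "carrier G" "\<lambda>i. r (Min e, i) \<otimes> inv r (Max e, i)" "\<lambda>_. 1::nat"] fin
      by simp
    then have "(\<Sum>a\<in>carrier G. q r e a) = 1"
      using m by (simp add: q_def flip: sum_divide_distrib of_nat_sum)
    then show ?thesis by (simp add: sum.distrib k_def)
  qed
  have "sum ?T ?F \<le> (\<Sum>f\<in>?F. C * (\<Sum>r\<in>R. \<Prod>e\<in>edges n. q r e (f e) + d))"
    by (rule sum_mono) (rule *)
  also have "\<dots> = C * (\<Sum>r\<in>R. \<Sum>f\<in>?F. \<Prod>e\<in>edges n. q r e (f e) + d)"
    by (subst sum.swap) (simp add: sum_distrib_left)
  also have "\<dots> = C * (\<Sum>r\<in>R. \<Prod>e\<in>edges n. \<Sum>a\<in>carrier G. q r e a + d)"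
    using fin by (simp add: prod_sum_PiE)
  also have "\<dots> = C * (\<Sum>r\<in>R. (1 + k * d) ^ N)"
    by (simp add: one N_def)
  also have "\<dots> = C * (real (card R) * (1 + k * d) ^ N)"
    by simp
  also have "real (card R) = k ^ (n * m)"
    by (simp add: R_def card_PiE k_def)
  finally show ?thesis
    unfolding C_def by (simp only: mult_ac)
qed

section \<open>Cocycles and their values on the edges\<close>

lemma cocycles1_closed:
  assumes "c \<in> cocycles1 n K G" "a \<in> {1..n}" "b \<in> {1..n}" "a \<noteq> b"
  shows "c (a, b) \<in> carrier G"
proof -
  have "c \<in> {(u, v). u \<in> {1..n} \<and> v \<in> {1..n} \<and> u \<noteq> v} \<rightarrow>\<^sub>E carrier G"
    using assms(1) unfolding cocycles1_def by simp
  then show ?thesis by (rule PiE_mem) (use assms in simp)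
qed

lemma cocycles1_swap:
  assumes "c \<in> cocycles1 n K G" "a \<in> {1..n}" "b \<in> {1..n}" "a \<noteq> b"
  shows "c (a, b) = inv\<^bsub>G\<^esub> c (b, a)"
  using assms(1)[unfolded cocycles1_def, THEN CollectD, THEN conjunct2, THEN conjunct1, rule_format, OF assms(2-4)] .

lemma cocycles1_triangle:
  assumes "c \<in> cocycles1 n K G" "{u, v, w} \<in> K" "card {u, v, w} = 3"
  shows "c (u, v) \<otimes>\<^bsub>G\<^esub> c (v, w) \<otimes>\<^bsub>G\<^esub> c (w, u) = \<one>\<^bsub>G\<^esub>"
  using assms(1)[unfolded cocycles1_def, THEN CollectD, THEN conjunct2, THEN conjunct2, rule_format, OF conjI, OF assms(2,3)] .

text \<open>Antisymmetry recovers a cocycle from its values on increasing pairs.\<close>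

lemma inj_on_edge_values:
  "inj_on (\<lambda>c. \<lambda>e\<in>edges n. c (Min e, Max e)) (cocycles1 n K G)"
proof (rule inj_onI)
  fix c c' assume c: "c \<in> cocycles1 n K G" "c' \<in> cocycles1 n K G"
    and eq: "(\<lambda>e\<in>edges n. c (Min e, Max e)) = (\<lambda>e\<in>edges n. c' (Min e, Max e))"
  have lt: "c (u, v) = c' (u, v)" if "u \<in> {1..n}" "v \<in> {1..n}" "u < v" for u v
    using fun_cong[OF eq, of "{u, v}"] that pair_in_edges[of u n v] by simp
  have "c (u, v) = c' (u, v)" if uv: "u \<in> {1..n}" "v \<in> {1..n}" "u \<noteq> v" for u v
  proof (cases "u < v")
    case False
    then have "c (v, u) = c' (v, u)" using uv by (intro lt) auto
    moreover have "c (u, v) = inv\<^bsub>G\<^esub> c (v, u)" "c' (u, v) = inv\<^bsub>G\<^esub> c' (v, u)"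
      using cocycles1_swap[OF c(1) uv] cocycles1_swap[OF c(2) uv] .
    ultimately show ?thesis by simp
  qed (use lt uv in auto)
  moreover have "c \<in> {(u, v). u \<in> {1..n} \<and> v \<in> {1..n} \<and> u \<noteq> v} \<rightarrow>\<^sub>E carrier G"
      "c' \<in> {(u, v). u \<in> {1..n} \<and> v \<in> {1..n} \<and> u \<noteq> v} \<rightarrow>\<^sub>E carrier G"
    using c unfolding cocycles1_def by simp_all
  ultimately show "c = c'"
    by (intro PiE_ext[where k = "{(u, v). u \<in> {1..n} \<and> v \<in> {1..n} \<and> u \<noteq> v}" and s = "\<lambda>_. carrier G"]) auto
qed

text \<open>For each edge only the equation of the face chosen at that very edge is kept. This
  discards constraints, but what remains is one condition on each of the independent variables
  \<open>w e\<close>.\<close>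

lemma (in group) cocycle_balanced:
  assumes c: "c \<in> cocycles1 n (one_out_complex n w) G"
    and w: "\<And>e. e \<in> edges n \<Longrightarrow> w e \<in> {1..n} - e"
    and e: "e \<in> edges n"
  shows "balanced G (\<lambda>e\<in>edges n. c (Min e, Max e)) e (w e)"
proof -
  define f where "f = (\<lambda>e\<in>edges n. c (Min e, Max e))"
  obtain u v where uv: "e = {u, v}" "u < v" "u \<in> {1..n}" "v \<in> {1..n}" "Min e = u" "Max e = v"
    using e by (elim edgesE)
  define x where "x = w e"
  have x: "x \<in> {1..n}" "x \<noteq> u" "x \<noteq> v" using w[OF e] uv by (auto simp: x_def)
  have car: "c (a, b) \<in> carrier G" if "a \<in> {1..n}" "b \<in> {1..n}" "a \<noteq> b" for a b
    using that by (intro cocycles1_closed[OF c])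
  note swap = cocycles1_swap[OF c]
  have skew: "skew G f a b = c (a, b)" if "a \<in> {1..n}" "b \<in> {1..n}" "a \<noteq> b" for a b
  proof (cases "a < b")
    case True
    then show ?thesis using that pair_in_edges[of a n b] by (simp add: skew_def f_def)
  next
    case False
    then have "b < a" using that by auto
    then show ?thesis using that pair_in_edges[of a n b] swap[of a b]
      by (simp add: skew_def f_def insert_commute)
  qed
  have "{u, x, v} = insert (w e) e" using uv by (auto simp: x_def)
  then have "{u, x, v} \<in> one_out_complex n w" "card {u, x, v} = 3"
    using e x uv by (auto simp: one_out_complex_def)
  then have "c (u, x) \<otimes> c (x, v) \<otimes> c (v, u) = \<one>"
    by (rule cocycles1_triangle[OF c])
  moreover have "c (u, x) \<in> carrier G" "c (x, v) \<in> carrier G" "c (v, u) \<in> carrier G"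
    using car x uv by auto
  ultimately have "c (u, x) \<otimes> c (x, v) = inv c (v, u)"
    by (intro inv_equality[symmetric] m_closed)
  also have "\<dots> = c (u, v)" using swap[of u v] uv by auto
  finally have "c (u, x) \<otimes> c (x, v) = c (u, v)" .
  moreover have "f e = c (u, v)" using e uv by (simp add: f_def)
  moreover have "skew G f u x = c (u, x)" "skew G f x v = c (x, v)"
    using skew[of u x] skew[of x v] x uv by auto
  ultimately show ?thesis
    unfolding balanced_def f_def[symmetric] x_def[symmetric] uv(5,6) by simp
qed

lemma (in group) finite_cocycles1: "finite (carrier G) \<Longrightarrow> finite (cocycles1 n K G)"
proof -
  assume fin: "finite (carrier G)"
  let ?P = "{(u, v). u \<in> {1..n} \<and> v \<in> {1..n} \<and> u \<noteq> v}"
  have "finite ?P" by (rule finite_subset[of _ "{1..n} \<times> {1..n}"]) auto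
  then have "finite (?P \<rightarrow>\<^sub>E carrier G)" using fin by (intro finite_PiE)
  moreover have "cocycles1 n K G \<subseteq> ?P \<rightarrow>\<^sub>E carrier G" by (simp add: cocycles1_def)
  ultimately show ?thesis by (rule finite_subset[rotated])
qed

text \<open>The trivial cocycle is always present. Triangles have to lie in \<open>{1..n}\<close>
  because outside its domain the function is \<open>undefined\<close>. Positivity supports the lower
  half of the logarithmic limit and later the monotonicity of \<open>ln\<close> on the
  counts.\<close>

lemma (in group) card_cocycles1_pos:
  assumes "finite (carrier G)" and K: "\<Union>K \<subseteq> {1..n}" shows "card (cocycles1 n K G) \<ge> 1"
proof -
  have "(\<lambda>(u, v)\<in>{(u, v). u \<in> {1..n} \<and> v \<in> {1..n} \<and> u \<noteq> v}. \<one>) \<in> cocycles1 n K G"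
  proof -
    have "u \<noteq> v \<and> v \<noteq> w \<and> w \<noteq> u" if "card {u, v, w} = 3" for u v w :: nat
    proof -
      have "u \<noteq> v"
      proof
        assume "u = v"
        then have "card {u, v, w} \<le> 2" using card_insert_le_m1[of 2 "{w}" v] by simp
        with that show False by simp
      qed
      moreover have "v \<noteq> w"
      proof
        assume "v = w"
        then have "card {u, v, w} \<le> 2" using card_insert_le_m1[of 2 "{w}" u] by simp
        with that show False by simp
      qed
      moreover have "w \<noteq> u"
      proof
        assume "w = u"
        then have "card {u, v, w} \<le> 2" using card_insert_le_m1[of 2 "{w}" v] by (simp add: insert_commute)
        with that show False by simp
      qed
      ultimately show ?thesis by blast
    qed
    moreover have "u \<in> {1..n}" "v \<in> {1..n}" "w \<in> {1..n}" if "{u, v, w} \<in> K" for u v w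
      using that K by auto
    ultimately have d: "u \<in> {1..n} \<and> v \<in> {1..n} \<and> w \<in> {1..n} \<and> u \<noteq> v \<and> v \<noteq> w \<and> w \<noteq> u"
      if "{u, v, w} \<in> K \<and> card {u, v, w} = 3" for u v w
      using that by blast
    show ?thesis
      unfolding cocycles1_def
    proof (intro CollectI conjI ballI allI impI, goal_cases)
      case (3 u v w)
      from d[OF 3] show ?case by simp
    qed auto
  qed
  then have "cocycles1 n K G \<noteq> {}" by blast
  then have "card (cocycles1 n K G) > 0"
    using finite_cocycles1[OF assms(1), of n K] by (simp only: card_gt_0_iff) blast
  then show ?thesis by simp
qed

section \<open>Independent third vertices and the first moment of the cocycle count\<close>

lemma finite_set_Pi_pmf:
  assumes "finite A" "\<And>x. x \<in> A \<Longrightarrow> finite (set_pmf (p x))"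
  shows "finite (set_pmf (Pi_pmf A d p))"
  using assms by (simp add: set_Pi_pmf finite_PiE_dflt)

definition choice_pmf :: "nat \<Rightarrow> (nat set \<Rightarrow> nat) pmf" where
  "choice_pmf n = Pi_pmf (edges n) undefined (\<lambda>e. pmf_of_set ({1..n} - e))"

lemma S2_eq: "S2 n = map_pmf (one_out_complex n) (choice_pmf n)"
  by (simp add: S2_def choice_pmf_def)

lemma third_vertices:
  assumes "n \<ge> 3" "e \<in> edges n"
  shows "finite ({1..n} - e)" "{1..n} - e \<noteq> {}" "card ({1..n} - e) = n - 2"
proof -
  have e: "e \<subseteq> {1..n}" "card e = 2" "finite e"
    using assms(2) by (auto simp: edges_def intro: finite_subset)
  then show c: "card ({1..n} - e) = n - 2" by (simp add: card_Diff_subset)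
  show "finite ({1..n} - e)" by simp
  show "{1..n} - e \<noteq> {}" using c assms(1) by (metis card.empty diff_is_0_eq not_less_eq_eq numeral_2_eq_2 numeral_3_eq_3)
qed

lemma set_choice_pmf:
  assumes "n \<ge> 3" "w \<in> set_pmf (choice_pmf n)" "e \<in> edges n"
  shows "w e \<in> {1..n} - e"
  using assms third_vertices[OF assms(1)]
  by (auto simp: choice_pmf_def set_Pi_pmf PiE_dflt_def set_pmf_of_set)

lemma finite_set_choice_pmf: "n \<ge> 3 \<Longrightarrow> finite (set_pmf (choice_pmf n))"
  unfolding choice_pmf_def using third_vertices[of n]
  by (intro finite_set_Pi_pmf) (auto simp: set_pmf_of_set)

text \<open>A cocycle forces \<open>balanced\<close> at every edge with its chosen vertex, and
  independence turns the probability of these joint events into a product. The bound uses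
  frequencies over all of \<open>{1..n}\<close> so that every edge is sampled from the same vertex
  set, although the actual choice excludes the endpoints of \<open>e\<close>.\<close>

lemma (in group) expectation_cocycles_le:
  assumes fin: "finite (carrier G)" and n: "n \<ge> 3"
  shows "measure_pmf.expectation (S2 n) (\<lambda>K. real (card (cocycles1 n K G)))
     \<le> (\<Sum>f\<in>edges n \<rightarrow>\<^sub>E carrier G. \<Prod>e\<in>edges n. real (card {w\<in>{1..n}. balanced G f e w}) / real n)"
proof -
  let ?F = "edges n \<rightarrow>\<^sub>E carrier G"
  let ?B = "\<lambda>f. {w. \<forall>e\<in>edges n. balanced G f e (w e)}"
  have finF: "finite ?F" using fin by (intro finite_PiE) auto
  have int: "integrable (measure_pmf (choice_pmf n)) h" for h :: "_ \<Rightarrow> real"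
    using finite_set_choice_pmf[OF n] by (rule integrable_measure_pmf_finite)
  have le: "real (card (cocycles1 n (one_out_complex n w) G)) \<le> (\<Sum>f\<in>?F. indicator (?B f) w)"
    if w: "w \<in> set_pmf (choice_pmf n)" for w
  proof -
    let ?h = "\<lambda>c. \<lambda>e\<in>edges n. c (Min e, Max e)"
    have "?h ` cocycles1 n (one_out_complex n w) G \<subseteq> {f\<in>?F. w \<in> ?B f}"
    proof (intro image_subsetI CollectI conjI ballI)
      fix c assume c: "c \<in> cocycles1 n (one_out_complex n w) G"
      show "?h c \<in> ?F"
      proof (rule restrict_PiE_iff[THEN iffD2], rule ballI)
        fix e assume "e \<in> edges n"
        then obtain u v where "u < v" "u \<in> {1..n}" "v \<in> {1..n}" "Min e = u" "Max e = v"
          by (elim edgesE)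
        then show "c (Min e, Max e) \<in> carrier G" using cocycles1_closed[OF c, of u v] by simp
      qed
      show "balanced G (?h c) e (w e)" if "e \<in> edges n" for e
        using set_choice_pmf[OF n w] by (intro cocycle_balanced[OF c] that)
    qed
    then have "card (cocycles1 n (one_out_complex n w) G) \<le> card {f\<in>?F. w \<in> ?B f}"
      using finF by (intro card_inj_on_le[OF inj_on_edge_values]) auto
    also have "real \<dots> = (\<Sum>f\<in>?F. indicator (?B f) w)"
      using finF by (simp add: indicator_def sum.If_cases Int_def)
    finally show ?thesis by simp
  qed
  have prob: "measure_pmf.prob (choice_pmf n) (?B f) \<le>
      (\<Prod>e\<in>edges n. real (card {w\<in>{1..n}. balanced G f e w}) / real n)" if f: "f \<in> ?F" for f
  proof -
    have "?B f = Pi (edges n) (\<lambda>e. {w. balanced G f e w})" by (auto simp: Pi_def)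
    then have "measure_pmf.prob (choice_pmf n) (?B f)
        = (\<Prod>e\<in>edges n. measure_pmf.prob (pmf_of_set ({1..n} - e)) {w. balanced G f e w})"
      by (simp add: choice_pmf_def measure_Pi_pmf_Pi)
    also have "\<dots> \<le> (\<Prod>e\<in>edges n. real (card {w\<in>{1..n}. balanced G f e w}) / real n)"
    proof (intro prod_mono conjI measure_nonneg)
      fix e assume e: "e \<in> edges n"
      obtain u v where uv: "e = {u, v}" "u < v" "u \<in> {1..n}" "v \<in> {1..n}" "Min e = u" "Max e = v"
        using e by (elim edgesE)
      let ?S = "({1..n} - e) \<inter> {w. balanced G f e w}"
      have fe: "f e \<in> carrier G" using f e by auto
      \<comment> \<open>The endpoints satisfy the equation trivially, thanks to the diagonal value
        of \<open>skew\<close>, so passing to \<open>{1..n}\<close> adds exactly two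
        successes.\<close>
      have "balanced G f e u" "balanced G f e v"
        using uv fe by (auto simp: balanced_def skew_def)
      then have "{w\<in>{1..n}. balanced G f e w} = insert u (insert v ?S)"
        using uv by auto
      then have c: "card {w\<in>{1..n}. balanced G f e w} = card ?S + 2"
        using uv by simp
      have s: "card ?S \<le> n - 2"
        using third_vertices[OF n e] card_mono[of "{1..n} - e" ?S] by auto
      have "measure_pmf.prob (pmf_of_set ({1..n} - e)) {w. balanced G f e w} = real (card ?S) / real (n - 2)"
        using third_vertices[OF n e] by (simp add: measure_pmf_of_set)
      \<comment> \<open>Adding two successful trials to \<open>n - 2\<close> trials cannot lower the
        success rate.\<close>
      also have "\<dots> \<le> real (card ?S + 2) / real n"
      proof -
        have "real (n - 2) = real n - 2" "real (card ?S) \<le> real n - 2" using n s by auto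
        then show ?thesis using n by (simp add: field_simps)
      qed
      finally show "measure_pmf.prob (pmf_of_set ({1..n} - e)) {w. balanced G f e w}
          \<le> real (card {w\<in>{1..n}. balanced G f e w}) / real n" unfolding c .
    qed
    finally show ?thesis .
  qed
  have "measure_pmf.expectation (S2 n) (\<lambda>K. real (card (cocycles1 n K G)))
      = measure_pmf.expectation (choice_pmf n) (\<lambda>w. real (card (cocycles1 n (one_out_complex n w) G)))"
    by (simp add: S2_eq)
  also have "\<dots> \<le> measure_pmf.expectation (choice_pmf n) (\<lambda>w. \<Sum>f\<in>?F. indicator (?B f) w)"
    by (intro integral_mono_AE int) (auto simp: AE_measure_pmf_iff intro: le)
  also have "\<dots> = (\<Sum>f\<in>?F. measure_pmf.prob (choice_pmf n) (?B f))"
    by (subst Bochner_Integration.integral_sum) (auto simp: int)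
  also have "\<dots> \<le> (\<Sum>f\<in>?F. \<Prod>e\<in>edges n. real (card {w\<in>{1..n}. balanced G f e w}) / real n)"
    by (rule sum_mono) (rule prob)
  finally show ?thesis .
qed

text \<open>The sample size \<open>m\<close> depends on \<open>\<epsilon>\<close> and the group but
  not on \<open>n\<close>, so the number of tables contributes only \<open>exp (C * n)\<close>. All
  quadratic growth comes from the sampling error and the shift, each allowed half of
  \<open>\<epsilon>\<close> per edge.\<close>

lemma (in group) expectation_cocycles_exp_bound:
  assumes fin: "finite (carrier G)" and eps: "\<epsilon> > 0"
  shows "\<exists>C. \<forall>n\<ge>3. measure_pmf.expectation (S2 n) (\<lambda>K. real (card (cocycles1 n K G)))
            \<le> exp (\<epsilon> * real n ^ 2 + C * real n)"
proof -
  define k where "k = real (card (carrier G))"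
  have k: "k \<ge> 1"
    unfolding k_def using fin one_closed by (metis One_nat_def Suc_leI card_gt_0_iff empty_iff of_nat_1 of_nat_le_iff)
  \<comment> \<open>Makes \<open>k * d = \<epsilon> / 2\<close>, the cost of the shift per
    edge.\<close>
  define d where "d = \<epsilon> / (2 * k)"
  have d: "d > 0" using k eps by (simp add: d_def)
  \<comment> \<open>Large enough for the sampling error per edge, \<open>1 / (d * sqrt m)\<close>,
    to be at most \<open>\<epsilon> / 2\<close>.\<close>
  obtain m :: nat where m: "real m > (2 / (d * \<epsilon>))\<^sup>2" using reals_Archimedean2 by blast
  have m0: "m > 0" using m by (metis less_le_not_le of_nat_0 zero_le_power2 gr0I)
  have sq: "2 / (d * \<epsilon>) \<le> sqrt (real m)" using m d eps by (intro real_le_rsqrt) auto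
  then have sm: "1 / (d * sqrt (real m)) \<le> \<epsilon> / 2"
    using d eps m0 by (simp add: field_simps)
  have "measure_pmf.expectation (S2 n) (\<lambda>K. real (card (cocycles1 n K G)))
            \<le> exp (\<epsilon> * real n ^ 2 + (real m * ln k) * real n)" if n: "n \<ge> 3" for n
  proof -
    define N where "N = card (edges n)"
    have "measure_pmf.expectation (S2 n) (\<lambda>K. real (card (cocycles1 n K G)))
       \<le> (\<Sum>f\<in>edges n \<rightarrow>\<^sub>E carrier G. \<Prod>e\<in>edges n. real (card {w\<in>{1..n}. balanced G f e w}) / real n)"
      by (rule expectation_cocycles_le[OF fin n])
    also have "\<dots> \<le> (\<Sum>f\<in>edges n \<rightarrow>\<^sub>E carrier G. \<Prod>e\<in>edges n. real (card {w\<in>{1..n}. balanced G f e w}) / real n + d)"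
      using d by (intro sum_mono prod_mono) auto
    also have "\<dots> \<le> k ^ (n * m) * exp (real N / (d * sqrt (real m))) * (1 + k * d) ^ N"
      unfolding k_def N_def by (rule sum_prod_balanced_le) (use fin n m0 d in auto)
    also have "\<dots> \<le> k ^ (n * m) * exp (real N * (\<epsilon> / 2)) * exp (real N * (\<epsilon> / 2))"
    proof -
      have kd: "k * d = \<epsilon> / 2" using k by (simp add: d_def)
      have le: "1 + k * d \<le> exp (\<epsilon> / 2)" unfolding kd by (rule exp_ge_add_one_self)
      have "0 \<le> k * d" by (rule mult_nonneg_nonneg) (use k d in linarith)+
      then have nn: "0 \<le> 1 + k * d" by linarith
      have "(1 + k * d) ^ N \<le> exp (\<epsilon> / 2) ^ N" by (rule power_mono[OF le nn])
      also have "\<dots> = exp (real N * (\<epsilon> / 2))" by (rule exp_of_nat_mult[symmetric])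
      finally have a: "(1 + k * d) ^ N \<le> exp (real N * (\<epsilon> / 2))" .
      have "real N / (d * sqrt (real m)) \<le> real N * (\<epsilon> / 2)"
        using mult_left_mono[OF sm, of "real N"] by simp
      then have b: "exp (real N / (d * sqrt (real m))) \<le> exp (real N * (\<epsilon> / 2))" by simp
      have "0 \<le> k ^ (n * m)" by (rule zero_le_power) (use k in linarith)
      then show ?thesis
        by (intro mult_mono a b order_refl mult_nonneg_nonneg zero_le_power[OF nn] exp_ge_zero)
    qed
    also have "k ^ (n * m) = exp ((real m * ln k) * real n)"
    proof -
      have "k ^ (n * m) = exp (ln k) ^ (n * m)" using k by simp
      also have "\<dots> = exp (real (n * m) * ln k)" by (rule exp_of_nat_mult[symmetric])
      finally show ?thesis by (simp add: mult_ac)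
    qed
    also have "exp ((real m * ln k) * real n) * exp (real N * (\<epsilon> / 2)) * exp (real N * (\<epsilon> / 2))
        = exp (\<epsilon> * real N + (real m * ln k) * real n)"
      by (simp add: algebra_simps flip: exp_add)
    also have "\<dots> \<le> exp (\<epsilon> * real n ^ 2 + (real m * ln k) * real n)"
    proof -
      have "real N \<le> real n ^ 2" using card_edges_le[of n] by (simp add: N_def flip: of_nat_power)
      then show ?thesis using eps by simp
    qed
    finally show ?thesis .
  qed
  then show ?thesis by blast
qed

lemma Union_S2:
  assumes "n \<ge> 3" "K \<in> set_pmf (S2 n)"
  shows "\<Union>K \<subseteq> {1..n}"
proof -
  obtain w where w: "w \<in> set_pmf (choice_pmf n)" "K = one_out_complex n w"
    using assms(2) by (auto simp: S2_eq)
  then show ?thesis using set_choice_pmf[OF assms(1) w(1)]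
    by (fastforce simp: one_out_complex_def edges_def)
qed

lemma (in group) expectation_cocycles_ge_1:
  assumes fin: "finite (carrier G)" and n: "n \<ge> 3"
  shows "measure_pmf.expectation (S2 n) (\<lambda>K. real (card (cocycles1 n K G))) \<ge> 1"
proof -
  have "finite (set_pmf (S2 n))" using finite_set_choice_pmf[OF n] by (simp add: S2_eq)
  then have "measure_pmf.expectation (S2 n) (\<lambda>K. 1) \<le> measure_pmf.expectation (S2 n) (\<lambda>K. real (card (cocycles1 n K G)))"
    using card_cocycles1_pos[OF fin Union_S2[OF n]]
    by (intro integral_mono_AE integrable_measure_pmf_finite) (auto simp: AE_measure_pmf_iff)
  then show ?thesis by simp
qed

lemma (in group) ln_expectation_cocycles:
  assumes fin: "finite (carrier G)"
  shows "(\<lambda>n. ln (measure_pmf.expectation (S2 n) (\<lambda>K. real (card (cocycles1 n K G)))) / real n ^ 2) \<longlonglongrightarrow> 0"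
proof (rule LIMSEQ_I)
  fix r :: real assume r: "r > 0"
  obtain C where C: "\<And>n. n \<ge> 3 \<Longrightarrow> measure_pmf.expectation (S2 n) (\<lambda>K. real (card (cocycles1 n K G)))
            \<le> exp (r / 3 * real n ^ 2 + C * real n)"
    using expectation_cocycles_exp_bound[OF fin, of "r / 3"] r by auto
  \<comment> \<open>Beyond \<open>n0\<close> the linear term is at most a second third of
    \<open>r * n^2\<close>, which leaves a strict margin below \<open>r\<close>.\<close>
  obtain n0 :: nat where n0: "real n0 > 3 * \<bar>C\<bar> / r" using reals_Archimedean2 by blast
  show "\<exists>no. \<forall>n\<ge>no. norm (ln (measure_pmf.expectation (S2 n) (\<lambda>K. real (card (cocycles1 n K G)))) / real n ^ 2 - 0) < r"
  proof (intro exI allI impI)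
    fix n assume "n \<ge> max 3 n0"
    then have n: "n \<ge> 3" "real n > 3 * \<bar>C\<bar> / r" using n0 by auto
    define x where "x = measure_pmf.expectation (S2 n) (\<lambda>K. real (card (cocycles1 n K G)))"
    have x1: "x \<ge> 1" unfolding x_def by (rule expectation_cocycles_ge_1[OF fin n(1)])
    have "ln x \<le> ln (exp (r / 3 * real n ^ 2 + C * real n))"
      using x1 C[OF n(1)] by (subst ln_le_cancel_iff) (auto simp: x_def)
    then have "ln x \<le> r / 3 * real n ^ 2 + C * real n" by simp
    also have "C * real n \<le> r / 3 * real n ^ 2"
    proof -
      have "C \<le> r / 3 * real n" using n(2) r by (simp add: field_simps)
      then have "C * real n \<le> (r / 3 * real n) * real n" by (intro mult_right_mono) auto
      then show ?thesis by (simp add: power2_eq_square)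
    qed
    finally have "ln x / real n ^ 2 \<le> 2 * r / 3" using n by (simp add: field_simps)
    moreover have "ln x / real n ^ 2 \<ge> 0" using x1 by simp
    ultimately have "\<bar>ln x / real n ^ 2\<bar> < r" using r by linarith
    then show "norm (ln (measure_pmf.expectation (S2 n) (\<lambda>K. real (card (cocycles1 n K G)))) / real n ^ 2 - 0) < r"
      by (simp only: x_def diff_0_right real_norm_def)
  qed
qed

section \<open>Generators of lattice quotients\<close>

definition zscale :: "int \<Rightarrow> ('e \<Rightarrow> int) \<Rightarrow> 'e \<Rightarrow> int" (infixr "*z" 75) where
  "c *z v = (\<lambda>x. c * v x)"

lemma zscale_apply: "(c *z v) x = c * v x"
  by (simp add: zscale_def)

interpretation zfun: Modules.module zscale
  by standard (auto simp: zscale_apply algebra_simps fun_eq_iff)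

lemma fun_sum_apply: "(\<Sum>i\<in>A. f i) x = (\<Sum>i\<in>A. f i x)" for f :: "'i \<Rightarrow> 'e \<Rightarrow> int"
  by (induction A rule: infinite_finite_induct) auto

definition unit_vec :: "'e \<Rightarrow> 'e \<Rightarrow> int" where
  "unit_vec e = (\<lambda>x. of_bool (x = e))"

text \<open>The lattice of integer vectors indexed by \<open>E\<close>, kept inside the full
  function type so that \<open>zfun.span\<close>, the generated subgroup, lives in one ambient
  module for all \<open>E\<close>.\<close>

definition supported :: "'e set \<Rightarrow> ('e \<Rightarrow> int) set" where
  "supported E = {v. \<forall>x. x \<notin> E \<longrightarrow> v x = 0}"

lemma subspace_supported: "zfun.subspace (supported E)"
  by (intro zfun.subspaceI) (auto simp: supported_def zscale_apply)

lemma unit_vec_supported: "e \<in> E \<Longrightarrow> unit_vec e \<in> supported E"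
  by (auto simp: supported_def unit_vec_def)

lemma supported_expand:
  assumes "finite E" "v \<in> supported E"
  shows "v = (\<Sum>e\<in>E. v e *z unit_vec e)"
proof
  fix x
  have "(\<Sum>e\<in>E. v e * unit_vec e x) = (\<Sum>e\<in>E. if e = x then v e else 0)"
    by (intro sum.cong) (auto simp: unit_vec_def)
  also have "\<dots> = v x" using assms by (auto simp: supported_def)
  finally show "v x = (\<Sum>e\<in>E. v e *z unit_vec e) x" by (simp add: fun_sum_apply zscale_apply)
qed

lemma supported_subset_span_unit:
  assumes "finite E" shows "supported E \<subseteq> zfun.span (unit_vec ` E)"
proof
  fix v assume v: "v \<in> supported E"
  have "(\<Sum>e\<in>E. v e *z unit_vec e) \<in> zfun.span (unit_vec ` E)"
    by (intro zfun.span_sum zfun.span_scale zfun.span_base) auto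
  then show "v \<in> zfun.span (unit_vec ` E)" using supported_expand[OF assms v] by simp
qed

section \<open>Greedy generating sets and digit expansions\<close>

definition jumps :: "('e \<Rightarrow> int) set \<Rightarrow> (nat \<Rightarrow> 'e \<Rightarrow> int) \<Rightarrow> nat \<Rightarrow> nat set" where
  "jumps T x N = {i. i < N \<and> x i \<notin> zfun.span (T \<union> x ` {..<i})}"

text \<open>\<open>jumps\<close> marks where the growing chain of spans is strict. At any other
  index the vector depends on earlier ones, selected or not, and strong induction traces those back
  to selected ones.\<close>

lemma jumps_span:
  assumes "i < N" shows "x i \<in> zfun.span (T \<union> x ` jumps T x N)"
  using assms
proof (induction i rule: less_induct)
  case (less i)
  show ?case
  proof (cases "i \<in> jumps T x N")
    case True then show ?thesis by (intro zfun.span_base) auto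
  next
    case False
    then have "x i \<in> zfun.span (T \<union> x ` {..<i})" using less.prems by (simp add: jumps_def)
    moreover have "T \<union> x ` {..<i} \<subseteq> zfun.span (T \<union> x ` jumps T x N)"
    proof (intro Un_least image_subsetI)
      show "T \<subseteq> zfun.span (T \<union> x ` jumps T x N)"
        by (rule order_trans[OF _ zfun.span_superset]) blast
      fix l assume "l \<in> {..<i}"
      then show "x l \<in> zfun.span (T \<union> x ` jumps T x N)"
        using less.prems by (intro less.IH) auto
    qed
    then have "zfun.span (T \<union> x ` {..<i}) \<subseteq> zfun.span (T \<union> x ` jumps T x N)"
      by (rule zfun.span_minimal[OF _ zfun.subspace_span])
    ultimately show ?thesis by blast
  qed
qed

text \<open>Digit expansions in base \<open>P\<close>: when each selected vector has order at least
  \<open>P\<close> modulo the earlier span, combinations with digits below \<open>P\<close> are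
  distinct modulo \<open>zfun.span T\<close>. So the quotient contains at least
  \<open>P ^ card S\<close> elements, which is how selections are bounded both modulo a prime and
  over the integers.\<close>

lemma jumps_unique:
  fixes a b :: "nat \<Rightarrow> int"
  assumes fin: "finite S"
    and H: "\<And>i d. i \<in> S \<Longrightarrow> 0 < d \<Longrightarrow> d < P \<Longrightarrow> d *z x i \<notin> zfun.span (T \<union> x ` {..<i})"
    and ab: "\<And>i. i \<in> S \<Longrightarrow> 0 \<le> a i \<and> a i < P" "\<And>i. i \<in> S \<Longrightarrow> 0 \<le> b i \<and> b i < P"
    and mem: "(\<Sum>i\<in>S. (a i - b i) *z x i) \<in> zfun.span T"
  shows "\<forall>i\<in>S. a i = b i"
proof (rule ccontr)
  assume neq: "\<not> (\<forall>i\<in>S. a i = b i)"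
  define D where "D = {i\<in>S. a i \<noteq> b i}"
  have D: "finite D" "D \<noteq> {}" using fin neq by (auto simp: D_def)
  define j where "j = Max D"
  have j: "j \<in> D" "\<And>i. i \<in> D - {j} \<Longrightarrow> i < j"
    using D Max_in[OF D] Max_ge[OF D(1)] unfolding j_def by (auto simp: le_less)
  have "(\<Sum>i\<in>S. (a i - b i) *z x i) = (\<Sum>i\<in>D. (a i - b i) *z x i)"
    using fin by (intro sum.mono_neutral_right) (auto simp: D_def fun_eq_iff)
  also have "\<dots> = (a j - b j) *z x j + (\<Sum>i\<in>D - {j}. (a i - b i) *z x i)"
    by (rule sum.remove[OF D(1) j(1)])
  finally have eq: "(a j - b j) *z x j = (\<Sum>i\<in>S. (a i - b i) *z x i) - (\<Sum>i\<in>D - {j}. (a i - b i) *z x i)"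
    by simp
  \<comment> \<open>At the largest differing index \<open>j\<close> all other differences have
    smaller index, so a nonzero multiple of \<open>x j\<close> with multiplier strictly between
    \<open>- P\<close> and \<open>P\<close> falls into the earlier span.\<close>
  have m: "(a j - b j) *z x j \<in> zfun.span (T \<union> x ` {..<j})"
    unfolding eq
  proof (rule zfun.span_diff[OF _ zfun.span_sum[OF zfun.span_scale]])
    show "(\<Sum>i\<in>S. (a i - b i) *z x i) \<in> zfun.span (T \<union> x ` {..<j})"
      using mem zfun.span_mono[of T "T \<union> x ` {..<j}"] by blast
    fix i assume "i \<in> D - {j}"
    then show "x i \<in> zfun.span (T \<union> x ` {..<j})" using j(2) by (intro zfun.span_base) blast
  qed
  have jS: "j \<in> S" "a j \<noteq> b j" using j(1) by (auto simp: D_def)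
  show False
  proof (cases "a j > b j")
    case True
    then show ?thesis using H[of j "a j - b j"] m jS ab[OF jS(1)] by auto
  next
    case False
    have "(b j - a j) *z x j = - ((a j - b j) *z x j)" by (auto simp: fun_eq_iff algebra_simps)
    then have "(b j - a j) *z x j \<in> zfun.span (T \<union> x ` {..<j})"
      using zfun.span_neg[OF m] by simp
    then show ?thesis using H[of j "b j - a j"] jS False ab(1)[OF jS(1)] ab(2)[OF jS(1)] by auto
  qed
qed

text \<open>By Bezout, \<open>v\<close> is an integer combination of its two multiples.\<close>

lemma coprime_scale_in_span:
  assumes "a *z v \<in> zfun.span T" "b *z v \<in> zfun.span T" "coprime a b"
  shows "v \<in> zfun.span T"
proof -
  obtain s t where "s * a + t * b = 1"
    using bezout_int[of a b] assms(3) by (auto simp: coprime_iff_gcd_eq_1)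
  then have "v = (\<lambda>x. (s * a + t * b) * v x)" by simp
  also have "\<dots> = s *z (a *z v) + t *z (b *z v)" by (simp add: zscale_apply fun_eq_iff algebra_simps)
  also have "\<dots> \<in> zfun.span T" by (intro zfun.span_add zfun.span_scale assms)
  finally show ?thesis .
qed

lemma span_insert_sum:
  assumes "finite S" "v \<in> zfun.span (T \<union> x ` S)"
  shows "\<exists>a. v - (\<Sum>i\<in>S. a i *z x i) \<in> zfun.span T"
  using assms
proof (induction S arbitrary: v rule: finite_induct)
  case empty then show ?case by (auto simp: zero_fun_def)
next
  case (insert j S)
  have "T \<union> x ` insert j S = insert (x j) (T \<union> x ` S)" by auto
  with insert.prems have "v \<in> zfun.span (insert (x j) (T \<union> x ` S))" by metis
  then obtain k where "v - k *z x j \<in> zfun.span (T \<union> x ` S)"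
    unfolding zfun.span_breakdown_eq by blast
  then obtain a where a: "v - k *z x j - (\<Sum>i\<in>S. a i *z x i) \<in> zfun.span T"
    using insert.IH by blast
  have "(\<Sum>i\<in>insert j S. (a(j := k)) i *z x i) = k *z x j + (\<Sum>i\<in>S. a i *z x i)"
  proof -
    have "(\<Sum>i\<in>S. (a(j := k)) i *z x i) = (\<Sum>i\<in>S. a i *z x i)"
      using insert.hyps by (intro sum.cong) auto
    then show ?thesis using insert.hyps by simp
  qed
  then have "v - (\<Sum>i\<in>insert j S. (a(j := k)) i *z x i) = v - k *z x j - (\<Sum>i\<in>S. a i *z x i)"
    by (simp only: diff_diff_eq)
  then show ?case using a by metis
qed

text \<open>For \<open>T\<close> supported on \<open>E\<close>, these are the homomorphisms from the
  quotient by \<open>zfun.span T\<close> to the integers modulo \<open>p\<close>, given by their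
  residues on the unit vectors. They are the link between generators and cocycles.\<close>

definition annihilators :: "int \<Rightarrow> 'e set \<Rightarrow> ('e \<Rightarrow> int) set \<Rightarrow> ('e \<Rightarrow> int) set" where
  "annihilators p E T = {f \<in> E \<rightarrow>\<^sub>E {0..<p}. \<forall>t\<in>T. p dvd (\<Sum>e\<in>E. f e * t e)}"

text \<open>Reduced modulo \<open>p\<close>, the quotient by \<open>T\<close> is a vector space over
  a prime field; \<open>S\<close> is a basis of it picked from the unit vectors, and combinations of
  the dual basis give \<open>p ^ card S\<close> annihilators. The correction
  \<open>int p *z u\<close> expresses generation modulo \<open>p\<close> without leaving the integer
  lattice.\<close>

lemma exists_mod_prime_generators:
  fixes T :: "('e \<Rightarrow> int) set"
  assumes p: "prime p" and E: "finite E" and T: "T \<subseteq> supported E"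
  shows "\<exists>S\<subseteq>E. (\<forall>v\<in>supported E. \<exists>u\<in>supported E. v - int p *z u \<in> zfun.span (T \<union> unit_vec ` S))
           \<and> p ^ card S \<le> card (annihilators (int p) E T)"
proof -
  define q where "q = int p"
  have q: "prime q" "q > 0" "q > 1" using p prime_gt_1_nat[OF p] by (auto simp: q_def)
  define N where "N = card E"
  obtain g where g: "bij_betw g {..<N} E"
    using ex_bij_betw_nat_finite[OF E] by (auto simp: N_def atLeast0LessThan)
  define x where "x = (\<lambda>i. unit_vec (g i))"
  \<comment> \<open>With all \<open>p\<close>-multiples adjoined, the reduction modulo
    \<open>p\<close> is built into the spans.\<close>
  define L where "L = T \<union> (\<lambda>e. q *z unit_vec e) ` E"
  define S where "S = jumps L x N"
  have S: "S \<subseteq> {..<N}" "finite S" unfolding S_def jumps_def by (auto intro: finite_subset[of _ "{..<N}"])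
  have xE: "x ` {..<N} = unit_vec ` E" using g by (auto simp: x_def bij_betw_def)
  have gE: "g i \<in> E" if "i < N" for i using g that by (auto simp: bij_betw_def)
  have ginj: "g i = g j \<longleftrightarrow> i = j" if "i < N" "j < N" for i j
    using g that by (auto simp: bij_betw_def inj_on_def)
  have qx: "q *z x i \<in> L" if "i < N" for i
    using gE[OF that] unfolding L_def x_def by blast
  have H: "d *z x i \<notin> zfun.span (L \<union> x ` {..<i})" if i: "i \<in> S" and d: "0 < d" "d < q" for i d
  proof
    assume a: "d *z x i \<in> zfun.span (L \<union> x ` {..<i})"
    have "q *z x i \<in> zfun.span (L \<union> x ` {..<i})"
      using qx i S by (intro zfun.span_base) auto
    moreover have "coprime d q"
      using q(1) d by (metis coprime_commute prime_imp_coprime zdvd_not_zless)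
    ultimately have "x i \<in> zfun.span (L \<union> x ` {..<i})"
      using coprime_scale_in_span[OF a] by blast
    then show False using i by (simp add: S_def jumps_def)
  qed
  \<comment> \<open>Independence of the selected vectors modulo \<open>p\<close>: reduce the
    coefficients to digits and compare with the zero digits.\<close>
  have dvd: "q dvd c i" if c: "(\<Sum>i\<in>S. c i *z x i) \<in> zfun.span L" and i: "i \<in> S" for c i
  proof -
    have eq: "(\<Sum>i\<in>S. (c i mod q - 0) *z x i) = (\<Sum>i\<in>S. c i *z x i) - (\<Sum>i\<in>S. (c i div q) *z (q *z x i))"
      unfolding sum_subtractf[symmetric]
      by (intro sum.cong) (auto simp: fun_eq_iff zscale_apply minus_mult_div_eq_mod[symmetric] algebra_simps)
    have "(\<Sum>i\<in>S. (c i mod q - 0) *z x i) \<in> zfun.span L"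
      unfolding eq
    proof (rule zfun.span_diff[OF c zfun.span_sum[OF zfun.span_scale]])
      show "q *z x i \<in> zfun.span L" if "i \<in> S" for i
        using that S(1) by (intro zfun.span_base qx) auto
    qed
    then have "\<forall>i\<in>S. c i mod q = 0"
      using q by (intro jumps_unique[OF S(2) H, where b = "\<lambda>_. 0"]) auto
    then show ?thesis using i by auto
  qed
  have gen: "v \<in> zfun.span (L \<union> x ` S)" if "v \<in> supported E" for v
  proof -
    have "x ` {..<N} \<subseteq> zfun.span (L \<union> x ` S)"
      using jumps_span[of _ N x L] by (auto simp: S_def)
    then have "zfun.span (x ` {..<N}) \<subseteq> zfun.span (L \<union> x ` S)"
      by (rule zfun.span_minimal[OF _ zfun.subspace_span])
    then show ?thesis using that supported_subset_span_unit[OF E] unfolding xE by blast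
  qed
  have "\<forall>v\<in>supported E. \<exists>a. v - (\<Sum>i\<in>S. a i *z x i) \<in> zfun.span L"
    using span_insert_sum[OF S(2) gen] by blast
  from bchoice[OF this] obtain \<alpha>
    where \<alpha>: "\<And>v. v \<in> supported E \<Longrightarrow> v - (\<Sum>i\<in>S. \<alpha> v i *z x i) \<in> zfun.span L"
    by blast
  \<comment> \<open>The functional with values \<open>b\<close> on the basis, evaluated at
    \<open>unit_vec e\<close> through the coordinates \<open>\<alpha>\<close>.\<close>
  define F where "F = (\<lambda>b. \<lambda>e\<in>E. (\<Sum>i\<in>S. b i * \<alpha> (unit_vec e) i) mod q)"
  have F_mem: "F b \<in> annihilators q E T" for b
  proof -
    have "q dvd (\<Sum>e\<in>E. F b e * t e)" if t: "t \<in> T" for t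
    proof -
      \<comment> \<open>Coordinates of \<open>t\<close> in the basis. Since \<open>t\<close>
        vanishes in the quotient, independence makes all of them divisible by
        \<open>q\<close>.\<close>
      define c where "c = (\<lambda>i. \<Sum>e\<in>E. t e * \<alpha> (unit_vec e) i)"
      have tE: "t \<in> supported E" using t T by blast
      have "(\<Sum>i\<in>S. c i *z x i) = (\<Sum>e\<in>E. t e *z (\<Sum>i\<in>S. \<alpha> (unit_vec e) i *z x i))"
      proof
        fix y
        have "(\<Sum>i\<in>S. c i *z x i) y = (\<Sum>i\<in>S. \<Sum>e\<in>E. t e * \<alpha> (unit_vec e) i * x i y)"
          by (simp add: fun_sum_apply zscale_apply c_def sum_distrib_right)
        also have "\<dots> = (\<Sum>e\<in>E. \<Sum>i\<in>S. t e * \<alpha> (unit_vec e) i * x i y)" by (rule sum.swap)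
        also have "\<dots> = (\<Sum>e\<in>E. t e *z (\<Sum>i\<in>S. \<alpha> (unit_vec e) i *z x i)) y"
          by (simp add: fun_sum_apply zscale_apply sum_distrib_left mult.assoc)
        finally show "(\<Sum>i\<in>S. c i *z x i) y = \<dots>" .
      qed
      also have "\<dots> = t - (\<Sum>e\<in>E. t e *z (unit_vec e - (\<Sum>i\<in>S. \<alpha> (unit_vec e) i *z x i)))"
        by (subst (2) supported_expand[OF E tE])
           (simp add: fun_eq_iff zscale_apply fun_sum_apply right_diff_distrib sum_subtractf)
      also have "\<dots> \<in> zfun.span L"
        using t unit_vec_supported[of _ E]
        by (intro zfun.span_diff zfun.span_sum zfun.span_scale \<alpha>) (auto intro: zfun.span_base simp: L_def)
      finally have c: "q dvd c i" if "i \<in> S" for i using dvd that by blast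
      have "[(\<Sum>e\<in>E. F b e * t e) = (\<Sum>e\<in>E. (\<Sum>i\<in>S. b i * \<alpha> (unit_vec e) i) * t e)] (mod q)"
        by (intro cong_sum cong_mult) (auto simp: F_def cong_def)
      also have "(\<Sum>e\<in>E. (\<Sum>i\<in>S. b i * \<alpha> (unit_vec e) i) * t e) = (\<Sum>i\<in>S. b i * c i)"
        unfolding c_def sum_distrib_left sum_distrib_right
        by (subst sum.swap) (simp add: mult_ac)
      finally show ?thesis
        using c by (simp add: cong_dvd_iff dvd_sum)
    qed
    then show ?thesis using q by (auto simp: annihilators_def F_def)
  qed
  have F_val: "F b (g j) = b j" if j: "j \<in> S" and b: "0 \<le> b j" "b j < q" for b j
  proof -
    have jN: "j < N" using S(1) j by blast
    \<comment> \<open>\<open>\<alpha>\<close> comes from an arbitrary choice, so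
      \<open>\<alpha> (x j)\<close> agrees with the indicator of \<open>j\<close> only modulo
      \<open>q\<close>.\<close>
    have "q dvd of_bool (i = j) - \<alpha> (x j) i" if "i \<in> S" for i
    proof (rule dvd[OF _ that])
      have "(\<Sum>i\<in>S. of_bool (i = j) *z x i) = (\<Sum>i\<in>S. if i = j then x j else 0)"
        by (intro sum.cong) (auto simp: fun_eq_iff zscale_apply)
      also have "\<dots> = x j" using j S by simp
      finally have "(\<Sum>i\<in>S. (of_bool (i = j) - \<alpha> (x j) i) *z x i) = x j - (\<Sum>i\<in>S. \<alpha> (x j) i *z x i)"
        by (simp only: zfun.scale_left_diff_distrib sum_subtractf)
      also have "\<dots> \<in> zfun.span L"
        using gE[OF jN] by (intro \<alpha>) (simp add: x_def unit_vec_supported)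
      finally show "(\<Sum>i\<in>S. (of_bool (i = j) - \<alpha> (x j) i) *z x i) \<in> zfun.span L" .
    qed
    then have "[(\<Sum>i\<in>S. b i * \<alpha> (x j) i) = (\<Sum>i\<in>S. b i * of_bool (i = j))] (mod q)"
      by (intro cong_sum cong_mult) (auto simp: cong_iff_dvd_diff dvd_diff_commute)
    moreover have "(\<Sum>i\<in>S. b i * of_bool (i = j)) = b j"
    proof -
      have "(\<Sum>i\<in>S. b i * of_bool (i = j)) = (\<Sum>i\<in>S. if i = j then b j else 0)"
        by (intro sum.cong) auto
      then show ?thesis using j S by simp
    qed
    ultimately show ?thesis using b gE[OF jN] by (simp add: F_def cong_def x_def)
  qed
  have "inj_on F (S \<rightarrow>\<^sub>E {0..<q})"
  proof (rule inj_onI)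
    fix b b' assume b: "b \<in> S \<rightarrow>\<^sub>E {0..<q}" "b' \<in> S \<rightarrow>\<^sub>E {0..<q}" and eq: "F b = F b'"
    have "b j = b' j" if j: "j \<in> S" for j
    proof -
      have "b j \<in> {0..<q}" "b' j \<in> {0..<q}" using b j by (auto intro: PiE_mem)
      then show ?thesis using F_val[OF j, of b] F_val[OF j, of b'] eq by simp
    qed
    then show "b = b'" using b by (intro PiE_ext) auto
  qed
  moreover have "finite (annihilators q E T)"
    by (rule finite_subset[of _ "E \<rightarrow>\<^sub>E {0..<q}"]) (auto simp: annihilators_def intro: finite_PiE E)
  ultimately have "card (S \<rightarrow>\<^sub>E {0..<q}) \<le> card (annihilators q E T)"
    using F_mem by (intro card_inj_on_le[of F]) auto
  then have cardle: "p ^ card S \<le> card (annihilators q E T)"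
    using S by (simp add: card_PiE q_def)
  have ginjS: "inj_on g S" using g S(1) by (auto simp: bij_betw_def intro: inj_on_subset)
  show ?thesis
  proof (intro exI[of _ "g ` S"] conjI ballI)
    show "g ` S \<subseteq> E" using gE S by auto
    show "p ^ card (g ` S) \<le> card (annihilators (int p) E T)"
      using cardle by (simp add: card_image[OF ginjS] q_def)
    fix v assume "v \<in> supported E"
    \<comment> \<open>Regrouping the generators splits off the \<open>p\<close>-multiples, which are
      then collected into a single vector \<open>u\<close>.\<close>
    then have "v \<in> zfun.span ((T \<union> x ` S) \<union> (\<lambda>e. q *z unit_vec e) ` E)"
      using gen by (simp add: L_def Un_ac)
    then obtain a where a: "v - (\<Sum>e\<in>E. a e *z (q *z unit_vec e)) \<in> zfun.span (T \<union> x ` S)"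
      using span_insert_sum[OF E] by blast
    have "x ` S = unit_vec ` g ` S" by (auto simp: x_def)
    moreover have "(\<Sum>e\<in>E. a e *z (q *z unit_vec e)) = int p *z (\<Sum>e\<in>E. a e *z unit_vec e)"
      by (simp add: fun_eq_iff zscale_apply fun_sum_apply sum_distrib_left q_def mult_ac)
    moreover have "(\<Sum>e\<in>E. a e *z unit_vec e) \<in> supported E"
      by (intro zfun.subspace_sum[OF subspace_supported] zfun.subspace_scale[OF subspace_supported] unit_vec_supported)
    ultimately show "\<exists>u\<in>supported E. v - int p *z u \<in> zfun.span (T \<union> unit_vec ` g ` S)"
      using a by auto
  qed
qed

section \<open>Independent families of relations with index prime to p\<close>

lemma sum_fun_upd_remove:
  fixes m :: "'e \<Rightarrow> 'e \<Rightarrow> int"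
  assumes "finite E" "j \<in> E"
  shows "(\<Sum>e\<in>E. c e *z (m(j := t)) e) = c j *z t + (\<Sum>e\<in>E - {j}. c e *z m e)"
proof -
  have "(\<Sum>e\<in>E - {j}. c e *z (m(j := t)) e) = (\<Sum>e\<in>E - {j}. c e *z m e)"
    by (intro sum.cong) auto
  then show ?thesis using sum.remove[OF assms, of "\<lambda>e. c e *z (m(j := t)) e"] by simp
qed

text \<open>The sublattice into which all of \<open>T\<close> would fall if no relation could take
  the place of \<open>m j\<close>; being closed under integer combinations, it would then contain
  \<open>zfun.span T\<close>.\<close>

lemma combinations_subspace:
  fixes m :: "'e \<Rightarrow> 'e \<Rightarrow> int"
  assumes "j \<in> E"
  shows "zfun.subspace {l. \<exists>c. k *z l = (\<Sum>e\<in>E. c e *z m e) \<and> p dvd c j}"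
proof (intro zfun.subspaceI)
  have "k *z (0 :: 'e \<Rightarrow> int) = (\<Sum>e\<in>E. 0 *z m e)"
    by (simp add: fun_eq_iff zscale_apply fun_sum_apply)
  then show "0 \<in> {l. \<exists>c. k *z l = (\<Sum>e\<in>E. c e *z m e) \<and> p dvd c j}"
    by (intro CollectI exI[of _ "\<lambda>_. 0"]) simp
next
  fix u v assume "u \<in> {l. \<exists>c. k *z l = (\<Sum>e\<in>E. c e *z m e) \<and> p dvd c j}"
    "v \<in> {l. \<exists>c. k *z l = (\<Sum>e\<in>E. c e *z m e) \<and> p dvd c j}"
  then obtain c d where c: "k *z u = (\<Sum>e\<in>E. c e *z m e)" "p dvd c j"
    and d: "k *z v = (\<Sum>e\<in>E. d e *z m e)" "p dvd d j" by blast
  have "k *z (u + v) = (\<Sum>e\<in>E. (c e + d e) *z m e)"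
    by (simp only: zfun.scale_right_distrib zfun.scale_left_distrib sum.distrib c d)
  then show "u + v \<in> {l. \<exists>c. k *z l = (\<Sum>e\<in>E. c e *z m e) \<and> p dvd c j}"
    using c d by (intro CollectI exI[of _ "\<lambda>e. c e + d e"]) (simp add: dvd_add)
next
  fix a u assume "u \<in> {l. \<exists>c. k *z l = (\<Sum>e\<in>E. c e *z m e) \<and> p dvd c j}"
  then obtain c where c: "k *z u = (\<Sum>e\<in>E. c e *z m e)" "p dvd c j" by blast
  have "k *z (a *z u) = a *z (k *z u)" by (simp only: zfun.scale_left_commute)
  also have "\<dots> = (\<Sum>e\<in>E. (a * c e) *z m e)"
    by (simp only: c zfun.scale_sum_right zfun.scale_scale)
  finally show "a *z u \<in> {l. \<exists>c. k *z l = (\<Sum>e\<in>E. c e *z m e) \<and> p dvd c j}"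
    using c by (intro CollectI exI[of _ "\<lambda>e. a * c e"]) simp
qed

text \<open>A basis of the lattice localised at \<open>p\<close>, with \<open>k\<close> as common
  denominator. For a prime \<open>p\<close> and vectors supported on \<open>E\<close> it says that
  the square matrix with columns \<open>m e\<close> has determinant prime to \<open>p\<close>;
  carrying \<open>k\<close> instead of the determinant makes exchanges easy.\<close>

definition frame :: "int \<Rightarrow> 'e set \<Rightarrow> ('e \<Rightarrow> 'e \<Rightarrow> int) \<Rightarrow> int \<Rightarrow> bool" where
  "frame p E m k \<longleftrightarrow> coprime p k \<and>
     (\<forall>v\<in>supported E. \<exists>c. k *z v = (\<Sum>e\<in>E. c e *z m e)) \<and>
     (\<forall>c. (\<Sum>e\<in>E. c e *z m e) = 0 \<longrightarrow> (\<forall>e\<in>E. c e = 0))"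

text \<open>Steinitz exchange over the integers localised at \<open>p\<close>. Since
  \<open>T\<close> generates modulo \<open>p\<close>, its \<open>j\<close>-coordinates cannot all
  vanish modulo \<open>p\<close>; a \<open>t\<close> with \<open>c j\<close> prime to
  \<open>p\<close> replaces \<open>m j\<close>, and \<open>c j * k\<close> is the new
  denominator.\<close>

lemma frame_exchange:
  fixes T :: "('e \<Rightarrow> int) set"
  assumes p: "prime (p :: int)" and E: "finite E" and T: "T \<subseteq> supported E"
    and gen: "\<And>v. v \<in> supported E \<Longrightarrow> \<exists>u\<in>supported E. v - p *z u \<in> zfun.span T"
    and fr: "frame p E m k" and m: "\<And>e. e \<in> E \<Longrightarrow> m e \<in> supported E" and j: "j \<in> E"
  shows "\<exists>t\<in>T. \<exists>k'. frame p E (m(j := t)) k'"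
proof -
  have k: "coprime p k" and sp: "\<And>v. v \<in> supported E \<Longrightarrow> \<exists>c. k *z v = (\<Sum>e\<in>E. c e *z m e)"
    and ind: "\<And>c e. (\<Sum>e\<in>E. c e *z m e) = 0 \<Longrightarrow> e \<in> E \<Longrightarrow> c e = 0"
    using fr by (auto simp: frame_def)
  have "\<exists>t\<in>T. \<exists>c. k *z t = (\<Sum>e\<in>E. c e *z m e) \<and> \<not> p dvd c j"
  proof (rule ccontr)
    assume neg: "\<not> (\<exists>t\<in>T. \<exists>c. k *z t = (\<Sum>e\<in>E. c e *z m e) \<and> \<not> p dvd c j)"
    let ?Q = "{l. \<exists>c. k *z l = (\<Sum>e\<in>E. c e *z m e) \<and> p dvd c j}"
    have "T \<subseteq> ?Q"
    proof
      fix t assume t: "t \<in> T"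
      then obtain c where "k *z t = (\<Sum>e\<in>E. c e *z m e)" using sp T by blast
      then show "t \<in> ?Q" using neg t by blast
    qed
    then have "zfun.span T \<subseteq> ?Q" by (rule zfun.span_minimal[OF _ combinations_subspace[OF j]])
    moreover obtain u where u: "u \<in> supported E" "m j - p *z u \<in> zfun.span T"
      using gen[OF m[OF j]] by blast
    ultimately obtain c where c: "k *z (m j - p *z u) = (\<Sum>e\<in>E. c e *z m e)" "p dvd c j" by blast
    obtain d where d: "k *z u = (\<Sum>e\<in>E. d e *z m e)" using sp[OF u(1)] by blast
    have "(\<Sum>e\<in>E. (k * of_bool (e = j)) *z m e) = k *z m j"
    proof -
      have "(\<Sum>e\<in>E. (k * of_bool (e = j)) *z m e) = (\<Sum>e\<in>E. if e = j then k *z m j else 0)"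
        by (intro sum.cong) (auto simp: fun_eq_iff zscale_apply)
      then show ?thesis using j E by simp
    qed
    also have "k *z m j = k *z (m j - p *z u) + p *z (k *z u)"
      by (simp add: fun_eq_iff zscale_apply algebra_simps)
    also have "\<dots> = (\<Sum>e\<in>E. c e *z m e) + (\<Sum>e\<in>E. (p * d e) *z m e)"
      by (simp only: c d zfun.scale_sum_right zfun.scale_scale)
    finally have eq: "(\<Sum>e\<in>E. (k * of_bool (e = j)) *z m e)
        = (\<Sum>e\<in>E. c e *z m e) + (\<Sum>e\<in>E. (p * d e) *z m e)" .
    \<comment> \<open>Comparing the coefficients of \<open>m j\<close> in two expansions of
      \<open>k *z m j\<close> shows that \<open>p\<close> divides \<open>k\<close>.\<close>
    have "(\<Sum>e\<in>E. (k * of_bool (e = j) - (c e + p * d e)) *z m e) = 0"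
      by (simp only: zfun.scale_left_diff_distrib zfun.scale_left_distrib sum_subtractf sum.distrib eq) simp
    from ind[OF this j] have "k = c j + p * d j" by simp
    then have "p dvd k" using c(2) by simp
    then show False using k p by (metis coprime_def dvd_refl not_prime_unit)
  qed
  then obtain t c where t: "t \<in> T" and c: "k *z t = (\<Sum>e\<in>E. c e *z m e)" "\<not> p dvd c j" by blast
  have mj: "c j *z m j = k *z t - (\<Sum>e\<in>E - {j}. c e *z m e)"
    unfolding c(1) sum.remove[OF E j] by simp
  have "frame p E (m(j := t)) (c j * k)"
    unfolding frame_def
  proof (intro conjI ballI allI impI)
    show "coprime p (c j * k)" using k c(2) p by (simp add: prime_imp_coprime)
  next
    fix v assume "v \<in> supported E"
    then obtain d where d: "k *z v = (\<Sum>e\<in>E. d e *z m e)" using sp by blast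
    \<comment> \<open>Multiply the expansion of \<open>v\<close> by \<open>c j\<close> and eliminate
      \<open>m j\<close> by means of \<open>mj\<close>.\<close>
    define d' where "d' = (\<lambda>e. if e = j then d j * k else c j * d e - d j * c e)"
    have "(\<Sum>e\<in>E. d' e *z (m(j := t)) e) = d' j *z t + (\<Sum>e\<in>E - {j}. d' e *z m e)"
      by (rule sum_fun_upd_remove[OF E j])
    also have "(\<Sum>e\<in>E - {j}. d' e *z m e) = (\<Sum>e\<in>E - {j}. c j *z (d e *z m e) - d j *z (c e *z m e))"
      by (intro sum.cong) (auto simp: d'_def fun_eq_iff zscale_apply algebra_simps)
    also have "\<dots> = c j *z (\<Sum>e\<in>E - {j}. d e *z m e) - d j *z (\<Sum>e\<in>E - {j}. c e *z m e)"
      by (simp only: sum_subtractf zfun.scale_sum_right)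
    also have "(\<Sum>e\<in>E - {j}. c e *z m e) = k *z t - c j *z m j" using mj by simp
    also have "(\<Sum>e\<in>E - {j}. d e *z m e) = k *z v - d j *z m j"
      unfolding d sum.remove[OF E j] by simp
    also have "d' j *z t + (c j *z (k *z v - d j *z m j) - d j *z (k *z t - c j *z m j)) = (c j * k) *z v"
      by (simp add: d'_def fun_eq_iff zscale_apply algebra_simps)
    finally show "\<exists>c'. (c j * k) *z v = (\<Sum>e\<in>E. c' e *z (m(j := t)) e)" by metis
  next
    fix d e assume d0: "(\<Sum>e\<in>E. d e *z (m(j := t)) e) = 0" and e: "e \<in> E"
    have z: "d j *z t + (\<Sum>e\<in>E - {j}. d e *z m e) = 0"
      using d0 unfolding sum_fun_upd_remove[OF E j] .
    \<comment> \<open>Multiply the vanishing combination by \<open>k\<close> and expand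
      \<open>k *z t\<close> back in the old family.\<close>
    define d' where "d' = (\<lambda>e. if e = j then d j * c j else d j * c e + k * d e)"
    have "(\<Sum>e\<in>E. d' e *z m e) = d' j *z m j + (\<Sum>e\<in>E - {j}. d' e *z m e)"
      by (rule sum.remove[OF E j])
    also have "(\<Sum>e\<in>E - {j}. d' e *z m e) = (\<Sum>e\<in>E - {j}. d j *z (c e *z m e) + k *z (d e *z m e))"
      by (intro sum.cong) (auto simp: d'_def fun_eq_iff zscale_apply algebra_simps)
    also have "\<dots> = d j *z (\<Sum>e\<in>E - {j}. c e *z m e) + k *z (\<Sum>e\<in>E - {j}. d e *z m e)"
      by (simp only: sum.distrib zfun.scale_sum_right)
    also have "(\<Sum>e\<in>E - {j}. c e *z m e) = k *z t - c j *z m j" using mj by simp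
    also have "(\<Sum>e\<in>E - {j}. d e *z m e) = - (d j *z t)" using z by (simp add: eq_neg_iff_add_eq_0 add.commute)
    also have "d' j *z m j + (d j *z (k *z t - c j *z m j) + k *z - (d j *z t)) = 0"
      by (simp add: d'_def fun_eq_iff zscale_apply algebra_simps)
    finally have "(\<Sum>e\<in>E. d' e *z m e) = 0" .
    from ind[OF this] have d': "\<And>e. e \<in> E \<Longrightarrow> d' e = 0" by blast
    have "c j \<noteq> 0" "k \<noteq> 0" using c(2) k p by (auto simp: coprime_def)
    moreover have "d' j = 0" "d' e = 0" using d' e j by auto
    ultimately show "d e = 0" by (cases "e = j") (auto simp: d'_def)
  qed
  then show ?thesis using t by blast
qed

text \<open>A form of Nakayama's lemma: generation modulo \<open>p\<close> implies generation after
  localising at \<open>p\<close>. The unit vectors are exchanged for relations one index at a time;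
  \<open>F\<close> collects the indices already treated.\<close>

lemma exists_frame:
  fixes T :: "('e \<Rightarrow> int) set"
  assumes p: "prime (p :: int)" and E: "finite E" and T: "T \<subseteq> supported E"
    and gen: "\<And>v. v \<in> supported E \<Longrightarrow> \<exists>u\<in>supported E. v - p *z u \<in> zfun.span T"
  shows "\<exists>m k. frame p E m k \<and> (\<forall>e\<in>E. m e \<in> T)"
proof -
  have "\<exists>m k. frame p E m k \<and> (\<forall>e\<in>F. m e \<in> T) \<and> (\<forall>e\<in>E. m e \<in> supported E)" if "F \<subseteq> E" for F
    using finite_subset[OF that E] that
  proof (induction F rule: finite_induct)
    case empty
    have "frame p E unit_vec 1"
      unfolding frame_def
    proof (intro conjI ballI allI impI)
      show "\<exists>c. 1 *z v = (\<Sum>e\<in>E. c e *z unit_vec e)" if "v \<in> supported E" for v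
        using supported_expand[OF E that] by (intro exI[of _ v]) (simp only: zfun.scale_one)
      fix c e assume c: "(\<Sum>e\<in>E. c e *z unit_vec e) = 0" and e: "e \<in> E"
      have "(\<Sum>x\<in>E. c x *z unit_vec x) e = (\<Sum>x\<in>E. if e = x then c x else 0)"
        unfolding fun_sum_apply by (intro sum.cong) (auto simp: zscale_apply unit_vec_def)
      also have "\<dots> = c e" using E e by simp
      finally show "c e = 0" by (simp add: c)
    qed simp
    then show ?case
      by (intro exI[of _ unit_vec] exI[of _ "1 :: int"] conjI ballI unit_vec_supported) simp_all
  next
    case (insert j F)
    then obtain m k where m: "frame p E m k" "\<forall>e\<in>F. m e \<in> T" "\<forall>e\<in>E. m e \<in> supported E" by auto
    obtain t k' where t: "t \<in> T" "frame p E (m(j := t)) k'"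
      using frame_exchange[OF p E T gen m(1), of j] m(3) insert.prems by blast
    moreover have "t \<in> supported E" using t T by blast
    ultimately show ?case using m(2,3)
      by (intro exI[of _ "m(j := t)"] exI[of _ k'] conjI) (assumption | auto)+
  qed
  then show ?thesis by blast
qed

text \<open>Thus the quotient is killed by an integer prime to \<open>p\<close>, and so has no
  \<open>p\<close>-torsion when \<open>p\<close> is prime.\<close>

lemma frame_multiple_in_span:
  assumes "frame p E m k" "\<forall>e\<in>E. m e \<in> T" "v \<in> supported E"
  shows "k *z v \<in> zfun.span T"
proof -
  obtain c where "k *z v = (\<Sum>e\<in>E. c e *z m e)" using assms by (auto simp: frame_def)
  also have "\<dots> \<in> zfun.span T"
    using assms(2) by (intro zfun.span_sum zfun.span_scale zfun.span_base) blast
  finally show ?thesis .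
qed

text \<open>Reducing the coordinates with respect to the frame modulo \<open>k\<close> puts a representative into the
  parallelepiped spanned by the frame.\<close>

lemma frame_box_representative:
  assumes fr: "frame p E m k" and p: "\<not> is_unit p" and mT: "\<forall>e\<in>E. m e \<in> T"
    and T: "T \<subseteq> supported E" and v: "v \<in> supported E"
  shows "\<exists>r\<in>supported E. v - r \<in> zfun.span T \<and> (\<forall>x. \<bar>r x\<bar> \<le> (\<Sum>e\<in>E. \<bar>m e x\<bar>))"
proof -
  obtain c where c: "k *z v = (\<Sum>e\<in>E. c e *z m e)" using fr v by (auto simp: frame_def)
  have k: "k \<noteq> 0" using fr p by (auto simp: frame_def)
  define r where "r = v - (\<Sum>e\<in>E. (c e div k) *z m e)"
  have sp: "(\<Sum>e\<in>E. (c e div k) *z m e) \<in> zfun.span T"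
    using mT by (intro zfun.span_sum zfun.span_scale zfun.span_base) blast
  have "zfun.span T \<subseteq> supported E" by (rule zfun.span_minimal[OF T subspace_supported])
  then have r: "r \<in> supported E"
    unfolding r_def using sp by (intro zfun.subspace_diff[OF subspace_supported] v) blast
  have "\<bar>r x\<bar> \<le> (\<Sum>e\<in>E. \<bar>m e x\<bar>)" for x
  proof -
    have "k * v x = (\<Sum>e\<in>E. c e * m e x)"
      using fun_cong[OF c, of x] by (simp add: zscale_apply fun_sum_apply)
    then have "k * r x = (\<Sum>e\<in>E. c e * m e x) - (\<Sum>e\<in>E. k * (c e div k) * m e x)"
      by (simp add: r_def fun_sum_apply zscale_apply right_diff_distrib sum_distrib_left mult_ac)
    also have "\<dots> = (\<Sum>e\<in>E. (c e mod k) * m e x)"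
      by (simp add: sum_subtractf[symmetric] left_diff_distrib[symmetric] minus_mult_div_eq_mod)
    finally have "\<bar>k\<bar> * \<bar>r x\<bar> = \<bar>\<Sum>e\<in>E. (c e mod k) * m e x\<bar>" by (simp flip: abs_mult)
    also have "\<dots> \<le> (\<Sum>e\<in>E. \<bar>(c e mod k) * m e x\<bar>)" by (rule sum_abs)
    also have "\<dots> \<le> (\<Sum>e\<in>E. \<bar>k\<bar> * \<bar>m e x\<bar>)"
    proof (rule sum_mono)
      fix e
      have "\<bar>c e mod k\<bar> \<le> \<bar>k\<bar>" using abs_mod_less[OF k, of "c e"] by simp
      then show "\<bar>(c e mod k) * m e x\<bar> \<le> \<bar>k\<bar> * \<bar>m e x\<bar>"
        unfolding abs_mult by (intro mult_right_mono) auto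
    qed
    also have "\<dots> = \<bar>k\<bar> * (\<Sum>e\<in>E. \<bar>m e x\<bar>)" by (simp add: sum_distrib_left)
    finally show ?thesis using k by simp
  qed
  moreover have "v - r \<in> zfun.span T" using sp by (simp add: r_def)
  ultimately show ?thesis using r by blast
qed

text \<open>An l1 substitute for a determinant bound: \<open>1 + x \<le> exp x\<close> bounds the
  number of lattice points by the exponential of the total width. For the box of a frame the total
  width is governed by the l1 norms of the frame vectors, so short relations give an order
  exponential in \<open>card E\<close>.\<close>

lemma finite_box: "finite E \<Longrightarrow> finite {r \<in> supported E. \<forall>x. \<bar>r x\<bar> \<le> s x}"
  and card_box_le: "finite E \<Longrightarrow> (\<And>x. s x \<ge> 0) \<Longrightarrow>
    real (card {r \<in> supported E. \<forall>x. \<bar>r x\<bar> \<le> s x}) \<le> exp (2 * real_of_int (\<Sum>x\<in>E. s x))"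
proof -
  assume E: "finite E"
  let ?B = "{r \<in> supported E. \<forall>x. \<bar>r x\<bar> \<le> s x}"
  let ?P = "\<Pi>\<^sub>E x\<in>E. {- s x..s x}"
  have sub: "(\<lambda>r. restrict r E) ` ?B \<subseteq> ?P" by (auto simp: abs_le_iff minus_le_iff)
  have inj: "inj_on (\<lambda>r. restrict r E) ?B"
  proof (rule inj_onI)
    fix r r' assume r: "r \<in> ?B" "r' \<in> ?B" and eq: "restrict r E = restrict r' E"
    show "r = r'"
    proof
      fix x show "r x = r' x" using fun_cong[OF eq, of x] r by (cases "x \<in> E") (auto simp: supported_def)
    qed
  qed
  have finP: "finite ?P" using E by (intro finite_PiE) auto
  show "finite ?B" by (rule inj_on_finite[OF inj sub finP])
  assume s: "\<And>x. s x \<ge> 0"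
  have "card ?B \<le> card ?P" by (rule card_inj_on_le[OF inj sub finP])
  then have "real (card ?B) \<le> real (card ?P)" by simp
  also have "\<dots> = (\<Prod>x\<in>E. 1 + 2 * real_of_int (s x))"
    using E s by (simp add: card_PiE add.commute)
  also have "\<dots> \<le> (\<Prod>x\<in>E. exp (2 * real_of_int (s x)))"
    using s by (intro prod_mono conjI exp_ge_add_one_self) auto
  also have "\<dots> = exp (2 * real_of_int (\<Sum>x\<in>E. s x))"
    using E by (simp add: exp_sum sum_distrib_left)
  finally show "real (card ?B) \<le> exp (2 * real_of_int (\<Sum>x\<in>E. s x))" .
qed

text \<open>By \<open>gen\<close> the quotient by \<open>T\<close> has no torsion at primes below
  \<open>P\<close>, and this makes every strict step of the greedy chain have index at least
  \<open>P\<close>. A frame at a single prime bounds the order itself; \<open>P > 2\<close> makes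
  the prime 2 available for that.\<close>

lemma few_extra_generators:
  fixes T :: "('e \<Rightarrow> int) set"
  assumes E: "finite E" and T: "T \<subseteq> supported E"
    and norm: "\<And>t. t \<in> T \<Longrightarrow> (\<Sum>x\<in>E. \<bar>t x\<bar>) \<le> b" and P: "P > 2"
    and gen: "\<And>p v. prime p \<Longrightarrow> p < P \<Longrightarrow> v \<in> supported E \<Longrightarrow>
        \<exists>u\<in>supported E. v - int p *z u \<in> zfun.span T"
  shows "\<exists>S\<subseteq>E. supported E \<subseteq> zfun.span (T \<union> unit_vec ` S)
           \<and> real P ^ card S \<le> exp (2 * real_of_int b * real (card E))"
proof -
  define N where "N = card E"
  obtain g where g: "bij_betw g {..<N} E"
    using ex_bij_betw_nat_finite[OF E] by (auto simp: N_def atLeast0LessThan)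
  define x where "x = (\<lambda>i. unit_vec (g i))"
  define S where "S = jumps T x N"
  have S: "S \<subseteq> {..<N}" "finite S" unfolding S_def jumps_def by (auto intro: finite_subset[of _ "{..<N}"])
  have xE: "x ` {..<N} = unit_vec ` E" using g by (auto simp: x_def bij_betw_def)
  have gE: "g i \<in> E" if "i < N" for i using g that by (auto simp: bij_betw_def)
  \<comment> \<open>Cancels a multiplier below \<open>P\<close> one prime factor at a time, since an
    integer prime to that factor also carries the vector into the span. The set \<open>T'\<close> is
    arbitrary above \<open>T\<close> because it will be \<open>T\<close> together with the earlier
    vectors of the chain.\<close>
  have divide: "v \<in> zfun.span T'"
    if d: "d > 0" "d < P" and v: "v \<in> supported E" and T': "T \<subseteq> T'" and dv: "int d *z v \<in> zfun.span T'" for d v T'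
    using d v dv
  proof (induction d arbitrary: v rule: less_induct)
    case (less d)
    show ?case
    proof (cases "d = 1")
      case True
      then show ?thesis using less.prems(4) by (simp only: of_nat_1 zfun.scale_one)
    next
      case False
      then obtain p where p: "prime p" "p dvd d" using prime_factor_nat by blast
      then obtain d' where d': "d = p * d'" by (elim dvdE)
      have pd: "d' > 0" "d' < d" using less.prems(1) prime_gt_1_nat[OF p(1)] d' by auto
      have "p < P" using dvd_imp_le[OF p(2)] less.prems(1,2) by linarith
      note pd = pd this
      let ?w = "int d' *z v"
      have w: "?w \<in> supported E" using less.prems(3) by (rule zfun.subspace_scale[OF subspace_supported])
      have pw: "int p *z ?w \<in> zfun.span T'"
        using less.prems(4) by (simp only: d' of_nat_mult zfun.scale_scale)
      have pI: "prime (int p)" using p by simp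
      obtain m k where mk: "frame (int p) E m k" "\<forall>e\<in>E. m e \<in> T"
        using exists_frame[OF pI E T gen[OF p(1) pd(3)]] by blast
      have "k *z ?w \<in> zfun.span T'"
        using frame_multiple_in_span[OF mk w] zfun.span_mono[OF T'] by blast
      then have "?w \<in> zfun.span T'"
        using coprime_scale_in_span[OF pw] mk(1) by (auto simp: frame_def)
      then show ?thesis using less.IH[of d' v] pd less.prems by auto
    qed
  qed
  have H: "d *z x i \<notin> zfun.span (T \<union> x ` {..<i})" if i: "i \<in> S" and d: "0 < d" "d < int P" for i d
  proof
    assume a: "d *z x i \<in> zfun.span (T \<union> x ` {..<i})"
    have iN: "i < N" using i S(1) by blast
    have xi: "x i \<in> supported E" unfolding x_def by (intro unit_vec_supported gE iN)
    have "x i \<in> zfun.span (T \<union> x ` {..<i})"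
    proof (rule divide[OF _ _ xi])
      show "nat d > 0" "nat d < P" using d by auto
      have "int (nat d) = d" using d by simp
      then show "int (nat d) *z x i \<in> zfun.span (T \<union> x ` {..<i})" using a by (simp only:)
    qed blast
    then show False using i by (simp add: S_def jumps_def)
  qed
  obtain m k where mk: "frame 2 E m k" "\<forall>e\<in>E. m e \<in> T"
  proof -
    have "prime (2 :: int)" by simp
    from exists_frame[OF this E T] gen[of 2] P show thesis using that by auto
  qed
  define s where "s = (\<lambda>y. \<Sum>e\<in>E. \<bar>m e y\<bar>)"
  define B where "B = {r \<in> supported E. \<forall>y. \<bar>r y\<bar> \<le> s y}"
  have "\<forall>v\<in>supported E. \<exists>r. r \<in> B \<and> v - r \<in> zfun.span T"
  proof
    fix v :: "'e \<Rightarrow> int" assume v: "v \<in> supported E"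
    obtain r where "r \<in> supported E" "v - r \<in> zfun.span T" "\<forall>x. \<bar>r x\<bar> \<le> (\<Sum>e\<in>E. \<bar>m e x\<bar>)"
      using frame_box_representative[OF mk(1) _ mk(2) T v] by auto
    then show "\<exists>r. r \<in> B \<and> v - r \<in> zfun.span T" by (auto simp: B_def s_def)
  qed
  from bchoice[OF this] obtain \<rho> where \<rho>: "\<And>v. v \<in> supported E \<Longrightarrow> \<rho> v \<in> B"
      "\<And>v. v \<in> supported E \<Longrightarrow> v - \<rho> v \<in> zfun.span T" by blast
  let ?w = "\<lambda>a. \<Sum>i\<in>S. a i *z x i"
  have w: "?w a \<in> supported E" for a
    by (intro zfun.subspace_sum[OF subspace_supported] zfun.subspace_scale[OF subspace_supported])
       (use S gE in \<open>auto simp: x_def intro!: unit_vec_supported\<close>)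
  \<comment> \<open>Equal representatives mean that two combinations differ by an element of
    \<open>zfun.span T\<close>, so uniqueness of digits applies.\<close>
  have "inj_on (\<lambda>a. \<rho> (?w a)) (S \<rightarrow>\<^sub>E {0..<int P})"
  proof (rule inj_onI)
    fix a c assume ac: "a \<in> S \<rightarrow>\<^sub>E {0..<int P}" "c \<in> S \<rightarrow>\<^sub>E {0..<int P}" and eq: "\<rho> (?w a) = \<rho> (?w c)"
    have "(?w a - \<rho> (?w a)) - (?w c - \<rho> (?w c)) \<in> zfun.span T"
      by (intro zfun.span_diff \<rho> w)
    also have "(?w a - \<rho> (?w a)) - (?w c - \<rho> (?w c)) = (\<Sum>i\<in>S. (a i - c i) *z x i)"
      unfolding eq by (simp only: zfun.scale_left_diff_distrib sum_subtractf) simp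
    finally have "\<forall>i\<in>S. a i = c i"
      using PiE_mem[OF ac(1)] PiE_mem[OF ac(2)]
      by (intro jumps_unique[OF S(2) H]) auto
    then show "a = c" using ac by (intro PiE_ext) auto
  qed
  then have "card (S \<rightarrow>\<^sub>E {0..<int P}) \<le> card B"
    using \<rho>(1)[OF w] by (intro card_inj_on_le[of "\<lambda>a. \<rho> (?w a)"]) (auto simp: B_def intro!: finite_box E)
  moreover have "card (S \<rightarrow>\<^sub>E {0..<int P}) = P ^ card S" using S by (simp add: card_PiE)
  ultimately have "real P ^ card S \<le> real (card B)" by (simp flip: of_nat_power)
  also have "\<dots> \<le> exp (2 * real_of_int (\<Sum>x\<in>E. s x))"
    unfolding B_def by (rule card_box_le[OF E]) (simp add: s_def sum_nonneg)
  also have "\<dots> \<le> exp (2 * real_of_int b * real (card E))"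
  proof -
    \<comment> \<open>Exchanging the sums turns the total width of the box into the sum of the l1
      norms of \<open>card E\<close> relations.\<close>
    have "(\<Sum>y\<in>E. s y) = (\<Sum>e\<in>E. \<Sum>y\<in>E. \<bar>m e y\<bar>)" unfolding s_def by (rule sum.swap)
    also have "\<dots> \<le> (\<Sum>e\<in>E. b)" using mk(2) by (intro sum_mono norm) auto
    finally have "(\<Sum>y\<in>E. s y) \<le> int (card E) * b" by simp
    then have "real_of_int (\<Sum>y\<in>E. s y) \<le> real_of_int (int (card E) * b)" by (simp only: of_int_le_iff)
    then show ?thesis by (simp add: mult_ac)
  qed
  finally have card: "real P ^ card S \<le> exp (2 * real_of_int b * real (card E))" .
  have ginjS: "inj_on g S" using g S(1) by (auto simp: bij_betw_def intro: inj_on_subset)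
  have xS: "x ` S = unit_vec ` g ` S" by (auto simp: x_def)
  have "x ` {..<N} \<subseteq> zfun.span (T \<union> x ` S)"
    using jumps_span[of _ N x T] by (auto simp: S_def)
  then have "zfun.span (x ` {..<N}) \<subseteq> zfun.span (T \<union> x ` S)"
    by (rule zfun.span_minimal[OF _ zfun.subspace_span])
  then have "supported E \<subseteq> zfun.span (T \<union> unit_vec ` g ` S)"
    using supported_subset_span_unit[OF E] unfolding xE xS by blast
  then show ?thesis
    using gE S card by (intro exI[of _ "g ` S"]) (auto simp: card_image[OF ginjS])
qed

text \<open>The unit vectors chosen for the small primes join the relations; they respect the norm
  bound because \<open>b \<ge> 1\<close>, and generation modulo each \<open>p\<close> persists when
  \<open>T\<close> grows. The price is one logarithm of a count per small prime, plus a
  deterministic term that a large \<open>P\<close> makes small.\<close>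

lemma exists_integral_generators:
  fixes T :: "('e \<Rightarrow> int) set"
  assumes E: "finite E" and T: "T \<subseteq> supported E"
    and norm: "\<And>t. t \<in> T \<Longrightarrow> (\<Sum>x\<in>E. \<bar>t x\<bar>) \<le> b" and b: "b \<ge> 1" and P: "P > 2"
  shows "\<exists>S\<subseteq>E. supported E \<subseteq> zfun.span (T \<union> unit_vec ` S)
     \<and> real (card S) \<le> (\<Sum>p | prime p \<and> p < P. log (real p) (real (card (annihilators (int p) E T))))
          + 2 * real_of_int b * real (card E) / ln (real P)"
proof -
  let ?Q = "{p. prime p \<and> p < P}"
  have finQ: "finite ?Q" by (rule finite_subset[of _ "{..<P}"]) auto
  have "\<forall>p\<in>?Q. \<exists>S. S \<subseteq> E \<and> (\<forall>v\<in>supported E. \<exists>u\<in>supported E. v - int p *z u \<in> zfun.span (T \<union> unit_vec ` S))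
           \<and> p ^ card S \<le> card (annihilators (int p) E T)"
  proof
    fix p assume "p \<in> ?Q"
    then have "prime p" by simp
    from exists_mod_prime_generators[OF this E T]
    show "\<exists>S. S \<subseteq> E \<and> (\<forall>v\<in>supported E. \<exists>u\<in>supported E. v - int p *z u \<in> zfun.span (T \<union> unit_vec ` S))
           \<and> p ^ card S \<le> card (annihilators (int p) E T)" .
  qed
  from bchoice[OF this] obtain Sp where Sp: "\<And>p. p \<in> ?Q \<Longrightarrow> Sp p \<subseteq> E"
      "\<And>p v. p \<in> ?Q \<Longrightarrow> v \<in> supported E \<Longrightarrow> \<exists>u\<in>supported E. v - int p *z u \<in> zfun.span (T \<union> unit_vec ` Sp p)"
      "\<And>p. p \<in> ?Q \<Longrightarrow> p ^ card (Sp p) \<le> card (annihilators (int p) E T)" by blast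
  define S0 where "S0 = (\<Union>p\<in>?Q. Sp p)"
  have S0: "S0 \<subseteq> E" using Sp(1) by (auto simp: S0_def)
  have T0: "T \<union> unit_vec ` S0 \<subseteq> supported E" 
    using T S0 by (intro Un_least image_subsetI unit_vec_supported) blast+
  have unit_norm: "(\<Sum>x\<in>E. \<bar>unit_vec e x\<bar>) \<le> b" for e :: 'e
  proof -
    have "(\<Sum>x\<in>E. \<bar>unit_vec e x\<bar>) = (\<Sum>x\<in>E. if e = x then 1 else 0)"
      by (intro sum.cong) (auto simp: unit_vec_def)
    also have "\<dots> \<le> 1" using E by simp
    finally show ?thesis using b by simp
  qed
  have gen0: "\<exists>u\<in>supported E. v - int p *z u \<in> zfun.span (T \<union> unit_vec ` S0)"
    if "prime p" "p < P" "v \<in> supported E" for p v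
  proof -
    have "T \<union> unit_vec ` Sp p \<subseteq> T \<union> unit_vec ` S0" using that by (auto simp: S0_def)
    then show ?thesis using Sp(2)[of p v] that zfun.span_mono by blast
  qed
  have norm0: "(\<Sum>x\<in>E. \<bar>t x\<bar>) \<le> b" if "t \<in> T \<union> unit_vec ` S0" for t
    using that norm unit_norm by auto
  obtain S1 where S1: "S1 \<subseteq> E" "supported E \<subseteq> zfun.span ((T \<union> unit_vec ` S0) \<union> unit_vec ` S1)"
      "real P ^ card S1 \<le> exp (2 * real_of_int b * real (card E))"
    using few_extra_generators[OF E T0 norm0 P gen0] by blast
  have "card (Sp p) \<le> log (real p) (real (card (annihilators (int p) E T)))" if p: "p \<in> ?Q" for p
  proof -
    have p1: "real p > 1" using p prime_gt_1_nat by auto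
    have "p ^ card (Sp p) > 0" using p1 by simp
    then have "real p powr real (card (Sp p)) \<le> real (card (annihilators (int p) E T))"
      using Sp(3)[OF p] p1 by (simp add: powr_realpow flip: of_nat_power)
    moreover have "real (card (annihilators (int p) E T)) > 0"
      using Sp(3)[OF p] \<open>p ^ card (Sp p) > 0\<close> by linarith
    ultimately show ?thesis using p1 by (simp add: le_log_iff)
  qed
  then have "(\<Sum>p\<in>?Q. real (card (Sp p))) \<le> (\<Sum>p\<in>?Q. log (real p) (real (card (annihilators (int p) E T))))"
    by (intro sum_mono)
  moreover have "card S0 \<le> (\<Sum>p\<in>?Q. card (Sp p))" unfolding S0_def by (rule card_UN_le[OF finQ])
  then have "real (card S0) \<le> (\<Sum>p\<in>?Q. real (card (Sp p)))" by (simp flip: of_nat_sum)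
  moreover have "real (card S1) \<le> 2 * real_of_int b * real (card E) / ln (real P)"
  proof -
    have "ln (real P ^ card S1) \<le> ln (exp (2 * real_of_int b * real (card E)))"
      using S1(3) P by (subst ln_le_cancel_iff) auto
    then have "real (card S1) * ln (real P) \<le> 2 * real_of_int b * real (card E)"
      using P by (simp add: ln_realpow)
    then show ?thesis using P by (simp add: pos_le_divide_eq)
  qed
  moreover have "real (card (S0 \<union> S1)) \<le> real (card S0) + real (card S1)"
    using card_Un_le[of S0 S1] by (simp flip: of_nat_add)
  ultimately have "real (card (S0 \<union> S1)) \<le> (\<Sum>p\<in>?Q. log (real p) (real (card (annihilators (int p) E T))))
          + 2 * real_of_int b * real (card E) / ln (real P)" by linarith
  moreover have "supported E \<subseteq> zfun.span (T \<union> unit_vec ` (S0 \<union> S1))"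
    using S1(2) by (simp add: image_Un Un_assoc)
  ultimately show ?thesis using S0 S1(1) by (intro exI[of _ "S0 \<union> S1"]) auto
qed

section \<open>First homology of a complex with complete 1-skeleton\<close>

text \<open>One family for both coefficient rings: since \<open>x mod 0 = x\<close>, the case
  \<open>q = 0\<close> is the ring of integers, and a prime \<open>q\<close> gives the residue
  field. Homology is then computed once for all \<open>q\<close>.\<close>

definition zmod :: "int \<Rightarrow> int ring" where
  "zmod q = \<lparr>carrier = range (\<lambda>x. x mod q), mult = (\<lambda>x y. x * y mod q), one = 1 mod q,
     zero = 0, add = (\<lambda>x y. (x + y) mod q)\<rparr>"

lemma zmod_0: "zmod 0 = \<Z>"
  by (simp add: zmod_def fun_eq_iff)

lemma range_mod: "q > 0 \<Longrightarrow> range (\<lambda>x. x mod q) = {0..q - 1}" for q :: int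
  by (auto intro!: image_eqI[of x "\<lambda>x. x mod q" x for x])

lemma zmod_eq_residue_ring: "q > 1 \<Longrightarrow> zmod q = residue_ring q"
  by (simp add: zmod_def residue_ring_def range_mod)

lemma zmod_simps [simp]:
  "mult (zmod q) = (\<lambda>x y. x * y mod q)" "one (zmod q) = 1 mod q"
  "zero (zmod q) = 0" "add (zmod q) = (\<lambda>x y. (x + y) mod q)"
  by (simp_all add: zmod_def)

lemma zmod_carrier: "carrier (zmod q) = range (\<lambda>x. x mod q)"
  by (simp add: zmod_def)

lemma mod_in_zmod [simp]: "x mod q \<in> carrier (zmod q)"
  by (simp add: zmod_carrier)

lemma zmod_carrierD: "x \<in> carrier (zmod q) \<Longrightarrow> x mod q = x"
  by (auto simp: zmod_carrier)

lemma abelian_group_zmod: "abelian_group (zmod q)"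
proof (rule abelian_groupI)
  fix x assume x: "x \<in> carrier (zmod q)"
  show "\<exists>y\<in>carrier (zmod q). y \<oplus>\<^bsub>zmod q\<^esub> x = \<zero>\<^bsub>zmod q\<^esub>"
    by (rule bexI[of _ "(- x) mod q"]) (simp_all add: mod_simps)
next
  show "\<zero>\<^bsub>zmod q\<^esub> \<in> carrier (zmod q)" using mod_in_zmod[of 0 q] by simp
qed (simp_all add: mod_simps zmod_carrierD algebra_simps)

lemma cring_zmod: "cring (zmod q)"
proof (rule cringI[OF abelian_group_zmod])
  show "Group.comm_monoid (zmod q)"
  proof (rule comm_monoidI)
    show "\<one>\<^bsub>zmod q\<^esub> \<in> carrier (zmod q)" by simp
    show "\<one>\<^bsub>zmod q\<^esub> \<otimes>\<^bsub>zmod q\<^esub> x = x" if "x \<in> carrier (zmod q)" for x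
      using zmod_carrierD[OF that] by (simp add: mod_simps)
  qed (simp_all add: mod_simps mult_ac)
qed (simp add: mod_simps algebra_simps)

lemma zmod_a_inv: "x \<in> carrier (zmod q) \<Longrightarrow> \<ominus>\<^bsub>zmod q\<^esub> x = (- x) mod q"
proof -
  interpret abelian_group "zmod q" by (rule abelian_group_zmod)
  assume x: "x \<in> carrier (zmod q)"
  show ?thesis by (rule minus_equality) (use x in \<open>simp_all add: mod_simps\<close>)
qed

lemma zmod_finsum:
  assumes "finite A" shows "finsum (zmod q) (\<lambda>i. f i mod q) A = (\<Sum>i\<in>A. f i) mod q"
  using assms
proof (induction A rule: finite_induct)
  interpret cring "zmod q" by (rule cring_zmod)
  case empty show ?case by simp
next
  interpret cring "zmod q" by (rule cring_zmod)
  case (insert x A)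
  then show ?case by (subst finsum_insert) (simp_all add: mod_simps)
qed

lemma zmod_neg_one_pow: "(\<ominus>\<^bsub>zmod q\<^esub> \<one>\<^bsub>zmod q\<^esub>) [^]\<^bsub>zmod q\<^esub> (k :: nat) = (- 1) ^ k mod q"
proof -
  interpret cring "zmod q" by (rule cring_zmod)
  have m: "\<ominus>\<^bsub>zmod q\<^esub> \<one>\<^bsub>zmod q\<^esub> = (- 1) mod q"
    by (subst zmod_a_inv) (simp_all add: mod_simps)
  show ?thesis unfolding m by (induction k) (simp_all add: mod_simps)
qed

lemma zmod_sign_mult: "((\<ominus>\<^bsub>zmod q\<^esub> \<one>\<^bsub>zmod q\<^esub>) [^]\<^bsub>zmod q\<^esub> (k :: nat)) \<otimes>\<^bsub>zmod q\<^esub> c = ((- 1) ^ k * c) mod q"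
  unfolding zmod_neg_one_pow by (simp add: mod_simps)

section \<open>Cycles and boundaries in degree one\<close>

definition edge_sign :: "nat \<Rightarrow> nat \<Rightarrow> int" where
  "edge_sign u v = (if u < v then - 1 else 1)"

definition int_boundary :: "nat \<Rightarrow> (nat set \<Rightarrow> int) \<Rightarrow> nat \<Rightarrow> int" where
  "int_boundary n y u = (\<Sum>v\<in>{1..n} - {u}. edge_sign u v * y {u, v})"

text \<open>The boundary of the face \<open>F\<close> as an integer vector; the exponent follows the
  sign convention of \<open>boundary\<close>, with \<open>v\<close> the vertex opposite to
  \<open>\<tau>\<close>.\<close>

definition triangle_vec :: "nat set \<Rightarrow> nat set \<Rightarrow> int" where
  "triangle_vec F = (\<lambda>\<tau>. \<Sum>v\<in>F. if \<tau> = F - {v} then (- 1) ^ card {u \<in> \<tau>. u < v} else 0)"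

text \<open>Chains over \<open>zmod q\<close> are represented by integer functions and reduced edge
  by edge. Cycles and boundaries become images of subgroups of one integer module, where the lattice
  results apply.\<close>

definition mod_chain :: "nat \<Rightarrow> int \<Rightarrow> (nat set \<Rightarrow> int) \<Rightarrow> nat set \<Rightarrow> int" where
  "mod_chain n q y = (\<lambda>e\<in>edges n. y e mod q)"

definition mod_cycles :: "nat \<Rightarrow> int \<Rightarrow> (nat set \<Rightarrow> int) set" where
  "mod_cycles n q = {y. \<forall>u\<in>{1..n}. q dvd int_boundary n y u}"

locale two_complex =
  fixes n :: nat and K :: "nat set set"
  assumes K_sub: "K \<subseteq> Pow {1..n}"
    and vertices_K: "\<And>v. v \<in> {1..n} \<Longrightarrow> {v} \<in> K"
    and edges_K: "edges n \<subseteq> K"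
begin

definition faces :: "nat set set" where "faces = simplices K 2"

definition boundary_span :: "(nat set \<Rightarrow> int) set" where
  "boundary_span = zfun.span (triangle_vec ` faces)"

lemma finite_K: "finite K" using K_sub by (rule finite_subset) simp

lemma finite_faces: "finite faces"
  using finite_K by (simp add: faces_def simplices_def)

lemma simplices_0: "simplices K 0 = (\<lambda>v. {v}) ` {1..n}"
proof (intro equalityI subsetI)
  fix \<sigma> assume "\<sigma> \<in> simplices K 0"
  then obtain v where "\<sigma> = {v}" "\<sigma> \<in> K" by (auto simp: simplices_def card_1_singleton_iff)
  then show "\<sigma> \<in> (\<lambda>v. {v}) ` {1..n}" using K_sub by auto
qed (use vertices_K in \<open>auto simp: simplices_def\<close>)

lemma simplices_1: "simplices K 1 = edges n"
  using K_sub edges_K by (auto simp: simplices_def edges_def numeral_2_eq_2)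

lemmas simplices_Suc_0 = simplices_1[unfolded One_nat_def]

lemma facesE:
  assumes "F \<in> faces"
  obtains a b c where "F = {a, b, c}" "a < b" "b < c" "a \<in> {1..n}" "b \<in> {1..n}" "c \<in> {1..n}"
proof -
  have F: "card F = 3" "F \<subseteq> {1..n}" using assms K_sub by (auto simp: faces_def simplices_def)
  then have fin: "finite F" by (simp add: card_ge_0_finite)
  obtain x y z where xyz: "F = {x, y, z}" "x \<noteq> y" "y \<noteq> z" "x \<noteq> z"
    using F(1) by (auto simp: card_3_iff)
  have ord: "\<exists>a b c. {x, y, z} = {a, b, c} \<and> a < b \<and> b < c"
    if "x < y" "y \<noteq> z" "x \<noteq> z" for x y z :: nat
  proof -
    have "y < z \<or> (x < z \<and> z < y) \<or> z < x" using that by linarith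
    moreover have "{x, y, z} = {x, z, y}" "{x, y, z} = {z, x, y}" by auto
    ultimately show ?thesis using that(1) by blast
  qed
  have "\<exists>a b c. F = {a, b, c} \<and> a < b \<and> b < c"
  proof (cases "x < y")
    case True
    then show ?thesis using ord[of x y z] xyz by simp
  next
    case False
    then have "y < x" using xyz by linarith
    then have "\<exists>a b c. {y, x, z} = {a, b, c} \<and> a < b \<and> b < c" using ord[of y x z] xyz by simp
    moreover have "{y, x, z} = F" using xyz(1) by auto
    ultimately show ?thesis by simp
  qed
  then obtain a b c where "F = {a, b, c}" "a < b" "b < c" by blast
  then show ?thesis using F(2) that by auto
qed

lemma triangle_vec_eq:
  assumes "a < b" "b < c"
  shows "triangle_vec {a, b, c} = (\<lambda>\<tau>. of_bool (\<tau> = {b, c}) - of_bool (\<tau> = {a, c}) + of_bool (\<tau> = {a, b}))"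
proof
  fix \<tau>
  have d: "{a, b, c} - {a} = {b, c}" "{a, b, c} - {b} = {a, c}" "{a, b, c} - {c} = {a, b}" using assms by auto
  have e: "{u \<in> {b, c}. u < a} = {}" "{u \<in> {a, c}. u < b} = {a}" "{u \<in> {a, b}. u < c} = {a, b}" using assms by auto
  have ne: "a \<noteq> b" "a \<noteq> c" "b \<noteq> c" using assms by auto
  have "triangle_vec {a, b, c} \<tau> = (if \<tau> = {b, c} then (- 1) ^ card {u \<in> \<tau>. u < a} else 0)
     + (if \<tau> = {a, c} then (- 1) ^ card {u \<in> \<tau>. u < b} else 0)
     + (if \<tau> = {a, b} then (- 1) ^ card {u \<in> \<tau>. u < c} else 0)"
    unfolding triangle_vec_def using ne by (simp add: d)
  also have "\<dots> = of_bool (\<tau> = {b, c}) - of_bool (\<tau> = {a, c}) + of_bool (\<tau> = {a, b})"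
  proof -
    have c: "card {a} = 1" "card {a, b} = 2" "card ({} :: nat set) = 0" using ne by simp_all
    have "(if \<tau> = {b, c} then (- 1) ^ card {u \<in> \<tau>. u < a} else 0) = (of_bool (\<tau> = {b, c}) :: int)"
      by (cases "\<tau> = {b, c}") (simp_all only: e c if_True if_False of_bool_eq power_0 simp_thms)
    moreover have "(if \<tau> = {a, c} then (- 1) ^ card {u \<in> \<tau>. u < b} else 0) = - (of_bool (\<tau> = {a, c}) :: int)"
      by (cases "\<tau> = {a, c}") (simp_all only: e c if_True if_False of_bool_eq power_one_right minus_zero simp_thms)
    moreover have "(if \<tau> = {a, b} then (- 1) ^ card {u \<in> \<tau>. u < c} else 0) = (of_bool (\<tau> = {a, b}) :: int)"
      by (cases "\<tau> = {a, b}") (simp_all only: e c if_True if_False of_bool_eq power2_minus power_one simp_thms)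
    ultimately show ?thesis by simp
  qed
  finally show "triangle_vec {a, b, c} \<tau> = of_bool (\<tau> = {b, c}) - of_bool (\<tau> = {a, c}) + of_bool (\<tau> = {a, b})" .
qed

lemma int_boundary_add: "int_boundary n (x + y) u = int_boundary n x u + int_boundary n y u"
  by (simp add: int_boundary_def sum.distrib algebra_simps)

lemma int_boundary_scale: "int_boundary n (c *z y) u = c * int_boundary n y u"
  by (simp add: int_boundary_def sum_distrib_left zscale_apply mult_ac)

lemma subspace_mod_cycles: "zfun.subspace (mod_cycles n q)"
  by (intro zfun.subspaceI)
     (auto simp: mod_cycles_def int_boundary_add int_boundary_scale int_boundary_def[of _ 0])

text \<open>The square of the boundary map vanishes, here already over the integers; so face
  boundaries are cycles for every modulus at once.\<close>

lemma int_boundary_triangle: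
  assumes "F \<in> faces" shows "int_boundary n (triangle_vec F) u = 0"
proof -
  obtain a b c where F: "F = {a, b, c}" "a < b" "b < c" "a \<in> {1..n}" "b \<in> {1..n}" "c \<in> {1..n}"
    using assms by (elim facesE)
  have ne: "a \<noteq> b" "a \<noteq> c" "b \<noteq> c" using F by auto
  have eq: "int_boundary n (triangle_vec F) u
     = (\<Sum>v\<in>{1..n} - {u}. edge_sign u v * of_bool ({u, v} = {b, c}))
     - (\<Sum>v\<in>{1..n} - {u}. edge_sign u v * of_bool ({u, v} = {a, c}))
     + (\<Sum>v\<in>{1..n} - {u}. edge_sign u v * of_bool ({u, v} = {a, b}))"
    unfolding int_boundary_def F(1) triangle_vec_eq[OF F(2,3)]
    by (simp add: sum.distrib sum_subtractf algebra_simps)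
  have one: "(\<Sum>v\<in>{1..n} - {u}. edge_sign u v * of_bool ({u, v} = {x, y}))
     = (if u = x then edge_sign x y else if u = y then edge_sign y x else 0)"
    if xy: "x \<in> {1..n}" "y \<in> {1..n}" "x \<noteq> y" for x y
  proof -
    have "(\<Sum>v\<in>{1..n} - {u}. edge_sign u v * of_bool ({u, v} = {x, y}))
      = (\<Sum>v\<in>{1..n} - {u}. (if v = y then of_bool (u = x) * edge_sign x y else 0)
           + (if v = x then of_bool (u = y) * edge_sign y x else 0))"
      using xy by (intro sum.cong) (auto simp: doubleton_eq_iff)
    also have "\<dots> = (if u = x then edge_sign x y else if u = y then edge_sign y x else 0)"
      using xy by (auto simp: sum.distrib)
    finally show ?thesis .
  qed
  show ?thesis
    unfolding eq one[OF F(5,6) ne(3)] one[OF F(4,6) ne(2)] one[OF F(4,5) ne(1)]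
    using F(2,3) by (auto simp: edge_sign_def)
qed

lemma boundary_span_cycles: "boundary_span \<subseteq> mod_cycles n q"
  unfolding boundary_span_def
  by (rule zfun.span_minimal[OF _ subspace_mod_cycles]) (auto simp: mod_cycles_def int_boundary_triangle)

lemma mod_chain_carrier: "mod_chain n q y \<in> carrier (chain_module (zmod q) K 1)"
  by (simp add: chain_module_def mod_chain_def simplices_Suc_0)

lemma mod_chain_id: "c \<in> carrier (chain_module (zmod q) K 1) \<Longrightarrow> mod_chain n q c = c"
  by (auto simp: chain_module_def mod_chain_def simplices_Suc_0 fun_eq_iff zmod_carrierD PiE_def Pi_def extensional_def)

lemma mod_chain_cong: "(\<And>e. e \<in> edges n \<Longrightarrow> q dvd y e - z e) \<Longrightarrow> mod_chain n q y = mod_chain n q z"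
  by (auto simp: mod_chain_def fun_eq_iff mod_eq_dvd_iff)

lemma boundary_0_eq:
  assumes "c \<in> carrier (chain_module (zmod q) K 1)" "u \<in> {1..n}"
  shows "boundary (zmod q) K 0 c {u} = int_boundary n c u mod q"
proof -
  have "{v. v \<notin> {u} \<and> insert v {u} \<in> K} = {1..n} - {u}"
    using K_sub edges_K pair_in_edges[OF _ assms(2)] by (auto simp: subset_iff)
  moreover have "(- 1) ^ card {x \<in> {u}. x < v} = edge_sign u v" for v
  proof (cases "u < v")
    case True
    then have "{x \<in> {u}. x < v} = {u}" by auto
    then show ?thesis using True by (simp add: edge_sign_def)
  next
    case False
    then have "{x \<in> {u}. x < v} = {}" by auto
    then show ?thesis using False by (simp only: edge_sign_def) simp
  qed
  ultimately have "boundary (zmod q) K 0 c {u}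
      = finsum (zmod q) (\<lambda>v. (edge_sign u v * c {u, v}) mod q) ({1..n} - {u})"
    using assms(2) unfolding boundary_def zmod_sign_mult simplices_0
    by (simp add: insert_commute)
  then show ?thesis by (simp add: zmod_finsum int_boundary_def)
qed

lemma cycles_eq: "cycles (zmod q) K 1 = mod_chain n q ` mod_cycles n q"
proof (intro equalityI subsetI)
  fix c assume "c \<in> cycles (zmod q) K 1"
  then have c: "c \<in> carrier (chain_module (zmod q) K 1)"
    "boundary (zmod q) K 0 c = \<zero>\<^bsub>chain_module (zmod q) K 0\<^esub>" by auto
  have "int_boundary n c u mod q = 0" if "u \<in> {1..n}" for u
    using boundary_0_eq[OF c(1) that] that c(2) by (simp add: chain_module_def simplices_0)
  then have "c \<in> mod_cycles n q" unfolding mod_cycles_def dvd_eq_mod_eq_0 by blast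
  then show "c \<in> mod_chain n q ` mod_cycles n q" using mod_chain_id[OF c(1)] by (metis image_eqI)
next
  fix c assume "c \<in> mod_chain n q ` mod_cycles n q"
  then obtain y where y: "y \<in> mod_cycles n q" "c = mod_chain n q y" by blast
  have c: "c \<in> carrier (chain_module (zmod q) K 1)" using y mod_chain_carrier by simp
  have "boundary (zmod q) K 0 c = \<zero>\<^bsub>chain_module (zmod q) K 0\<^esub>"
  proof
    fix \<sigma>
    show "boundary (zmod q) K 0 c \<sigma> = \<zero>\<^bsub>chain_module (zmod q) K 0\<^esub> \<sigma>"
    proof (cases "\<sigma> \<in> simplices K 0")
      case True
      then obtain u where u: "u \<in> {1..n}" "\<sigma> = {u}" by (auto simp: simplices_0)
      have "int_boundary n c u mod q = int_boundary n y u mod q"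
      proof -
        have "[edge_sign u v * c {u, v} = edge_sign u v * y {u, v}] (mod q)" if "v \<in> {1..n} - {u}" for v
          using that u pair_in_edges[of u n v] by (intro cong_mult) (auto simp: y mod_chain_def cong_def)
        then have "[int_boundary n c u = int_boundary n y u] (mod q)"
          unfolding int_boundary_def by (rule cong_sum)
        then show ?thesis by (simp add: cong_def)
      qed
      also have "\<dots> = 0" using y u by (auto simp: mod_cycles_def)
      finally show ?thesis using boundary_0_eq[OF c u(1)] u True by (simp add: chain_module_def)
    next
      case False
      then show ?thesis by (simp add: boundary_def chain_module_def)
    qed
  qed
  then show "c \<in> cycles (zmod q) K 1" using c by simp
qed

text \<open>\<open>boundary\<close> sums at each edge over the opposite vertices. Regrouping by
  faces exhibits boundaries as reductions of integer combinations of the vectors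
  \<open>triangle_vec F\<close>.\<close>

lemma boundary_1_eq:
  assumes "x \<in> carrier (chain_module (zmod q) K 2)"
  shows "boundary (zmod q) K 1 x = mod_chain n q (\<Sum>F\<in>faces. x F *z triangle_vec F)"
proof
  fix \<tau>
  show "boundary (zmod q) K 1 x \<tau> = mod_chain n q (\<Sum>F\<in>faces. x F *z triangle_vec F) \<tau>"
  proof (cases "\<tau> \<in> edges n")
    case True
    let ?V = "{v. v \<notin> \<tau> \<and> insert v \<tau> \<in> K}"
    have \<tau>: "card \<tau> = 2" "finite \<tau>" using True by (auto simp: edges_def card_ge_0_finite)
    have finV: "finite ?V" by (rule finite_subset[of _ "{1..n}"]) (use K_sub in auto)
    have "boundary (zmod q) K 1 x \<tau>
       = finsum (zmod q) (\<lambda>v. ((- 1) ^ card {u \<in> \<tau>. u < v} * x (insert v \<tau>)) mod q) ?V"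
      using True unfolding boundary_def zmod_sign_mult simplices_1 by simp
    also have "\<dots> = (\<Sum>v\<in>?V. (- 1) ^ card {u \<in> \<tau>. u < v} * x (insert v \<tau>)) mod q"
      by (rule zmod_finsum[OF finV])
    \<comment> \<open>For a fixed edge, the opposite vertex and the face containing both determine
      each other, so the sum can be reindexed.\<close>
    also have "(\<Sum>v\<in>?V. (- 1) ^ card {u \<in> \<tau>. u < v} * x (insert v \<tau>))
      = (\<Sum>F\<in>(\<lambda>v. insert v \<tau>) ` ?V. x F * triangle_vec F \<tau>)"
    proof (subst sum.reindex)
      show "inj_on (\<lambda>v. insert v \<tau>) ?V" by (rule inj_onI) blast
      show "(\<Sum>v\<in>?V. (- 1) ^ card {u \<in> \<tau>. u < v} * x (insert v \<tau>))
          = sum ((\<lambda>F. x F * triangle_vec F \<tau>) \<circ> (\<lambda>v. insert v \<tau>)) ?V"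
      proof (rule sum.cong[OF refl])
        fix v assume v: "v \<in> ?V"
        have "\<tau> = insert v \<tau> - {y} \<longleftrightarrow> y = v" if "y \<in> insert v \<tau>" for y
          using that v by blast
        then have "triangle_vec (insert v \<tau>) \<tau> = (\<Sum>y\<in>insert v \<tau>. if y = v then (- 1) ^ card {u \<in> \<tau>. u < v} else 0)"
          unfolding triangle_vec_def by (intro sum.cong) auto
        also have "\<dots> = (- 1) ^ card {u \<in> \<tau>. u < v}" using \<tau> by simp
        finally show "(- 1) ^ card {u \<in> \<tau>. u < v} * x (insert v \<tau>)
            = ((\<lambda>F. x F * triangle_vec F \<tau>) \<circ> (\<lambda>v. insert v \<tau>)) v" by (simp add: mult.commute)
      qed
    qed
    also have "\<dots> = (\<Sum>F\<in>faces. x F * triangle_vec F \<tau>)"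
    proof (rule sum.mono_neutral_left[OF finite_faces])
      show "(\<lambda>v. insert v \<tau>) ` ?V \<subseteq> faces" using \<tau> by (auto simp: faces_def simplices_def)
      show "\<forall>F\<in>faces - (\<lambda>v. insert v \<tau>) ` ?V. x F * triangle_vec F \<tau> = 0"
      proof
        fix F assume F: "F \<in> faces - (\<lambda>v. insert v \<tau>) ` ?V"
        have "\<tau> \<noteq> F - {v}" if v: "v \<in> F" for v
        proof
          assume t: "\<tau> = F - {v}"
          then have "F = insert v \<tau>" "v \<notin> \<tau>" using v by auto
          moreover have "F \<in> K" using F by (auto simp: faces_def simplices_def)
          ultimately show False using F by blast
        qed
        then have "triangle_vec F \<tau> = 0" unfolding triangle_vec_def by (intro sum.neutral) auto
        then show "x F * triangle_vec F \<tau> = 0" by simp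
      qed
    qed
    finally show ?thesis using True by (simp add: mod_chain_def fun_sum_apply zscale_apply)
  next
    case False
    then show ?thesis by (simp add: boundary_def mod_chain_def flip: simplices_1)
  qed
qed

lemma boundaries_eq: "boundaries (zmod q) K 1 = mod_chain n q ` boundary_span"
proof (intro equalityI subsetI)
  fix c assume "c \<in> boundaries (zmod q) K 1"
  then obtain x where x: "x \<in> carrier (chain_module (zmod q) K 2)" "c = boundary (zmod q) K 1 x"
    by (auto simp: boundaries_def numeral_2_eq_2)
  have "(\<Sum>F\<in>faces. x F *z triangle_vec F) \<in> boundary_span"
    unfolding boundary_span_def by (intro zfun.span_sum zfun.span_scale zfun.span_base) blast
  then show "c \<in> mod_chain n q ` boundary_span" unfolding x(2) boundary_1_eq[OF x(1)] by blast
next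
  fix c assume "c \<in> mod_chain n q ` boundary_span"
  \<comment> \<open>The empty union gives the shape of \<open>span_insert_sum\<close>, which then
    yields coefficients with no remainder.\<close>
  then obtain y where y: "y \<in> zfun.span ({} \<union> triangle_vec ` faces)" "c = mod_chain n q y"
    by (auto simp: boundary_span_def)
  obtain a where "y - (\<Sum>F\<in>faces. a F *z triangle_vec F) \<in> zfun.span {}"
    using span_insert_sum[OF finite_faces y(1)] by blast
  then have a: "y = (\<Sum>F\<in>faces. a F *z triangle_vec F)" by simp
  define x where "x = (\<lambda>F\<in>faces. a F mod q)"
  have x: "x \<in> carrier (chain_module (zmod q) K 2)"
    by (simp add: x_def chain_module_def faces_def)
  have "c = mod_chain n q (\<Sum>F\<in>faces. x F *z triangle_vec F)"
    unfolding y(2) a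
  proof (rule mod_chain_cong)
    fix e
    have "[(\<Sum>F\<in>faces. a F * triangle_vec F e) = (\<Sum>F\<in>faces. x F * triangle_vec F e)] (mod q)"
      by (intro cong_sum cong_mult) (auto simp: x_def cong_def)
    then show "q dvd (\<Sum>F\<in>faces. a F *z triangle_vec F) e - (\<Sum>F\<in>faces. x F *z triangle_vec F) e"
      by (simp add: fun_sum_apply zscale_apply cong_iff_dvd_diff)
  qed
  also have "\<dots> = boundary (zmod q) K 1 x" by (rule boundary_1_eq[OF x, symmetric])
  finally show "c \<in> boundaries (zmod q) K 1" using x by (auto simp: boundaries_def numeral_2_eq_2)
qed

end

declare One_nat_def [simp del]

section \<open>Homology classes and the operations on them\<close>

context two_complex
begin

text \<open>The coset of the reduction of \<open>y\<close>, defined for an arbitrary integer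
  function; it belongs to \<open>H1 q\<close> when \<open>y\<close> is a cycle modulo
  \<open>q\<close>. All operations on \<open>H1 q\<close> can then be computed on
  representatives.\<close>

definition cls :: "int \<Rightarrow> (nat set \<Rightarrow> int) \<Rightarrow> (nat set \<Rightarrow> int) set" where
  "cls q y = (\<lambda>b. mod_chain n q (b + y)) ` boundary_span"

abbreviation H1 :: "int \<Rightarrow> (int, (nat set \<Rightarrow> int) set) module" where
  "H1 q \<equiv> homology (zmod q) K 1"

lemma boundary_span_add: "a \<in> boundary_span \<Longrightarrow> b \<in> boundary_span \<Longrightarrow> a + b \<in> boundary_span"
  and boundary_span_diff: "a \<in> boundary_span \<Longrightarrow> b \<in> boundary_span \<Longrightarrow> a - b \<in> boundary_span"
  and boundary_span_scale: "a \<in> boundary_span \<Longrightarrow> c *z a \<in> boundary_span"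
  and boundary_span_0: "0 \<in> boundary_span"
  by (simp_all add: boundary_span_def zfun.span_add zfun.span_diff zfun.span_scale zfun.span_zero)

definition cycle_module :: "int \<Rightarrow> (int, nat set \<Rightarrow> int) module" where
  "cycle_module q = (chain_module (zmod q) K 1)\<lparr>carrier := cycles (zmod q) K 1\<rparr>"

lemma homology_eq: "H1 q = quotient_module (cycle_module q) (mod_chain n q ` boundary_span)"
  unfolding homology_def cycle_module_def boundaries_eq ..

lemma cycle_module_carrier: "carrier (cycle_module q) = mod_chain n q ` mod_cycles n q"
  unfolding cycle_module_def cycles_eq by simp

lemma cycle_module_add:
  "mod_chain n q x \<oplus>\<^bsub>cycle_module q\<^esub> mod_chain n q y = mod_chain n q (x + y)"
  by (auto simp: cycle_module_def chain_module_def mod_chain_def simplices_1 fun_eq_iff mod_simps)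

lemma cycle_module_smult:
  "a \<odot>\<^bsub>cycle_module q\<^esub> mod_chain n q y = mod_chain n q (a *z y)"
  by (auto simp: cycle_module_def chain_module_def mod_chain_def simplices_1 fun_eq_iff mod_simps zscale_apply)

lemma coset_eq:
  "(mod_chain n q ` boundary_span) +>\<^bsub>cycle_module q\<^esub> mod_chain n q y = cls q y"
  unfolding a_r_coset_def' cls_def by (auto simp: cycle_module_add)

lemma H1_carrier: "carrier (H1 q) = cls q ` mod_cycles n q"
  unfolding homology_eq quotient_module_def
  by (simp add: A_RCOSETS_def' cycle_module_carrier coset_eq image_image UNION_singleton_eq_range)

lemma H1_zero: "\<zero>\<^bsub>H1 q\<^esub> = cls q 0"
  by (simp add: homology_eq quotient_module_def cls_def)

lemma H1_add: "cls q y \<oplus>\<^bsub>H1 q\<^esub> cls q z = cls q (y + z)"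
proof -
  have "cls q y \<oplus>\<^bsub>H1 q\<^esub> cls q z = (\<Union>a\<in>boundary_span. \<Union>b\<in>boundary_span. {mod_chain n q ((a + y) + (b + z))})"
    unfolding homology_eq quotient_module_def cls_def
    by (simp add: set_add_def' cycle_module_add)
  also have "\<dots> = cls q (y + z)"
  proof (intro equalityI subsetI)
    fix c assume "c \<in> (\<Union>a\<in>boundary_span. \<Union>b\<in>boundary_span. {mod_chain n q ((a + y) + (b + z))})"
    then obtain a b where ab: "a \<in> boundary_span" "b \<in> boundary_span" "c = mod_chain n q ((a + y) + (b + z))" by blast
    moreover have "(a + y) + (b + z) = (a + b) + (y + z)" by (simp only: add_ac)
    ultimately show "c \<in> cls q (y + z)"
      unfolding cls_def using boundary_span_add[OF ab(1,2)] by (metis image_eqI)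
  next
    fix c assume "c \<in> cls q (y + z)"
    then obtain a where a: "a \<in> boundary_span" "c = mod_chain n q (a + (y + z))" by (auto simp: cls_def)
    have "a + (y + z) = (a + y) + (0 + z)" by (simp only: add_ac add_0)
    then have "c = mod_chain n q ((a + y) + (0 + z))" using a(2) by (simp only:)
    then show "c \<in> (\<Union>a\<in>boundary_span. \<Union>b\<in>boundary_span. {mod_chain n q ((a + y) + (b + z))})"
      using boundary_span_0 a(1) by blast
  qed
  finally show ?thesis .
qed

lemma H1_smult: "a \<odot>\<^bsub>H1 q\<^esub> cls q y = cls q (a *z y)"
proof -
  have "a \<odot>\<^bsub>H1 q\<^esub> cls q y = (\<Union>b\<in>boundary_span. cls q (a *z (b + y)))"
    unfolding homology_eq quotient_module_def cls_def[of q y]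
    by (simp add: cycle_module_smult coset_eq)
  also have "cls q (a *z (b + y)) = cls q (a *z y)" if b: "b \<in> boundary_span" for b
  proof (intro equalityI subsetI)
    fix c assume "c \<in> cls q (a *z (b + y))"
    then obtain d where d: "d \<in> boundary_span" "c = mod_chain n q (d + a *z (b + y))" by (auto simp: cls_def)
    moreover have "d + a *z (b + y) = (d + a *z b) + a *z y" by (simp only: zfun.scale_right_distrib add_ac)
    ultimately show "c \<in> cls q (a *z y)"
      unfolding cls_def using boundary_span_add[OF d(1) boundary_span_scale[OF b]] by (metis image_eqI)
  next
    fix c assume "c \<in> cls q (a *z y)"
    then obtain d where d: "d \<in> boundary_span" "c = mod_chain n q (d + a *z y)" by (auto simp: cls_def)
    moreover have "d + a *z y = (d - a *z b) + a *z (b + y)" by (simp only: zfun.scale_right_distrib) simp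
    ultimately show "c \<in> cls q (a *z (b + y))"
      unfolding cls_def using boundary_span_diff[OF d(1) boundary_span_scale[OF b]] by (metis image_eqI)
  qed
  then have "(\<Union>b\<in>boundary_span. cls q (a *z (b + y))) = cls q (a *z y)" using boundary_span_0 by blast
  finally show ?thesis .
qed

lemma cls_cong:
  assumes "\<And>e. e \<in> edges n \<Longrightarrow> q dvd y e - z e" shows "cls q y = cls q z"
proof -
  have "mod_chain n q (b + y) = mod_chain n q (b + z)" for b
    by (rule mod_chain_cong) (simp add: assms)
  then show ?thesis by (simp add: cls_def)
qed

lemma cls_boundary:
  assumes "y \<in> boundary_span" shows "cls q y = cls q 0"
proof -
  have "(\<lambda>b. b + y) ` boundary_span = boundary_span"
  proof (intro equalityI subsetI)
    fix b assume "b \<in> boundary_span"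
    then have "b - y \<in> boundary_span" using assms by (rule boundary_span_diff)
    moreover have "b = (b - y) + y" by simp
    ultimately show "b \<in> (\<lambda>b. b + y) ` boundary_span" by blast
  qed (use assms boundary_span_add in auto)
  then have "mod_chain n q ` boundary_span = (\<lambda>b. mod_chain n q (b + y)) ` boundary_span"
    by (metis image_image)
  then show ?thesis by (simp add: cls_def)
qed

lemma cycles_add: "y \<in> mod_cycles n q \<Longrightarrow> z \<in> mod_cycles n q \<Longrightarrow> y + z \<in> mod_cycles n q"
  and cycles_scale: "y \<in> mod_cycles n q \<Longrightarrow> c *z y \<in> mod_cycles n q"
  and cycles_0: "0 \<in> mod_cycles n q"
  by (rule zfun.subspace_add[OF subspace_mod_cycles] zfun.subspace_scale[OF subspace_mod_cycles]
      zfun.subspace_0[OF subspace_mod_cycles]; assumption)+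

lemma H1_abelian_group: "abelian_group (H1 q)"
proof (rule abelian_groupI)
  fix x y assume "x \<in> carrier (H1 q)" "y \<in> carrier (H1 q)"
  then obtain a b where ab: "a \<in> mod_cycles n q" "b \<in> mod_cycles n q" "x = cls q a" "y = cls q b"
    unfolding H1_carrier by blast
  show "x \<oplus>\<^bsub>H1 q\<^esub> y \<in> carrier (H1 q)"
    unfolding ab H1_add H1_carrier using ab cycles_add by blast
  show "x \<oplus>\<^bsub>H1 q\<^esub> y = y \<oplus>\<^bsub>H1 q\<^esub> x" unfolding ab H1_add by (simp only: add.commute)
next
  fix x y z assume "x \<in> carrier (H1 q)" "y \<in> carrier (H1 q)" "z \<in> carrier (H1 q)"
  then obtain a b c where abc: "x = cls q a" "y = cls q b" "z = cls q c"
    unfolding H1_carrier by blast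
  show "x \<oplus>\<^bsub>H1 q\<^esub> y \<oplus>\<^bsub>H1 q\<^esub> z = x \<oplus>\<^bsub>H1 q\<^esub> (y \<oplus>\<^bsub>H1 q\<^esub> z)"
    unfolding abc H1_add by (simp only: add.assoc)
next
  show "\<zero>\<^bsub>H1 q\<^esub> \<in> carrier (H1 q)" unfolding H1_zero H1_carrier using cycles_0 by blast
next
  fix x assume "x \<in> carrier (H1 q)"
  then obtain a where a: "a \<in> mod_cycles n q" "x = cls q a" unfolding H1_carrier by blast
  show "\<zero>\<^bsub>H1 q\<^esub> \<oplus>\<^bsub>H1 q\<^esub> x = x" unfolding a H1_zero H1_add by (simp only: add_0)
  have "cls q ((- 1) *z a) \<in> carrier (H1 q)" unfolding H1_carrier using cycles_scale[OF a(1)] by blast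
  moreover have "(- 1) *z a + a = 0" by (simp add: fun_eq_iff zscale_apply)
  then have "cls q ((- 1) *z a) \<oplus>\<^bsub>H1 q\<^esub> x = \<zero>\<^bsub>H1 q\<^esub>" unfolding a H1_add H1_zero by simp
  ultimately show "\<exists>y\<in>carrier (H1 q). y \<oplus>\<^bsub>H1 q\<^esub> x = \<zero>\<^bsub>H1 q\<^esub>" by blast
qed

lemma H1_module: "Module.module (zmod q) (H1 q)"
proof (rule moduleI[OF cring_zmod H1_abelian_group])
  fix a x assume "a \<in> carrier (zmod q)" "x \<in> carrier (H1 q)"
  then obtain y where y: "y \<in> mod_cycles n q" "x = cls q y" unfolding H1_carrier by blast
  show "a \<odot>\<^bsub>H1 q\<^esub> x \<in> carrier (H1 q)" unfolding y H1_smult H1_carrier using cycles_scale[OF y(1)] by blast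
next
  fix a b x assume "x \<in> carrier (H1 q)"
  then obtain y where y: "x = cls q y" unfolding H1_carrier by blast
  show "(a \<oplus>\<^bsub>zmod q\<^esub> b) \<odot>\<^bsub>H1 q\<^esub> x = a \<odot>\<^bsub>H1 q\<^esub> x \<oplus>\<^bsub>H1 q\<^esub> b \<odot>\<^bsub>H1 q\<^esub> x"
    unfolding y H1_smult H1_add
    by (rule cls_cong) (simp add: zscale_apply mod_eq_dvd_iff[symmetric] mod_simps left_diff_distrib algebra_simps)
  show "(a \<otimes>\<^bsub>zmod q\<^esub> b) \<odot>\<^bsub>H1 q\<^esub> x = a \<odot>\<^bsub>H1 q\<^esub> (b \<odot>\<^bsub>H1 q\<^esub> x)"
    unfolding y H1_smult
    by (rule cls_cong) (simp add: zscale_apply mod_eq_dvd_iff[symmetric] mod_simps algebra_simps)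
next
  fix a x y assume "x \<in> carrier (H1 q)" "y \<in> carrier (H1 q)"
  then obtain b c where bc: "x = cls q b" "y = cls q c" unfolding H1_carrier by blast
  show "a \<odot>\<^bsub>H1 q\<^esub> (x \<oplus>\<^bsub>H1 q\<^esub> y) = a \<odot>\<^bsub>H1 q\<^esub> x \<oplus>\<^bsub>H1 q\<^esub> a \<odot>\<^bsub>H1 q\<^esub> y"
    unfolding bc H1_smult H1_add by (simp only: zfun.scale_right_distrib)
next
  fix x assume "x \<in> carrier (H1 q)"
  then obtain y where y: "x = cls q y" unfolding H1_carrier by blast
  show "\<one>\<^bsub>zmod q\<^esub> \<odot>\<^bsub>H1 q\<^esub> x = x"
    unfolding y H1_smult
    by (rule cls_cong) (simp add: zscale_apply mod_eq_dvd_iff[symmetric] mod_simps)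
qed

text \<open>The star at vertex 1 is a spanning tree of the complete graph, so the edges outside it
  are coordinates for the cycles.\<close>

definition free_edges :: "nat set set" where
  "free_edges = {e \<in> edges n. 1 \<notin> e}"

text \<open>Every chain on the edges avoiding the vertex 1 extends uniquely to a cycle, by choosing the
  value on each edge \<open>{1, b}\<close> so that the boundary vanishes at \<open>b\<close>.\<close>

definition close_up :: "(nat set \<Rightarrow> int) \<Rightarrow> nat set \<Rightarrow> int" where
  "close_up v = (\<lambda>e. if 1 \<in> e then - (\<Sum>x\<in>{2..n} - {Max e}. edge_sign (Max e) x * v {Max e, x}) else v e)"

lemma close_up_add: "close_up (u + v) = close_up u + close_up v"
  by (auto simp: close_up_def fun_eq_iff sum.distrib distrib_left)

lemma close_up_scale: "close_up (c *z v) = c *z close_up v"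
  by (auto simp: close_up_def fun_eq_iff zscale_apply sum_distrib_left mult_ac)

lemma int_boundary_split:
  assumes "b \<in> {2..n}"
  shows "int_boundary n y b = y {1, b} + (\<Sum>x\<in>{2..n} - {b}. edge_sign b x * y {b, x})"
proof -
  have "{1..n} - {b} = insert 1 ({2..n} - {b})" using assms by auto
  moreover have "edge_sign b 1 = 1" using assms by (simp add: edge_sign_def)
  ultimately show ?thesis by (simp add: int_boundary_def insert_commute)
qed

lemma close_up_edge:
  assumes "b \<in> {2..n}"
  shows "close_up v {1, b} = - (\<Sum>x\<in>{2..n} - {b}. edge_sign b x * v {b, x})"
proof -
  have "Max {1, b} = b" using assms by auto
  then show ?thesis by (simp add: close_up_def)
qed

lemma close_up_free: "1 \<notin> e \<Longrightarrow> close_up v e = v e"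
  by (simp add: close_up_def)

lemma edge_cases:
  assumes "e \<in> edges n" obtains "e \<in> free_edges" | b where "b \<in> {2..n}" "e = {1, b}"
proof (cases "1 \<in> e")
  case True
  obtain u v where uv: "e = {u, v}" "u < v" "u \<in> {1..n}" "v \<in> {1..n}" using assms by (elim edgesE)
  with True have "u = 1" by auto
  then show ?thesis using uv by (intro that(2)[of v]) auto
qed (use assms that(1) in \<open>auto simp: free_edges_def\<close>)

lemma close_up_cycle: "close_up v \<in> mod_cycles n q"
proof -
  have "int_boundary n (close_up v) u = 0" if u: "u \<in> {1..n}" for u
  proof (cases "u = 1")
    case False
    then have u2: "u \<in> {2..n}" using u by auto
    have "(\<Sum>x\<in>{2..n} - {u}. edge_sign u x * close_up v {u, x}) = (\<Sum>x\<in>{2..n} - {u}. edge_sign u x * v {u, x})"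
      using u2 by (intro sum.cong) (auto simp: close_up_free)
    then show ?thesis unfolding int_boundary_split[OF u2] close_up_edge[OF u2] by simp
  next
    case True
    have "{1..n} - {1} = {2..n}" by auto
    then have "int_boundary n (close_up v) u = (\<Sum>b\<in>{2..n}. - close_up v {1, b})"
      unfolding True int_boundary_def by (intro sum.cong) (auto simp: edge_sign_def)
    also have "\<dots> = (\<Sum>b\<in>{2..n}. \<Sum>x\<in>{2..n} - {b}. edge_sign b x * v {b, x})"
      by (intro sum.cong refl) (simp add: close_up_edge)
    also have "\<dots> = (\<Sum>b\<in>{2..n}. \<Sum>x\<in>{2..n}. if x = b then 0 else edge_sign b x * v {b, x})" (is "_ = ?S")
      by (intro sum.cong refl sum.mono_neutral_cong_left) auto
    finally have S: "int_boundary n (close_up v) u = ?S" .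
    \<comment> \<open>Exchanging the two vertices reverses the sign of every edge, so the double sum
      equals its own negative.\<close>
    have "?S = (\<Sum>x\<in>{2..n}. \<Sum>b\<in>{2..n}. if x = b then 0 else edge_sign b x * v {b, x})" by (rule sum.swap)
    also have "\<dots> = (\<Sum>x\<in>{2..n}. \<Sum>b\<in>{2..n}. - (if b = x then 0 else edge_sign x b * v {x, b}))"
      by (intro sum.cong refl) (auto simp: edge_sign_def insert_commute)
    also have "\<dots> = - ?S" by (simp add: sum_negf)
    finally show ?thesis unfolding S by simp
  qed
  then show ?thesis by (simp add: mod_cycles_def)
qed

text \<open>Uniqueness of the extension modulo \<open>q\<close>: the boundary of \<open>y\<close> at
  \<open>b\<close> is divisible by \<open>q\<close>, which determines the value on
  \<open>{1, b}\<close> modulo \<open>q\<close>.\<close>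

lemma cls_close_up:
  assumes y: "y \<in> mod_cycles n q" and v: "\<And>e. e \<in> free_edges \<Longrightarrow> v e = y e"
  shows "cls q (close_up v) = cls q y"
proof (rule cls_cong)
  fix e assume "e \<in> edges n"
  then show "q dvd close_up v e - y e"
  proof (cases rule: edge_cases)
    case 1
    then show ?thesis using v[OF 1] by (simp add: free_edges_def close_up_free)
  next
    case (2 b)
    have "(\<Sum>x\<in>{2..n} - {b}. edge_sign b x * v {b, x}) = (\<Sum>x\<in>{2..n} - {b}. edge_sign b x * y {b, x})"
      using 2(1) by (intro sum.cong refl) (auto simp: free_edges_def pair_in_edges intro!: v)
    then have "close_up v e - y e = - int_boundary n y b"
      unfolding 2(2) close_up_edge[OF 2(1)] int_boundary_split[OF 2(1)] by simp
    then show ?thesis using y 2(1) by (simp add: mod_cycles_def)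
  qed
qed

definition free_part :: "(nat set \<Rightarrow> int) \<Rightarrow> nat set \<Rightarrow> int" where
  "free_part y = (\<lambda>e. if e \<in> free_edges then y e else 0)"

lemma free_part_supported: "free_part y \<in> supported free_edges"
  by (simp add: free_part_def supported_def)

lemma cls_close_up_free_part:
  "y \<in> mod_cycles n q \<Longrightarrow> cls q (close_up (free_part y)) = cls q y"
  by (rule cls_close_up) (simp_all add: free_part_def)

text \<open>The faces as relations between the coordinates on \<open>free_edges\<close>. Dropping
  the edges at vertex 1 is harmless, since closing up the restriction gives back the class of the
  face boundary, which is zero.\<close>

definition relations :: "(nat set \<Rightarrow> int) set" where
  "relations = free_part ` triangle_vec ` faces"

text \<open>\<open>Q\<close> stands for a subgroup, so that one argument serves both the generated
  subgroup over the integers and the linear span over a prime field. The correction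
  \<open>q *z u\<close> disappears in \<open>H1 q\<close>.\<close>

lemma H1_generated:
  assumes gen: "\<And>v. v \<in> supported free_edges \<Longrightarrow>
      \<exists>u\<in>supported free_edges. v - q *z u \<in> zfun.span (relations \<union> unit_vec ` S)"
    and Q0: "\<zero>\<^bsub>H1 q\<^esub> \<in> Q" and Qadd: "\<And>x y. x \<in> Q \<Longrightarrow> y \<in> Q \<Longrightarrow> x \<oplus>\<^bsub>H1 q\<^esub> y \<in> Q"
    and Qneg: "\<And>x. x \<in> Q \<Longrightarrow> \<ominus>\<^bsub>H1 q\<^esub> x \<in> Q"
    and Qgen: "\<And>e. e \<in> S \<Longrightarrow> cls q (close_up (unit_vec e)) \<in> Q"
  shows "carrier (H1 q) \<subseteq> Q"
proof -
  interpret H: abelian_group "H1 q" by (rule H1_abelian_group)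
  \<comment> \<open>The coordinate vectors whose closed-up class lies in \<open>Q\<close>. They form
    a subgroup, so it suffices to place the relations and the chosen unit vectors in it.\<close>
  define W where "W = {v. cls q (close_up v) \<in> Q}"
  have in_H: "cls q (close_up v) \<in> carrier (H1 q)" for v
    unfolding H1_carrier using close_up_cycle by blast
  have c0: "close_up 0 = 0" using close_up_scale[of 0 0] by simp
  have W0: "0 \<in> W" using Q0 by (simp add: W_def c0 H1_zero)
  have Wadd: "u + v \<in> W" if "u \<in> W" "v \<in> W" for u v
    using Qadd that by (simp add: W_def close_up_add flip: H1_add)
  have Wneg: "- u \<in> W" if "u \<in> W" for u
  proof -
    have "cls q (close_up (- u)) \<oplus>\<^bsub>H1 q\<^esub> cls q (close_up u) = \<zero>\<^bsub>H1 q\<^esub>"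
      unfolding H1_add H1_zero close_up_add[symmetric] by (simp add: c0)
    then have "\<ominus>\<^bsub>H1 q\<^esub> cls q (close_up u) = cls q (close_up (- u))"
      by (intro H.minus_equality in_H)
    then show ?thesis using Qneg[of "cls q (close_up u)"] that by (simp add: W_def)
  qed
  \<comment> \<open>\<open>Q\<close> is closed under addition and negation only, so integer
    multiples are built by repeated addition.\<close>
  have Wnat: "int k *z u \<in> W" if "u \<in> W" for k u
  proof (induction k)
    case 0 show ?case using W0 by (simp only: of_nat_0 zfun.scale_zero_left)
  next
    case (Suc k)
    then show ?case using that by (simp only: of_nat_Suc zfun.scale_left_distrib zfun.scale_one Wadd)
  qed
  have "zfun.subspace W"
  proof (rule zfun.subspaceI[OF W0 Wadd])
    fix c :: int and u assume u: "u \<in> W"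
    show "c *z u \<in> W"
    proof (cases c rule: int_cases2)
      case (nonneg k) then show ?thesis using Wnat[OF u] by simp
    next
      case (nonpos k) then show ?thesis using Wneg[OF Wnat[OF u]] by (simp only: zfun.scale_minus_left)
    qed
  qed
  moreover have "relations \<union> unit_vec ` S \<subseteq> W"
  proof (intro Un_least image_subsetI)
    show "unit_vec e \<in> W" if "e \<in> S" for e using Qgen[OF that] by (simp add: W_def)
    have "free_part (triangle_vec F) \<in> W" if F: "F \<in> faces" for F
    proof -
      have t: "triangle_vec F \<in> boundary_span"
        unfolding boundary_span_def using F by (intro zfun.span_base) blast
      then have "cls q (close_up (free_part (triangle_vec F))) = cls q (triangle_vec F)"
        using boundary_span_cycles by (intro cls_close_up_free_part) blast
      also have "\<dots> = \<zero>\<^bsub>H1 q\<^esub>" unfolding H1_zero by (rule cls_boundary[OF t])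
      finally show ?thesis using Q0 by (simp add: W_def)
    qed
    then show "relations \<subseteq> W" by (auto simp: relations_def)
  qed
  ultimately have sub: "zfun.span (relations \<union> unit_vec ` S) \<subseteq> W" by (rule zfun.span_minimal[rotated])
  show ?thesis
  proof
    fix x assume "x \<in> carrier (H1 q)"
    then obtain y where y: "y \<in> mod_cycles n q" "x = cls q y" unfolding H1_carrier by blast
    obtain u where u: "free_part y - q *z u \<in> W"
      using gen[OF free_part_supported[of y]] sub by blast
    have "close_up (free_part y) = close_up ((free_part y - q *z u) + q *z u)" by simp
    also have "\<dots> = close_up (free_part y - q *z u) + q *z close_up u"
      by (simp only: close_up_add close_up_scale)
    finally have "cls q (close_up (free_part y)) = cls q (close_up (free_part y - q *z u))"
      by (intro cls_cong) (simp add: zscale_apply)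
    then show "x \<in> Q" using u cls_close_up_free_part[OF y(1)] y(2) by (simp add: W_def)
  qed
qed

section \<open>Bounds on homology from a generating set of edges\<close>

lemma finite_free_edges: "finite free_edges"
  by (simp add: free_edges_def)

lemma min_generators_H1_le:
  assumes gen: "\<And>v. v \<in> supported free_edges \<Longrightarrow>
      \<exists>u\<in>supported free_edges. v - q *z u \<in> zfun.span (relations \<union> unit_vec ` S)"
    and S: "finite S"
  shows "min_generators (add_monoid (H1 q)) \<le> card S"
proof -
  interpret H: abelian_group "H1 q" by (rule H1_abelian_group)
  define A where "A = (\<lambda>e. cls q (close_up (unit_vec e))) ` S"
  have A: "finite A" "card A \<le> card S" "A \<subseteq> carrier (H1 q)"
    unfolding A_def H1_carrier using S card_image_le close_up_cycle by auto
  have "carrier (H1 q) \<subseteq> generate (add_monoid (H1 q)) A"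
  proof (rule H1_generated[OF gen])
    show "\<zero>\<^bsub>H1 q\<^esub> \<in> generate (add_monoid (H1 q)) A" using generate.one[of "add_monoid (H1 q)" A] by simp
    show "x \<oplus>\<^bsub>H1 q\<^esub> y \<in> generate (add_monoid (H1 q)) A"
      if "x \<in> generate (add_monoid (H1 q)) A" "y \<in> generate (add_monoid (H1 q)) A" for x y
      using generate.eng[OF that] by simp
    show "\<ominus>\<^bsub>H1 q\<^esub> x \<in> generate (add_monoid (H1 q)) A" if "x \<in> generate (add_monoid (H1 q)) A" for x
      using group.generate_m_inv_closed[OF H.a_group _ that] A(3) by (simp add: a_inv_def)
    show "cls q (close_up (unit_vec e)) \<in> generate (add_monoid (H1 q)) A" if "e \<in> S" for e
      using that by (intro generate.incl) (simp add: A_def)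
  qed
  moreover have "generate (add_monoid (H1 q)) A \<subseteq> carrier (H1 q)"
    using group.generate_incl[OF H.a_group, of A] A(3) by simp
  ultimately have "generate (add_monoid (H1 q)) A = carrier (add_monoid (H1 q))" by auto
  then have "min_generators (add_monoid (H1 q)) \<le> card A"
    unfolding min_generators_def using A by (intro Least_le exI[of _ A]) auto
  then show ?thesis using A(2) by linarith
qed

lemma dim_H1_le:
  assumes p: "prime p"
    and gen: "\<And>v. v \<in> supported free_edges \<Longrightarrow>
      \<exists>u\<in>supported free_edges. v - int p *z u \<in> zfun.span (relations \<union> unit_vec ` S)"
    and S: "finite S"
  shows "vectorspace.dim (residue_ring (int p)) (homology (residue_ring (int p)) K 1) \<le> card S"
proof -
  have p1: "int p > 1" using prime_gt_1_nat[OF p] by simp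
  note zr = zmod_eq_residue_ring[OF p1, symmetric]
  have "residues_prime p" using p by (simp add: residues_prime_def)
  then have fld: "field (zmod (int p))"
    using residues_prime.is_field[of p] by (simp add: zr)
  interpret H: Module.module "zmod (int p)" "H1 (int p)" by (rule H1_module)
  interpret V: vectorspace "zmod (int p)" "H1 (int p)"
    using fld H1_module by (simp add: vectorspace_def)
  define A where "A = (\<lambda>e. cls (int p) (close_up (unit_vec e))) ` S"
  have A: "finite A" "card A \<le> card S" "A \<subseteq> carrier (H1 (int p))"
    unfolding A_def H1_carrier using S card_image_le close_up_cycle by auto
  have sub: "submodule (zmod (int p)) (H.span A) (H1 (int p))" by (rule H.span_is_submodule[OF A(3)])
  have spanA: "H.span A \<subseteq> carrier (H1 (int p))" using sub by (simp add: submodule_def)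
  have "carrier (H1 (int p)) \<subseteq> H.span A"
  proof (rule H1_generated[OF gen])
    show "\<zero>\<^bsub>H1 (int p)\<^esub> \<in> H.span A" using sub by (simp add: submodule_def)
    show add: "x \<oplus>\<^bsub>H1 (int p)\<^esub> y \<in> H.span A" if "x \<in> H.span A" "y \<in> H.span A" for x y
      using sub that by (simp add: submodule_def)
    show "\<ominus>\<^bsub>H1 (int p)\<^esub> x \<in> H.span A" if x: "x \<in> H.span A" for x
    proof -
      have "\<ominus>\<^bsub>H1 (int p)\<^esub> x = (\<ominus>\<^bsub>zmod (int p)\<^esub> \<one>\<^bsub>zmod (int p)\<^esub>) \<odot>\<^bsub>H1 (int p)\<^esub> x"
        using subsetD[OF spanA x] by (simp only: H.smult_l_minus[OF H.R.one_closed] H.smult_one)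
      then show ?thesis using sub x by (simp add: submodule_def del: zmod_simps)
    qed
    show "cls (int p) (close_up (unit_vec e)) \<in> H.span A" if "e \<in> S" for e
      using that H.in_own_span[OF A(3)] by (auto simp: A_def)
  qed
  then have "H.span A = carrier (H1 (int p))" using spanA by blast
  then have "V.dim \<le> card A" using A by (intro V.gen_ge_dim) auto
  then show ?thesis using A(2) by (simp add: zr)
qed

section \<open>Short relations and normalised cocycles\<close>

lemma relations_supported: "relations \<subseteq> supported free_edges"
  using free_part_supported by (auto simp: relations_def)

text \<open>A triangle has three edges, each with coefficient 1 or -1, and those at vertex 1 drop
  out.\<close>

lemma relations_norm:
  assumes "t \<in> relations" shows "(\<Sum>e\<in>free_edges. \<bar>t e\<bar>) \<le> 3"
proof -
  obtain F where F: "F \<in> faces" "t = free_part (triangle_vec F)" using assms by (auto simp: relations_def)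
  obtain a b c where abc: "F = {a, b, c}" "a < b" "b < c" using F(1) by (elim facesE)
  have one: "(\<Sum>e\<in>free_edges. of_bool (e = X)) \<le> (1 :: int)" for X
  proof -
    have "(\<Sum>e\<in>free_edges. of_bool (e = X)) = (\<Sum>e\<in>free_edges. if e = X then 1 else (0 :: int))"
      by (intro sum.cong) auto
    then show ?thesis using finite_free_edges by simp
  qed
  have le: "(\<Sum>e\<in>free_edges. \<bar>t e\<bar>)
      \<le> (\<Sum>e\<in>free_edges. of_bool (e = {b, c}) + of_bool (e = {a, c}) + of_bool (e = {a, b}))"
    unfolding F(2) abc(1) triangle_vec_eq[OF abc(2,3)]
    by (intro sum_mono) (simp add: free_part_def)
  then show ?thesis
    using one[of "{b, c}"] one[of "{a, c}"] one[of "{a, b}"] unfolding sum.distrib by linarith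
qed

text \<open>Values on the free edges extended by zero along the star at vertex 1 and then
  antisymmetrically: a 1-cochain normalised at the base point.\<close>

definition skew_int :: "(nat set \<Rightarrow> int) \<Rightarrow> nat \<Rightarrow> nat \<Rightarrow> int" where
  "skew_int f u v = (if u < v then free_part f {u, v} else - free_part f {u, v})"

lemma skew_int_swap: "u \<noteq> v \<Longrightarrow> skew_int f v u = - skew_int f u v"
  by (auto simp: skew_int_def insert_commute)

text \<open>Pairing \<open>f\<close> with the boundary of a face is the same as evaluating the
  coboundary of \<open>f\<close> on that face.\<close>

lemma annihilator_triangle:
  assumes f: "f \<in> annihilators p free_edges relations"
    and F: "{u, v, w} \<in> K" "card {u, v, w} = 3"
  shows "p dvd skew_int f u v + skew_int f v w + skew_int f w u"
proof -
  have face: "{u, v, w} \<in> faces" using F by (simp add: faces_def simplices_def)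
  then obtain a b c where abc: "{u, v, w} = {a, b, c}" "a < b" "b < c" by (elim facesE)
  have delta: "(\<Sum>e\<in>free_edges. f e * of_bool (e = X)) = free_part f X" for X
  proof -
    have "(\<Sum>e\<in>free_edges. f e * of_bool (e = X)) = (\<Sum>e\<in>free_edges. if e = X then f e else 0)"
      by (intro sum.cong) auto
    then show ?thesis using finite_free_edges by (simp add: free_part_def)
  qed
  have "p dvd (\<Sum>e\<in>free_edges. f e * free_part (triangle_vec {u, v, w}) e)"
    using f face by (auto simp: annihilators_def relations_def)
  also have "(\<Sum>e\<in>free_edges. f e * free_part (triangle_vec {u, v, w}) e)
     = (\<Sum>e\<in>free_edges. f e * of_bool (e = {b, c}) - f e * of_bool (e = {a, c}) + f e * of_bool (e = {a, b}))"
    unfolding abc(1) triangle_vec_eq[OF abc(2,3)]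
    by (intro sum.cong) (simp_all add: free_part_def algebra_simps)
  also have "\<dots> = free_part f {b, c} - free_part f {a, c} + free_part f {a, b}"
    by (simp only: sum.distrib sum_subtractf delta)
  also have "\<dots> = skew_int f a b + skew_int f b c + skew_int f c a"
    using abc(2,3) by (simp add: skew_int_def insert_commute)
  finally have D: "p dvd skew_int f a b + skew_int f b c + skew_int f c a" .
  then have D': "p dvd - (skew_int f a b + skew_int f b c + skew_int f c a)" by (simp only: dvd_minus_iff)
  have sw: "skew_int f b a = - skew_int f a b" "skew_int f c b = - skew_int f b c" "skew_int f a c = - skew_int f c a"
    using abc(2,3) by (intro skew_int_swap; simp)+
  have ne: "u \<noteq> v" "v \<noteq> w" "w \<noteq> u"
    using F(2) by (auto simp: card_insert_if split: if_splits)
  have "u \<in> {a, b, c}" "v \<in> {a, b, c}" "w \<in> {a, b, c}" using abc(1) by auto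
  \<comment> \<open>The face vector is written for sorted vertices. Cyclic orderings leave the sum
    unchanged, and the three others negate it.\<close>
  then consider "u = a \<and> v = b \<and> w = c" | "u = a \<and> v = c \<and> w = b" | "u = b \<and> v = a \<and> w = c"
    | "u = b \<and> v = c \<and> w = a" | "u = c \<and> v = a \<and> w = b" | "u = c \<and> v = b \<and> w = a"
    using ne by (simp only: insert_iff empty_iff) metis
  then show ?thesis
    using D D' by cases (simp_all add: sw algebra_simps)
qed

text \<open>Annihilators extend by zero along the star at vertex 1 to cocycles, and the extension is
  injective. Here homology meets the counts whose expectation is controlled.\<close>

lemma card_annihilators_le_cocycles1:
  assumes p: "p > 0"
  shows "card (annihilators p free_edges relations) \<le> card (cocycles1 n K (add_monoid (zmod p)))"
proof -
  interpret R: abelian_group "zmod p" by (rule abelian_group_zmod)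
  let ?P = "{(u, v). u \<in> {1..n} \<and> v \<in> {1..n} \<and> u \<noteq> v}"
  define c where "c = (\<lambda>f. \<lambda>(u, v)\<in>?P. skew_int f u v mod p)"
  have cv: "c f (u, v) = skew_int f u v mod p" if "u \<in> {1..n}" "v \<in> {1..n}" "u \<noteq> v" for f u v
    using that by (simp add: c_def)
  have fin: "finite (carrier (zmod p))" by (simp add: zmod_carrier range_mod[OF p])
  have mem: "c f \<in> cocycles1 n K (add_monoid (zmod p))" if f: "f \<in> annihilators p free_edges relations" for f
    unfolding cocycles1_def
  proof (intro CollectI conjI ballI allI impI)
    show "c f \<in> ?P \<rightarrow>\<^sub>E carrier (add_monoid (zmod p))" by (auto simp: c_def)
    show "c f (u, v) = inv\<^bsub>add_monoid (zmod p)\<^esub> c f (v, u)" if "u \<in> {1..n}" "v \<in> {1..n}" "u \<noteq> v" for u v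
      unfolding a_inv_def[symmetric] using that
      by (simp add: cv zmod_a_inv skew_int_swap[of u v] mod_simps)
    fix u v w assume F: "{u, v, w} \<in> K \<and> card {u, v, w} = 3"
    have ne: "u \<noteq> v" "v \<noteq> w" "w \<noteq> u" using F by (auto simp: card_insert_if split: if_splits)
    have r: "u \<in> {1..n}" "v \<in> {1..n}" "w \<in> {1..n}" using F K_sub by auto
    have "(skew_int f u v + skew_int f v w + skew_int f w u) mod p = 0"
      using annihilator_triangle[OF f] F by simp
    then show "c f (u, v) \<otimes>\<^bsub>add_monoid (zmod p)\<^esub> c f (v, w) \<otimes>\<^bsub>add_monoid (zmod p)\<^esub> c f (w, u) = \<one>\<^bsub>add_monoid (zmod p)\<^esub>"
      using ne r by (simp add: cv mod_simps)
  qed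
  have inj: "inj_on c (annihilators p free_edges relations)"
  proof (rule inj_onI)
    fix f g assume f: "f \<in> annihilators p free_edges relations" and g: "g \<in> annihilators p free_edges relations"
      and eq: "c f = c g"
    have fE: "f \<in> free_edges \<rightarrow>\<^sub>E {0..<p}" "g \<in> free_edges \<rightarrow>\<^sub>E {0..<p}"
      using f g by (simp_all add: annihilators_def)
    have "f e = g e" if e: "e \<in> free_edges" for e
    proof -
      have "e \<in> edges n" using e by (simp add: free_edges_def)
      then obtain u v where uv: "e = {u, v}" "u < v" "u \<in> {1..n}" "v \<in> {1..n}" by (elim edgesE)
      have val: "c h (u, v) = h e" if "h \<in> free_edges \<rightarrow>\<^sub>E {0..<p}" for h
      proof -
        have "h e \<in> {0..<p}" using that e by (rule PiE_mem)
        moreover have "c h (u, v) = skew_int h u v mod p" using uv by (intro cv) auto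
        ultimately show ?thesis using uv e by (simp add: skew_int_def free_part_def)
      qed
      show ?thesis using val[OF fE(1)] val[OF fE(2)] eq by simp
    qed
    then show "f = g" using fE by (intro PiE_ext) auto
  qed
  show ?thesis
    using mem group.finite_cocycles1[OF R.a_group] fin by (intro card_inj_on_le[OF inj]) auto
qed

lemma card_free_edges_le: "card free_edges \<le> n\<^sup>2"
proof -
  have "card free_edges \<le> card (edges n)" by (rule card_mono) (auto simp: free_edges_def)
  then show ?thesis using card_edges_le[of n] by linarith
qed

lemma dim_H1_cocycles:
  assumes p: "prime p"
  shows "p ^ vectorspace.dim (residue_ring (int p)) (homology (residue_ring (int p)) K 1)
     \<le> card (cocycles1 n K (add_monoid (zmod (int p))))"
proof -
  obtain S where S: "S \<subseteq> free_edges"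
      "\<forall>v\<in>supported free_edges. \<exists>u\<in>supported free_edges. v - int p *z u \<in> zfun.span (relations \<union> unit_vec ` S)"
      "p ^ card S \<le> card (annihilators (int p) free_edges relations)"
    using exists_mod_prime_generators[OF p finite_free_edges relations_supported] by blast
  have "vectorspace.dim (residue_ring (int p)) (homology (residue_ring (int p)) K 1) \<le> card S"
    using S(2) finite_subset[OF S(1) finite_free_edges] by (intro dim_H1_le[OF p]) blast+
  then have "p ^ vectorspace.dim (residue_ring (int p)) (homology (residue_ring (int p)) K 1) \<le> p ^ card S"
    using prime_gt_0_nat[OF p] by (intro power_increasing) auto
  also note S(3)
  also have "card (annihilators (int p) free_edges relations) \<le> card (cocycles1 n K (add_monoid (zmod (int p))))"
    using prime_gt_0_nat[OF p] by (intro card_annihilators_le_cocycles1) simp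
  finally show ?thesis .
qed

text \<open>The constant 6 is twice the norm bound 3 of the relations, with
  \<open>card free_edges\<close> estimated by \<open>n^2\<close>.\<close>

lemma min_generators_H1_cocycles:
  assumes P: "P > 2"
  shows "real (min_generators (add_monoid (homology \<Z> K 1)))
    \<le> (\<Sum>p | prime p \<and> p < P. log (real p) (real (card (cocycles1 n K (add_monoid (zmod (int p)))))))
       + 6 * real n ^ 2 / ln (real P)"
proof -
  have b: "(1 :: int) \<le> 3" by simp
  obtain S where S: "S \<subseteq> free_edges" "supported free_edges \<subseteq> zfun.span (relations \<union> unit_vec ` S)"
     "real (card S) \<le> (\<Sum>p | prime p \<and> p < P. log (real p) (real (card (annihilators (int p) free_edges relations))))
          + 2 * real_of_int 3 * real (card free_edges) / ln (real P)"
    using exists_integral_generators[OF finite_free_edges relations_supported relations_norm b P] by blast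
  have "min_generators (add_monoid (homology (zmod 0) K 1)) \<le> card S"
  proof (rule min_generators_H1_le)
    fix v assume v: "v \<in> supported free_edges"
    \<comment> \<open>With \<open>q = 0\<close> the correction term vanishes, so true membership in
      the span is required, and \<open>S\<close> provides it.\<close>
    have "v - 0 *z 0 = v" by (simp add: fun_eq_iff zscale_apply)
    then show "\<exists>u\<in>supported free_edges. v - 0 *z u \<in> zfun.span (relations \<union> unit_vec ` S)"
      using v S(2) zfun.subspace_0[OF subspace_supported] by (intro bexI[of _ 0]) auto
  qed (rule finite_subset[OF S(1) finite_free_edges])
  then have "real (min_generators (add_monoid (homology \<Z> K 1))) \<le> real (card S)"
    unfolding zmod_0 by (simp only: of_nat_le_iff)
  also note S(3)
  also have "(\<Sum>p | prime p \<and> p < P. log (real p) (real (card (annihilators (int p) free_edges relations))))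
      \<le> (\<Sum>p | prime p \<and> p < P. log (real p) (real (card (cocycles1 n K (add_monoid (zmod (int p)))))))"
  proof (rule sum_mono)
    fix p assume "p \<in> {p. prime p \<and> p < P}"
    then have p: "prime p" by simp
    \<comment> \<open>Obtained for the positivity of the number of annihilators, on which the
      comparison of logarithms depends.\<close>
    obtain S' where "S' \<subseteq> free_edges"
      "\<forall>v\<in>supported free_edges. \<exists>u\<in>supported free_edges. v - int p *z u \<in> zfun.span (relations \<union> unit_vec ` S')"
      "p ^ card S' \<le> card (annihilators (int p) free_edges relations)"
      using exists_mod_prime_generators[OF p finite_free_edges relations_supported] by blast
    moreover have "p ^ card S' > 0" using prime_gt_0_nat[OF p] by simp
    ultimately have "card (annihilators (int p) free_edges relations) > 0" by linarith
    moreover have "card (annihilators (int p) free_edges relations) \<le> card (cocycles1 n K (add_monoid (zmod (int p))))"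
      using prime_gt_0_nat[OF p] by (intro card_annihilators_le_cocycles1) simp
    ultimately show "log (real p) (real (card (annihilators (int p) free_edges relations)))
       \<le> log (real p) (real (card (cocycles1 n K (add_monoid (zmod (int p))))))"
      using prime_gt_1_nat[OF p] by (subst log_le_cancel_iff) auto
  qed
  also have "2 * real_of_int 3 * real (card free_edges) / ln (real P) \<le> 6 * real n ^ 2 / ln (real P)"
  proof -
    have "real (card free_edges) \<le> real n ^ 2"
      using card_free_edges_le by (simp flip: of_nat_power)
    then show ?thesis using P by (intro divide_right_mono) auto
  qed
  finally show ?thesis by simp
qed

end

declare One_nat_def [simp]

section \<open>Convergence in probability\<close>

lemma two_complex_one_out:
  assumes "\<And>e. e \<in> edges n \<Longrightarrow> w e \<in> {1..n} - e"
  shows "two_complex n (one_out_complex n w)"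
proof
  show "one_out_complex n w \<subseteq> Pow {1..n}"
    using assms by (fastforce simp: one_out_complex_def edges_def)
  show "{v} \<in> one_out_complex n w" if "v \<in> {1..n}" for v
    using that by (auto simp: one_out_complex_def)
  show "edges n \<subseteq> one_out_complex n w" by (auto simp: one_out_complex_def)
qed

lemma two_complex_S2:
  assumes "n \<ge> 3" "K \<in> set_pmf (S2 n)" shows "two_complex n K"
proof -
  obtain w where w: "w \<in> set_pmf (choice_pmf n)" "K = one_out_complex n w"
    using assms(2) by (auto simp: S2_eq)
  show ?thesis unfolding w(2) using set_choice_pmf[OF assms(1) w(1)] by (rule two_complex_one_out)
qed

text \<open>Markov's inequality at the threshold \<open>exp (\<epsilon> * n^2)\<close>, against the
  expectation bound with rate \<open>\<epsilon> / 2\<close>; the gap between the quadratic terms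
  absorbs \<open>C * n\<close>.\<close>

lemma (in group) prob_many_cocycles:
  assumes fin: "finite (carrier G)" and eps: "\<epsilon> > 0"
  shows "(\<lambda>n. measure_pmf.prob (S2 n) {K. real (card (cocycles1 n K G)) \<ge> exp (\<epsilon> * real n ^ 2)}) \<longlonglongrightarrow> 0"
proof -
  obtain C where C: "\<And>n. n \<ge> 3 \<Longrightarrow> measure_pmf.expectation (S2 n) (\<lambda>K. real (card (cocycles1 n K G)))
            \<le> exp (\<epsilon> / 2 * real n ^ 2 + C * real n)"
    using expectation_cocycles_exp_bound[OF fin, of "\<epsilon> / 2"] eps by auto
  \<comment> \<open>From \<open>n0\<close> on, \<open>\<epsilon> / 2 * n^2\<close> is at least
    \<open>(C + 1) * n\<close>, which leaves \<open>exp (- n)\<close> as the bound.\<close>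
  obtain n0 :: nat where n0: "real n0 \<ge> 2 * (C + 1) / \<epsilon>" using real_arch_simple by blast
  have bound: "measure_pmf.prob (S2 n) {K. real (card (cocycles1 n K G)) \<ge> exp (\<epsilon> * real n ^ 2)} \<le> exp (- 1) ^ n"
    if n: "n \<ge> max 3 n0" for n
  proof -
    have n3: "n \<ge> 3" and nC: "real n \<ge> 2 * (C + 1) / \<epsilon>" using n n0 by auto
    have fs: "finite (set_pmf (S2 n))" using finite_set_choice_pmf[OF n3] by (simp add: S2_eq)
    let ?E = "measure_pmf.expectation (S2 n) (\<lambda>K. real (card (cocycles1 n K G)))"
    have "measure_pmf.prob (S2 n) {K \<in> space (measure_pmf (S2 n)). real (card (cocycles1 n K G)) \<ge> exp (\<epsilon> * real n ^ 2)}
        \<le> ?E / exp (\<epsilon> * real n ^ 2)"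
      by (rule integral_Markov_inequality_measure[where A = "{}"]) (auto intro: integrable_measure_pmf_finite fs)
    also have "\<dots> \<le> exp (\<epsilon> / 2 * real n ^ 2 + C * real n) / exp (\<epsilon> * real n ^ 2)"
      by (intro divide_right_mono C n3) simp
    also have "\<dots> = exp (C * real n - \<epsilon> / 2 * real n ^ 2)"
      by (simp add: exp_diff[symmetric] algebra_simps)
    also have "\<dots> \<le> exp (real n * (- 1))"
    proof -
      have "C + 1 \<le> \<epsilon> / 2 * real n" using nC eps by (simp add: field_simps)
      then have "(C + 1) * real n \<le> (\<epsilon> / 2 * real n) * real n" by (intro mult_right_mono) auto
      then show ?thesis by (simp add: power2_eq_square algebra_simps)
    qed
    also have "\<dots> = exp (- 1) ^ n" by (rule exp_of_nat_mult)
    finally show ?thesis by simp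
  qed
  have lim: "(\<lambda>n. exp (- 1 :: real) ^ n) \<longlonglongrightarrow> 0" by (rule LIMSEQ_realpow_zero) auto
  show ?thesis
  proof (rule tendsto_sandwich[OF _ _ tendsto_const lim])
    show "\<forall>\<^sub>F n in sequentially. measure_pmf.prob (S2 n)
        {K. real (card (cocycles1 n K G)) \<ge> exp (\<epsilon> * real n ^ 2)} \<le> exp (- 1) ^ n"
      unfolding eventually_sequentially using bound by blast
  qed simp
qed

lemma finite_zmod: "p > 0 \<Longrightarrow> finite (carrier (zmod p))"
  by (simp add: zmod_carrier range_mod)

lemma prob_many_zmod_cocycles:
  assumes "p > 0" "\<epsilon> > 0"
  shows "(\<lambda>n. measure_pmf.prob (S2 n) {K. real (card (cocycles1 n K (add_monoid (zmod p)))) \<ge> exp (\<epsilon> * real n ^ 2)}) \<longlonglongrightarrow> 0"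
  using assms by (intro group.prob_many_cocycles abelian_group.a_group abelian_group_zmod) (simp_all add: finite_zmod)

lemma dim_in_prob:
  assumes p: "prime p"
  shows "tendsto_in_prob S2
     (\<lambda>n K. real (vectorspace.dim (residue_ring (int p)) (homology (residue_ring (int p)) K 1)) / real n ^ 2) 0"
  unfolding tendsto_in_prob_def
proof (intro allI impI)
  fix \<epsilon> :: real assume eps: "\<epsilon> > 0"
  define d where "d = (\<lambda>K :: nat set set. vectorspace.dim (residue_ring (int p)) (homology (residue_ring (int p)) K 1))"
  \<comment> \<open>The event of having at least \<open>p\<close> to the power
    \<open>\<epsilon> * n^2\<close> cocycles, which a large dimension forces.\<close>
  define B where "B = (\<lambda>n. {K. real (card (cocycles1 n K (add_monoid (zmod (int p))))) \<ge> exp ((\<epsilon> * ln (real p)) * real n ^ 2)})"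
  have p1: "real p > 1" using prime_gt_1_nat[OF p] by simp
  have le: "measure_pmf.prob (S2 n) {K. \<bar>real (d K) / real n ^ 2 - 0\<bar> > \<epsilon>} \<le> measure_pmf.prob (S2 n) (B n)"
    if n: "n \<ge> 3" for n
  proof (rule measure_pmf.finite_measure_mono_AE)
    have "K \<in> B n" if K: "K \<in> set_pmf (S2 n)" and big: "\<bar>real (d K) / real n ^ 2 - 0\<bar> > \<epsilon>" for K
    proof -
      interpret two_complex n K by (rule two_complex_S2[OF n K])
      have "real (d K) / real n ^ 2 > \<epsilon>" using big by simp
      then have "\<epsilon> * real n ^ 2 \<le> real (d K)" using n by (simp add: field_simps)
      then have "\<epsilon> * real n ^ 2 * ln (real p) \<le> real (d K) * ln (real p)" using p1 by (intro mult_right_mono) auto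
      then have "exp ((\<epsilon> * ln (real p)) * real n ^ 2) \<le> exp (real (d K) * ln (real p))" by (simp add: mult_ac)
      also have "\<dots> = real p ^ d K" using p1 by (simp add: exp_of_nat_mult)
      also have "\<dots> \<le> real (card (cocycles1 n K (add_monoid (zmod (int p)))))"
        using dim_H1_cocycles[OF p] by (simp only: d_def of_nat_power[symmetric] of_nat_le_iff)
      finally show ?thesis by (simp add: B_def)
    qed
    then show "AE K in measure_pmf (S2 n). K \<in> {K. \<bar>real (d K) / real n ^ 2 - 0\<bar> > \<epsilon>} \<longrightarrow> K \<in> B n"
      by (simp add: AE_measure_pmf_iff)
  qed simp
  have lim: "(\<lambda>n. measure_pmf.prob (S2 n) (B n)) \<longlonglongrightarrow> 0"
    unfolding B_def using p1 eps by (intro prob_many_zmod_cocycles) auto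
  have "(\<lambda>n. measure_pmf.prob (S2 n) {K. \<bar>real (d K) / real n ^ 2 - 0\<bar> > \<epsilon>}) \<longlonglongrightarrow> 0"
    by (rule tendsto_sandwich[OF _ eventually_sequentiallyI[OF le] tendsto_const lim]) simp_all
  then show "(\<lambda>n. measure_pmf.prob (S2 n) {K. \<bar>real (vectorspace.dim (residue_ring (int p)) (homology (residue_ring (int p)) K 1))
      / real n ^ 2 - 0\<bar> > \<epsilon>}) \<longlonglongrightarrow> 0"
    by (simp only: d_def)
qed

text \<open>\<open>P\<close> and \<open>\<delta>\<close> depend on \<open>\<epsilon>\<close> only,
  so the union bound runs over a set of primes that stays fixed while \<open>n\<close>
  grows.\<close>

lemma min_generators_in_prob:
  "tendsto_in_prob S2 (\<lambda>n K. real (min_generators (add_monoid (homology \<Z> K 1))) / real n ^ 2) 0"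
  unfolding tendsto_in_prob_def
proof (intro allI impI)
  fix \<epsilon> :: real assume eps: "\<epsilon> > 0"
  define d where "d = (\<lambda>K :: nat set set. min_generators (add_monoid (homology \<Z> K 1)))"
  \<comment> \<open>Ensures \<open>6 / ln P \<le> \<epsilon> / 2\<close>: half of the allowance
    covers the generators left after the primes below \<open>P\<close>.\<close>
  obtain P0 :: nat where P0: "real P0 > exp (12 / \<epsilon>)" using reals_Archimedean2 by blast
  define P where "P = max 3 P0"
  have P: "P > 2" "real P > exp (12 / \<epsilon>)" using P0 by (auto simp: P_def)
  have "12 / \<epsilon> < ln (real P)" using P by (subst ln_ge_iff[symmetric] exp_less_cancel_iff[symmetric]) auto
  then have lnP: "6 / ln (real P) \<le> \<epsilon> / 2" using eps P by (simp add: field_simps)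
  let ?Q = "{p. prime p \<and> p < P}"
  have finQ: "finite ?Q" by (rule finite_subset[of _ "{..<P}"]) auto
  have cQ: "card ?Q \<le> P" using card_mono[of "{..<P}" ?Q] by auto
  \<comment> \<open>The other half is shared equally among the primes below \<open>P\<close>, of
    which there are at most \<open>P\<close>.\<close>
  define \<delta> where "\<delta> = \<epsilon> / (2 * real P)"
  have delta: "\<delta> > 0" using eps P by (simp add: \<delta>_def)
  define B where "B = (\<lambda>p n. {K. real (card (cocycles1 n K (add_monoid (zmod (int p))))) \<ge> exp ((\<delta> * ln (real p)) * real n ^ 2)})"
  have le: "measure_pmf.prob (S2 n) {K. \<bar>real (d K) / real n ^ 2 - 0\<bar> > \<epsilon>} \<le> (\<Sum>p\<in>?Q. measure_pmf.prob (S2 n) (B p n))"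
    if n: "n \<ge> 3" for n
  proof -
    have "K \<in> (\<Union>p\<in>?Q. B p n)" if K: "K \<in> set_pmf (S2 n)" and big: "\<bar>real (d K) / real n ^ 2 - 0\<bar> > \<epsilon>" for K
    proof (rule ccontr)
      assume nB: "K \<notin> (\<Union>p\<in>?Q. B p n)"
      interpret two_complex n K by (rule two_complex_S2[OF n K])
      let ?c = "\<lambda>p. real (card (cocycles1 n K (add_monoid (zmod (int p)))))"
      have each: "log (real p) (?c p) \<le> \<delta> * real n ^ 2" if p: "p \<in> ?Q" for p
      proof -
        have p1: "real p > 1" using p prime_gt_1_nat by auto
        have lt: "?c p < exp ((\<delta> * ln (real p)) * real n ^ 2)" using nB p by (auto simp: B_def not_le)
        have "?c p \<ge> 1"
          using group.card_cocycles1_pos[OF abelian_group.a_group[OF abelian_group_zmod], of "int p" K n] p1 K_sub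
          by (auto simp: finite_zmod)
        then have "ln (?c p) \<le> ln (exp ((\<delta> * ln (real p)) * real n ^ 2))"
          using lt by (subst ln_le_cancel_iff) auto
        then have "ln (?c p) \<le> (\<delta> * real n ^ 2) * ln (real p)" by (simp add: mult_ac)
        then show ?thesis using p1 by (simp add: log_def pos_divide_le_eq)
      qed
      have "real (d K) \<le> (\<Sum>p\<in>?Q. log (real p) (?c p)) + 6 * real n ^ 2 / ln (real P)"
        unfolding d_def by (rule min_generators_H1_cocycles[OF P(1)])
      also have "(\<Sum>p\<in>?Q. log (real p) (?c p)) \<le> (\<Sum>p\<in>?Q. \<delta> * real n ^ 2)"
        by (rule sum_mono) (rule each)
      also have "\<dots> = real (card ?Q) * (\<delta> * real n ^ 2)" by simp
      also have "\<dots> \<le> real P * (\<delta> * real n ^ 2)"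
        using cQ delta by (intro mult_right_mono) auto
      also have "\<dots> = \<epsilon> / 2 * real n ^ 2" using P by (simp add: \<delta>_def)
      also have "6 * real n ^ 2 / ln (real P) \<le> \<epsilon> / 2 * real n ^ 2"
        using mult_right_mono[OF lnP, of "real n ^ 2"] by simp
      finally have "real (d K) \<le> \<epsilon> * real n ^ 2" by simp
      then have "real (d K) / real n ^ 2 \<le> \<epsilon>" using n by (simp add: field_simps)
      then show False using big by simp
    qed
    then have "measure_pmf.prob (S2 n) {K. \<bar>real (d K) / real n ^ 2 - 0\<bar> > \<epsilon>} \<le> measure_pmf.prob (S2 n) (\<Union>p\<in>?Q. B p n)"
      by (intro measure_pmf.finite_measure_mono_AE) (simp_all add: AE_measure_pmf_iff)
    also have "\<dots> \<le> (\<Sum>p\<in>?Q. measure_pmf.prob (S2 n) (B p n))"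
      by (rule measure_pmf.finite_measure_subadditive_finite[OF finQ]) simp
    finally show ?thesis .
  qed
  have lim: "(\<lambda>n. \<Sum>p\<in>?Q. measure_pmf.prob (S2 n) (B p n)) \<longlonglongrightarrow> 0"
  proof (rule tendsto_null_sum)
    fix p assume "p \<in> ?Q"
    then have "real p > 1" using prime_gt_1_nat by auto
    then show "(\<lambda>n. measure_pmf.prob (S2 n) (B p n)) \<longlonglongrightarrow> 0"
      unfolding B_def using delta by (intro prob_many_zmod_cocycles) auto
  qed
  have "(\<lambda>n. measure_pmf.prob (S2 n) {K. \<bar>real (d K) / real n ^ 2 - 0\<bar> > \<epsilon>}) \<longlonglongrightarrow> 0"
    by (rule tendsto_sandwich[OF _ eventually_sequentiallyI[OF le] tendsto_const lim]) simp_all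
  then show "(\<lambda>n. measure_pmf.prob (S2 n) {K. \<bar>real (min_generators (add_monoid (homology \<Z> K 1))) / real n ^ 2 - 0\<bar> > \<epsilon>}) \<longlonglongrightarrow> 0"
    by (simp only: d_def)
qed

theorem theorem4:
  shows "(\<forall>G :: ('g, 'm) monoid_scheme. comm_group G \<and> finite (carrier G) \<longrightarrow>
            (\<lambda>n. ln (measure_pmf.expectation (S2 n) (\<lambda>K. real (card (cocycles1 n K G)))) / real n ^ 2)
              \<longlonglongrightarrow> 0) \<and>
         (\<forall>p :: nat. prime p \<longrightarrow>
            tendsto_in_prob S2
              (\<lambda>n K. real (vectorspace.dim (residue_ring (int p)) (homology (residue_ring (int p)) K 1))
                       / real n ^ 2) 0) \<and>
         tendsto_in_prob S2
           (\<lambda>n K. real (min_generators (add_monoid (homology \<Z> K 1))) / real n ^ 2) 0"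
proof (intro conjI allI impI)
  fix G :: "('g, 'm) monoid_scheme" assume G: "comm_group G \<and> finite (carrier G)"
  then have "group G" by (simp add: comm_group_def)
  then show "(\<lambda>n. ln (measure_pmf.expectation (S2 n) (\<lambda>K. real (card (cocycles1 n K G)))) / real n ^ 2)
      \<longlonglongrightarrow> 0"
    using G by (intro group.ln_expectation_cocycles) simp_all
qed (rule dim_in_prob min_generators_in_prob; assumption?)+

end
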